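(* Suppose $V$ is $\alpha$-strongly convex and $\beta$-smooth ($0<\alpha\le\beta$), let $\hat\pi$ be the minimizer of $\mathcal F$ over $\mathsf{BW}(\mathbb R^d)$, and let $0<\eta\le\frac{\alpha^2}{48\beta^3}$. Then the iterates of Stochastic FB--GVI satisfy, for every $N\ge0$, $$\mathbb E\,W_2^2(p_N,\hat\pi)\le\exp\Big(-\frac{\alpha N\eta}{2}\Big)W_2^2(p_0,\hat\pi)+\frac{24\beta\eta d}{\alpha}.$$
   Context: $\mathsf{BW}(\mathbb R^d)$ is the set of Gaussian distributions $\mathcal N(m,\Sigma)$ on $\mathbb R^d$ with $m\in\mathbb R^d$ and $\Sigma$ symmetric positive definite, endowed with the 2-Wasserstein distance $W_2$. $V:\mathbb R^d\to\mathbb R$ is twice continuously differentiable; it is $\beta$-smooth if $-\beta I\preceq\nabla^2V(x)\preceq\beta I$ for all $x$, and $\alpha$-strongly convex ($\alpha>0$) if $\alpha I\preceq\nabla^2V(x)$ for all $x$. Potential $\mathcal V(\mu)=\int V\,d\mu$, entropy $\mathcal H(\mu)=\int\log\mu(x)\,d\mu(x)$ (identifying $\mu$ with its Lebesgue density), $\mathcal F=\mathcal V+\mathcal H$. Stochastic FB--GVI with step size $\eta>0$ and initialization $p_0=\mathcal N(m_0,\Sigma_0)\in\mathsf{BW}(\mathbb R^d)$: given $p_k=\mathcal N(m_k,\Sigma_k)$, draw $\hat X_k\sim p_k$ independently of everything else conditionally on the past, set $b_k=\nabla V(\hat X_k)$, $S_k=\nabla^2V(\hat X_k)$, $m_{k+1}=m_k-\eta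 b_k$, $\Sigma_{k+1/2}=(I-\eta S_k)\Sigma_k(I-\eta S_k)$, $\Sigma_{k+1}=\tfrac12\big(\Sigma_{k+1/2}+2\eta I+[\Sigma_{k+1/2}(\Sigma_{k+1/2}+4\eta I)]^{1/2}\big)$ (principal PSD square root; the two factors commute), and $p_{k+1}=\mathcal N(m_{k+1},\Sigma_{k+1})$ (a random Gaussian). Expectations are over all the randomness of the samples. *)

theory Defs
  imports "HOL-Analysis.Analysis" "HOL-Probability.Probability"
begin

definition sym_pd :: "real^'d^'d \<Rightarrow> bool" where
  "sym_pd S \<longleftrightarrow> transpose S = S \<and> (\<forall>x. x \<noteq> 0 \<longrightarrow> x \<bullet> (S *v x) > 0)"

definition sym_psd :: "real^'d^'d \<Rightarrow> bool" where
  "sym_psd S \<longleftrightarrow> transpose S = S \<and> (\<forall>x. x \<bullet> (S *v x) \<ge> 0)"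

definition psd_sqrt :: "real^'d^'d \<Rightarrow> real^'d^'d" where
  "psd_sqrt A = (THE B. sym_psd B \<and> B ** B = A)"

definition gauss_dens :: "real^'d \<Rightarrow> real^'d^'d \<Rightarrow> real^'d \<Rightarrow> real" where
  "gauss_dens m S x =
     exp (- ((x - m) \<bullet> (matrix_inv S *v (x - m))) / 2)
     / sqrt ((2 * pi) ^ CARD('d) * det S)"

definition gauss :: "real^'d \<Rightarrow> real^'d^'d \<Rightarrow> (real^'d) measure" where
  "gauss m S = density lborel (\<lambda>x. ennreal (gauss_dens m S x))"

definition coupling :: "(real^'d) measure \<Rightarrow> (real^'d) measure \<Rightarrow> ((real^'d) \<times> (real^'d)) measure \<Rightarrow> bool" where
  "coupling \<mu> \<nu> \<pi> \<longleftrightarrow> prob_space \<pi> \<and> sets \<pi> = sets (borel :: ((real^'d) \<times> (real^'d)) measure)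
     \<and> distr \<pi> borel fst = \<mu> \<and> distr \<pi> borel snd = \<nu>"

definition W2sq :: "(real^'d) measure \<Rightarrow> (real^'d) measure \<Rightarrow> ennreal" where
  "W2sq \<mu> \<nu> = (INF \<pi> \<in> {\<pi>. coupling \<mu> \<nu> \<pi>}. \<integral>\<^sup>+ z. ennreal ((norm (fst z - snd z))\<^sup>2) \<partial>\<pi>)"

definition potential :: "(real^'d \<Rightarrow> real) \<Rightarrow> (real^'d) measure \<Rightarrow> real" where
  "potential V \<mu> = (\<integral> x. V x \<partial>\<mu>)"

definition entropy_dens :: "(real^'d \<Rightarrow> real) \<Rightarrow> real" where
  "entropy_dens f = (\<integral> x. ln (f x) \<partial>(density lborel (\<lambda>x. ennreal (f x))))"

definition free_energy :: "(real^'d \<Rightarrow> real) \<Rightarrow> real^'d \<Rightarrow> real^'d^'d \<Rightarrow> real" where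
  "free_energy V m S = potential V (gauss m S) + entropy_dens (gauss_dens m S)"

definition fbgvi_update ::
  "(real^'d \<Rightarrow> real^'d) \<Rightarrow> (real^'d \<Rightarrow> real^'d^'d) \<Rightarrow> real \<Rightarrow>
   (real^'d) \<times> (real^'d^'d) \<Rightarrow> real^'d \<Rightarrow> (real^'d) \<times> (real^'d^'d)" where
  "fbgvi_update gradV hessV \<eta> s xh =
     (let m = fst s; S = snd s;
          A = mat 1 - \<eta> *\<^sub>R hessV xh;
          Sh = A ** S ** A
      in (m - \<eta> *\<^sub>R gradV xh,
          (1/2) *\<^sub>R (Sh + (2 * \<eta>) *\<^sub>R mat 1 + psd_sqrt (Sh ** (Sh + (4 * \<eta>) *\<^sub>R mat 1)))))"

definition fbgvi_kernel ::
  "(real^'d \<Rightarrow> real^'d) \<Rightarrow> (real^'d \<Rightarrow> real^'d^'d) \<Rightarrow> real \<Rightarrow>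
   (real^'d) \<times> (real^'d^'d) \<Rightarrow> ((real^'d) \<times> (real^'d^'d)) measure" where
  "fbgvi_kernel gradV hessV \<eta> s =
     distr (gauss (fst s) (snd s)) borel (fbgvi_update gradV hessV \<eta> s)"

fun fbgvi_law ::
  "(real^'d \<Rightarrow> real^'d) \<Rightarrow> (real^'d \<Rightarrow> real^'d^'d) \<Rightarrow> real \<Rightarrow>
   real^'d \<Rightarrow> real^'d^'d \<Rightarrow> nat \<Rightarrow> ((real^'d) \<times> (real^'d^'d)) measure" where
  "fbgvi_law gradV hessV \<eta> m0 S0 0 = return borel (m0, S0)"
| "fbgvi_law gradV hessV \<eta> m0 S0 (Suc k) =
     fbgvi_law gradV hessV \<eta> m0 S0 k \<bind> fbgvi_kernel gradV hessV \<eta>"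

end

theory Submission
  imports Defs
begin

text \<open>
  Write a Gaussian \<open>N(m, S)\<close> as the law of \<open>m + B Z\<close> with \<open>Z\<close> standard normal and \<open>B B\<^sup>T = S\<close>, so that all
  expectations are expectations over \<open>Z\<close>, and let \<open>K\<close> be the square root of the target covariance. The squared
  distance to the target is the minimum of \<open>|m - mh|\<^sup>2 + |B - K|\<^sup>2\<close> (Frobenius norm) over all such \<open>B\<close>.

  The covariance update is the proximal step of the entropy for this distance and satisfies an evolution
  variational inequality, which follows from \<open>tr (P Q) \<ge> d + ln det P + ln det Q\<close> for positive definite \<open>P\<close>,
  \<open>Q\<close>. Adding the expanded square of the gradient step, the minimality of the free energy and smoothness of
  \<open>V\<close>, the first order terms collapse, in expectation and by Stein's identity, to
  \<open>E \<langle>\<nabla>V(X), X - Y\<rangle>\<close>, which strong convexity bounds below; what remains is \<open>\<eta>\<^sup>2\<close> times the variance of the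
  stochastic gradient. Cocoercivity of \<open>\<nabla>V\<close> bounds that variance by \<open>2 \<beta> E \<langle>\<nabla>V(X), B Z\<rangle>\<close>, and the stationarity of
  the target under dilations bounds this in turn by a multiple of \<open>d + \<beta>\<^sup>2/\<alpha>\<close> times the squared distance.
\<close>

text \<open>The obstacle is that factors do not stay optimal: the forward step turns a factor
  \<open>B\<close> into \<open>A ** B\<close> with
  \<open>A = mat 1 - \<eta> *\<^sub>R hessV x\<close>, the backward step multiplies by one more
  matrix \<open>R\<close>, and these products are in general not even symmetric. The one-step
  inequality is therefore stated for an arbitrary factor. The evolution variational inequality keeps
  the square |R C - C|^2 with a negative sign; it pays for the smoothness error along the
  displacement of the factor. The step size restriction enters twice: as \<eta> \<beta> \<le> 1/2,
  and to absorb the variance term 7 \<eta>^2 \<beta>^3 / \<alpha> times the squared distance into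
  half of the contraction rate \<alpha> \<eta>. The additive constant of the theorem is the fixed
  point of D -> (1 - \<alpha> \<eta> / 2) D + 12 \<beta> \<eta>^2 d. On the measure side, the
  transition kernel is known to be a probability only at states with positive definite covariance,
  while \<open>bind\<close> behaves well for kernels into subprobabilities. The distance is set to
  infinity at all other states, and its finite integral shows that they form a null set.\<close>

declare transpose_matrix_vector [simp del] vector_transpose_matrix [simp del]

subsection \<open>Matrix algebra and the Frobenius inner product\<close>

lemma bounded_bilinear_matrix_mult:
  "bounded_bilinear ((**) :: real^'n^'m \<Rightarrow> real^'p^'n \<Rightarrow> real^'p^'m)"
  unfolding bilinear_conv_bounded_bilinear[symmetric] bilinear_def
  by (auto intro!: linearI
      simp: matrix_matrix_mult_def vec_eq_iff sum.distrib sum_distrib_left algebra_simps)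

interpretation matmul: bounded_bilinear "(**) :: real^'n^'m \<Rightarrow> real^'p^'n \<Rightarrow> real^'p^'m"
  by (rule bounded_bilinear_matrix_mult)

lemma bounded_bilinear_matrix_vector:
  "bounded_bilinear ((*v) :: real^'n^'m \<Rightarrow> real^'n \<Rightarrow> real^'m)"
  unfolding bilinear_conv_bounded_bilinear[symmetric] bilinear_def
  by (auto intro!: linearI
      simp: matrix_vector_mult_def vec_eq_iff sum.distrib sum_distrib_left algebra_simps)

interpretation matvec: bounded_bilinear "(*v) :: real^'n^'m \<Rightarrow> real^'n \<Rightarrow> real^'m"
  by (rule bounded_bilinear_matrix_vector)

lemma transpose_add: "transpose (A + B) = transpose A + transpose (B :: real^'n^'m)"
  by (simp add: transpose_def vec_eq_iff)

lemma transpose_diff: "transpose (A - B) = transpose A - transpose (B :: real^'n^'m)"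
  by (simp add: transpose_def vec_eq_iff)

lemma inner_matrix_vector_transpose:
  "(A *v x) \<bullet> y = x \<bullet> (transpose A *v (y :: real^'m))" for A :: "real^'n^'m"
  by (metis dot_lmul_matrix inner_commute transpose_matrix_vector)

lemma matrix_inner_eq_sum:
  "A \<bullet> B = (\<Sum>i\<in>UNIV. \<Sum>j\<in>UNIV. A $ i $ j * B $ i $ j)" for A :: "real^'n^'m"
  by (simp add: inner_vec_def)

lemma matrix_inner_eq_trace: "A \<bullet> B = trace (A ** transpose B)" for A :: "real^'n^'m"
  by (simp add: matrix_inner_eq_sum trace_def matrix_matrix_mult_def transpose_def)

lemma matrix_inner_mult_right: "(A ** P) \<bullet> B = A \<bullet> (B ** transpose P)"
  for A :: "real^'n^'m" and P :: "real^'k^'n"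
  by (simp add: matrix_inner_eq_trace matrix_transpose_mul matrix_mul_assoc)

lemma matrix_vector_axis_nth: "(A *v axis j 1) $ i = A $ i $ j" for A :: "real^'n^'m"
  by (simp add: matrix_vector_mul_component inner_axis)

lemma matrix_inner_eq_sum_axis:
  "A \<bullet> B = (\<Sum>j\<in>UNIV. (A *v axis j 1) \<bullet> (B *v axis j 1))" for A :: "real^'n^'m"
  unfolding matrix_inner_eq_sum inner_vec_def matrix_vector_axis_nth
  by (subst sum.swap) simp

lemma inner_mat_1: "mat 1 \<bullet> (mat 1 :: real^'n^'n) = real CARD('n)"
  by (simp add: matrix_inner_eq_trace trace_I)

subsection \<open>Positive definite matrices\<close>

lemma sym_pd_imp_psd: "sym_pd S \<Longrightarrow> sym_psd S"
  unfolding sym_pd_def sym_psd_def by (metis inner_zero_left less_eq_real_def)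

lemma matrix_inv_mult:
  assumes "det (A :: real^'n^'n) \<noteq> 0"
  shows "A ** matrix_inv A = mat 1" "matrix_inv A ** A = mat 1"
proof -
  have "\<exists>B. A ** B = mat 1 \<and> B ** A = mat 1"
    using assms by (simp add: invertible_det_nz[symmetric] invertible_def)
  from someI_ex[OF this] show "A ** matrix_inv A = mat 1" "matrix_inv A ** A = mat 1"
    by (simp_all add: matrix_inv_def)
qed

lemma matrix_inv_unique:
  assumes "A ** B = mat 1"
  shows "matrix_inv (A :: real^'n^'n) = B"
proof -
  have "det A \<noteq> 0" using assms by (metis det_I det_mul mult_zero_left zero_neq_one)
  then show ?thesis
    by (metis assms matrix_inv_mult(2) matrix_mul_assoc matrix_mul_lid matrix_mul_rid)
qed

lemma sym_pd_det_nz: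
  assumes "sym_pd S"
  shows "det (S :: real^'d^'d) \<noteq> 0"
proof -
  have "\<forall>x. S *v x = 0 \<longrightarrow> x = 0" using assms unfolding sym_pd_def
    by (metis inner_zero_right less_irrefl)
  then show ?thesis
    by (metis matrix_left_invertible_ker invertible_left_inverse invertible_det_nz)
qed

lemma sym_psd_form_zero:
  assumes "sym_psd N" "x \<bullet> (N *v x) = 0"
  shows "N *v x = 0"
proof (rule ccontr)
  assume nz: "N *v x \<noteq> 0"
  define a where "a = (N *v x) \<bullet> (N *v x)"
  define b where "b = (N *v x) \<bullet> (N *v (N *v x))"
  have a: "a > 0" using nz by (simp add: a_def)
  have b: "b \<ge> 0" using assms by (simp add: b_def sym_psd_def)
  \<comment> \<open>This \<open>t\<close> minimises \<open>2 * t * a + t\<^sup>2 * (b + 1)\<close>,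
    a bound for the form on the line \<open>x + t N x\<close>; the \<open>+ 1\<close> avoids a
    division by zero when \<open>b = 0\<close>.\<close>
  define t where "t = - a / (b + 1)"
  have sym: "x \<bullet> (N *v (N *v x)) = a"
    using assms by (simp add: a_def sym_psd_def inner_matrix_vector_transpose)
  have "0 \<le> (x + t *\<^sub>R (N *v x)) \<bullet> (N *v (x + t *\<^sub>R (N *v x)))"
    using assms by (simp add: sym_psd_def)
  also have "\<dots> = 2 * t * a + t\<^sup>2 * b"
    using assms(2) sym
    by (simp add: matvec.add_right matvec.scaleR_right inner_add_left inner_add_right
        a_def b_def power2_eq_square algebra_simps)
  also have "\<dots> \<le> 2 * t * a + t\<^sup>2 * (b + 1)" by (simp add: algebra_simps)
  also have "\<dots> = - a\<^sup>2 / (b + 1)" using b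
    by (simp add: t_def power2_eq_square divide_simps)
  also have "\<dots> < 0" using a b by (simp add: divide_neg_pos)
  finally show False by simp
qed

lemma sym_pd_iff_psd_det: "sym_pd S \<longleftrightarrow> sym_psd S \<and> det S \<noteq> 0" for S :: "real^'d^'d"
proof
  assume R: "sym_psd S \<and> det S \<noteq> 0"
  have "x = 0" if "x \<bullet> (S *v x) = 0" for x
  proof -
    have "S *v x = 0" using R that sym_psd_form_zero by blast
    then show ?thesis
      by (metis R matrix_inv_mult(2) matrix_vector_mul_assoc matrix_vector_mul_lid matrix_vector_mult_0_right)
  qed
  then show "sym_pd S" using R unfolding sym_pd_def sym_psd_def by (metis order_le_less)
qed (simp add: sym_pd_imp_psd sym_pd_det_nz)

lemma sym_psd_congruence:
  assumes "sym_psd S" shows "sym_psd (B ** S ** transpose B)"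
proof -
  have "x \<bullet> ((B ** S ** transpose B) *v x) = (transpose B *v x) \<bullet> (S *v (transpose B *v x))" for x
    by (metis inner_matrix_vector_transpose matrix_vector_mul_assoc transpose_transpose)
  then show ?thesis using assms
    by (simp add: sym_psd_def matrix_transpose_mul matrix_mul_assoc)
qed

lemma sym_pd_congruence:
  assumes "sym_pd S" "det B \<noteq> 0" shows "sym_pd (B ** S ** transpose B)"
  using assms by (simp add: sym_pd_iff_psd_det sym_psd_congruence det_mul)

lemma sym_pd_mat_1: "sym_pd (mat 1)"
  by (simp add: sym_pd_def)

lemma sym_pd_factor: "det B \<noteq> 0 \<Longrightarrow> sym_pd (B ** transpose B)"
  using sym_pd_congruence[OF sym_pd_mat_1] by simp

lemma sym_pd_inv:
  assumes "sym_pd S" shows "sym_pd (matrix_inv S)"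
proof -
  have d: "det S \<noteq> 0" by (rule sym_pd_det_nz[OF assms])
  have t: "transpose S = S" using assms by (simp add: sym_pd_def)
  have "S ** transpose (matrix_inv S) = mat 1"
    using matrix_inv_mult(2)[OF d] by (metis t matrix_transpose_mul transpose_mat)
  then have ti: "transpose (matrix_inv S) = matrix_inv S" by (metis matrix_inv_unique)
  have "det (matrix_inv S) \<noteq> 0"
    using matrix_inv_mult(1)[OF d] by (metis det_I det_mul mult_zero_right zero_neq_one)
  from sym_pd_congruence[OF assms this] show ?thesis
    by (simp add: ti matrix_inv_mult[OF d])
qed

lemma sym_pd_add_psd:
  assumes "sym_pd A" "sym_psd B" shows "sym_pd (A + B)"
  using assms by (auto simp: sym_pd_def sym_psd_def transpose_add matvec.add_left inner_add_right add_pos_nonneg)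

lemma sym_psd_scaleR: "0 \<le> c \<Longrightarrow> sym_psd A \<Longrightarrow> sym_psd (c *\<^sub>R A)"
  by (simp add: sym_psd_def transpose_scalar matvec.scaleR_left)

lemma sym_pd_scaleR: "0 < c \<Longrightarrow> sym_pd A \<Longrightarrow> sym_pd (c *\<^sub>R A)"
  by (simp add: sym_pd_def transpose_scalar matvec.scaleR_left)

text \<open>This is \<open>N\<^sup>2 \<le> c N\<close>, read off from the form of \<open>N\<close>
  at \<open>c x - N x\<close>. Applied to the Hessian it is the infinitesimal form of
  cocoercivity.\<close>

lemma sym_psd_norm_sq_le:
  assumes N: "sym_psd N" and le: "\<And>x. x \<bullet> (N *v x) \<le> c * (x \<bullet> x)"
  shows "(norm (N *v x))\<^sup>2 \<le> c * (x \<bullet> (N *v x))"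
proof (cases "c = 0")
  case True
  have "x \<bullet> (N *v x) = 0" using le[of x] N True by (simp add: sym_psd_def order_antisym)
  then show ?thesis using sym_psd_form_zero[OF N] by simp
next
  case False
  have "0 \<le> c * (axis undefined 1 \<bullet> (axis undefined 1 :: real^'a))"
    using le N unfolding sym_psd_def by (meson order_trans)
  then have c: "c > 0" using False by (simp add: inner_axis_axis)
  have t: "transpose N = N" using N by (simp add: sym_psd_def)
  let ?y = "N *v x"
  have "0 \<le> (c *\<^sub>R x - ?y) \<bullet> (N *v (c *\<^sub>R x - ?y))" using N by (simp add: sym_psd_def)
  also have "\<dots> = c\<^sup>2 * (x \<bullet> ?y) - 2 * c * (?y \<bullet> ?y) + ?y \<bullet> (N *v ?y)"
    using inner_matrix_vector_transpose[of N x ?y] t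
    by (simp add: matvec.diff_right matvec.scaleR_right inner_diff_left inner_diff_right
        power2_eq_square algebra_simps)
  also have "\<dots> \<le> c\<^sup>2 * (x \<bullet> ?y) - 2 * c * (?y \<bullet> ?y) + c * (?y \<bullet> ?y)"
    using le by simp
  also have "\<dots> = c * (c * (x \<bullet> ?y) - ?y \<bullet> ?y)" by (simp add: power2_eq_square algebra_simps)
  finally show ?thesis using c by (simp add: zero_le_mult_iff power2_norm_eq_inner)
qed

lemma sym_pd_bounds:
  assumes "sym_pd (S :: real^'d^'d)"
  obtains c C where "0 < c" "c \<le> C" "\<And>x. c * (x \<bullet> x) \<le> x \<bullet> (S *v x)" "\<And>x. x \<bullet> (S *v x) \<le> C * (x \<bullet> x)"
proof -
  let ?s = "sphere (0 :: real^'d) 1" and ?f = "\<lambda>x. x \<bullet> (S *v x)"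
  have ne: "?s \<noteq> {}" using norm_axis_1[of "undefined::'d"] by (force simp: )
  have cont: "continuous_on ?s ?f"
    by (intro continuous_intros matvec.continuous_on)
  obtain a where a: "a \<in> ?s" "\<And>x. x \<in> ?s \<Longrightarrow> ?f a \<le> ?f x"
    using continuous_attains_inf[OF compact_sphere ne cont] by blast
  obtain b where b: "b \<in> ?s" "\<And>x. x \<in> ?s \<Longrightarrow> ?f x \<le> ?f b"
    using continuous_attains_sup[OF compact_sphere ne cont] by blast
  have hom: "?f x = (?f (sgn x)) * (x \<bullet> x)" if "x \<noteq> 0" for x
    using that by (simp add: sgn_div_norm matvec.scaleR_right power2_norm_eq_inner[symmetric] power2_eq_square field_simps)
  have sg: "sgn x \<in> ?s" if "x \<noteq> 0" for x :: "real^'d" using that by (simp add: norm_sgn)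
  show ?thesis
  proof
    show "0 < ?f a" using assms a(1) unfolding sym_pd_def by (metis mem_sphere_0 norm_zero zero_neq_one)
    show "?f a \<le> ?f b" using a b by blast
    show "?f a * (x \<bullet> x) \<le> ?f x" for x
      by (cases "x = 0") (auto simp: hom[of x] intro!: mult_right_mono a(2) sg simp del: mem_sphere_0)
    show "?f x \<le> ?f b * (x \<bullet> x)" for x
      by (cases "x = 0") (auto simp: hom[of x] intro!: mult_right_mono b(2) sg simp del: mem_sphere_0)
  qed
qed

subsection \<open>Square roots\<close>

lemma matrix_eqI_axis: "(\<And>j. A *v axis j 1 = B *v axis j 1) \<Longrightarrow> A = (B :: real^'n^'m)"
  by (simp add: vec_eq_iff) (metis matrix_vector_axis_nth)

text \<open>Holds column by column. It lets an operator norm bound contract Frobenius distances in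
  the fixed point argument for square roots.\<close>

lemma norm_matrix_mult_left_le:
  fixes A :: "real^'n^'m" and E :: "real^'p^'n"
  assumes "0 \<le> q" "\<And>x. norm (A *v x) \<le> q * norm x"
  shows "norm (A ** E) \<le> q * norm E"
proof -
  have "(norm (A ** E))\<^sup>2 = (\<Sum>j\<in>UNIV. (norm (A *v (E *v axis j 1)))\<^sup>2)"
    by (simp add: power2_norm_eq_inner matrix_inner_eq_sum_axis[of "A ** E"] matrix_vector_mul_assoc[symmetric])
  also have "\<dots> \<le> (\<Sum>j\<in>UNIV. (q * norm (E *v axis j 1))\<^sup>2)"
    by (intro sum_mono power_mono assms norm_ge_zero)
  also have "\<dots> = (q * norm E)\<^sup>2"
    by (simp add: power_mult_distrib power2_norm_eq_inner matrix_inner_eq_sum_axis[of E E] sum_distrib_left)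
  finally show ?thesis using assms(1) by (simp add: power2_le_iff_abs_le)
qed

lemma norm_transpose: "norm (transpose A) = norm (A :: real^'n^'m)"
  unfolding norm_eq_sqrt_inner matrix_inner_eq_sum
  by (subst sum.swap) (simp add: transpose_def)

text \<open>The root is sought as \<open>mat 1 - Y\<close>: its square is \<open>A\<close> exactly
  when \<open>Y\<close> is a fixed point of \<open>f\<close>. On symmetric matrices of operator norm
  at most \<open>q = 1 - c < 1\<close> the map \<open>f\<close> is a \<open>q\<close>-contraction,
  and the same norm bound makes \<open>mat 1 - Y\<close> positive semidefinite.\<close>

lemma psd_sqrt_exists_contraction:
  fixes A :: "real^'d^'d"
  assumes t: "transpose A = A" and c: "0 < c" and lo: "\<And>x. c * (x \<bullet> x) \<le> x \<bullet> (A *v x)"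
    and hi: "\<And>x. x \<bullet> (A *v x) \<le> x \<bullet> x"
  shows "\<exists>B. sym_psd B \<and> B ** B = A"
proof -
  define q where "q = 1 - c"
  have "c * (axis undefined 1 \<bullet> (axis undefined 1 :: real^'d)) \<le> axis undefined 1 \<bullet> (axis undefined 1 :: real^'d)"
    using lo hi by (meson order_trans)
  then have q: "0 \<le> q" "q < 1" using c by (simp_all add: q_def inner_axis_axis)
  define W where "W = {Y :: real^'d^'d. transpose Y = Y \<and> (\<forall>x. norm (Y *v x) \<le> q * norm x)}"
  define f where "f Y = (1/2) *\<^sub>R ((mat 1 - A) + Y ** Y)" for Y :: "real^'d^'d"
  have psd: "sym_psd (mat 1 - A)"
    using t hi by (simp add: sym_psd_def transpose_diff matvec.diff_left inner_diff_right)
  have IA: "norm ((mat 1 - A) *v x) \<le> q * norm x" for x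
  proof -
    have h: "y \<bullet> ((mat 1 - A) *v y) \<le> q * (y \<bullet> y)" for y
      using lo[of y] by (simp add: q_def matvec.diff_left inner_diff_right algebra_simps)
    have "(norm ((mat 1 - A) *v x))\<^sup>2 \<le> q * (x \<bullet> ((mat 1 - A) *v x))"
      by (rule sym_psd_norm_sq_le[OF psd h])
    also have "\<dots> \<le> q * (q * (x \<bullet> x))" using h q by (intro mult_left_mono)
    also have "\<dots> = (q * norm x)\<^sup>2" by (simp add: power2_eq_square power2_norm_eq_inner[symmetric])
    finally show ?thesis using q by (simp add: power2_le_iff_abs_le)
  qed
  have Wf: "f Y \<in> W" if Y: "Y \<in> W" for Y
  proof -
    have "norm (f Y *v x) \<le> q * norm x" for x
    proof -
      have "norm (Y *v (Y *v x)) \<le> q * norm (Y *v x)" using Y by (simp add: W_def)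
      also have "\<dots> \<le> q * (q * norm x)" using Y q by (intro mult_left_mono) (auto simp: W_def)
      finally have YY: "norm (Y *v (Y *v x)) \<le> q * (q * norm x)" .
      have "norm (f Y *v x) = (1/2) * norm ((mat 1 - A) *v x + Y *v (Y *v x))"
        by (simp add: f_def matvec.scaleR_left matvec.add_left matrix_vector_mul_assoc)
      also have "\<dots> \<le> (1/2) * (norm ((mat 1 - A) *v x) + norm (Y *v (Y *v x)))"
        by (intro mult_left_mono norm_triangle_ineq) auto
      also have "\<dots> \<le> (1/2) * (q * norm x + q * (q * norm x))"
        using IA[of x] YY by (intro mult_left_mono add_mono) auto
      also have "\<dots> \<le> (1/2) * (q * norm x + q * (1 * norm x))"
        using q by (intro mult_left_mono add_mono mult_right_mono) auto
      finally show ?thesis by simp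
    qed
    moreover have "transpose (f Y) = f Y"
      using Y t by (simp add: W_def f_def transpose_scalar transpose_add transpose_diff matrix_transpose_mul)
    ultimately show ?thesis by (simp add: W_def)
  qed
  have contr: "dist (f Y) (f Z) \<le> q * dist Y Z" if Y: "Y \<in> W" and Z: "Z \<in> W" for Y Z
  proof -
    \<comment> \<open>The norm bound in \<open>W\<close> acts from the left only; transposing moves
      \<open>Z\<close> to that side without changing the Frobenius norm.\<close>
    have "transpose ((Y - Z) ** Z) = Z ** (Y - Z)"
      using Y Z by (simp add: W_def matrix_transpose_mul transpose_diff)
    then have "norm ((Y - Z) ** Z) = norm (Z ** (Y - Z))" by (metis norm_transpose)
    then have r: "norm ((Y - Z) ** Z) \<le> q * norm (Y - Z)"
      using Z q by (simp add: W_def norm_matrix_mult_left_le)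
    have l: "norm (Y ** (Y - Z)) \<le> q * norm (Y - Z)"
      using Y q by (simp add: W_def norm_matrix_mult_left_le)
    have "f Y - f Z = (1/2) *\<^sub>R (Y ** (Y - Z) + (Y - Z) ** Z)"
      by (simp add: f_def matmul.diff_left matmul.diff_right algebra_simps)
    then have "norm (f Y - f Z) \<le> (1/2) * (norm (Y ** (Y - Z)) + norm ((Y - Z) ** Z))"
      by (simp add: norm_triangle_ineq)
    then show ?thesis using l r by (simp add: dist_norm)
  qed
  have "closed W"
  proof -
    have "W = {Y. transpose Y = Y} \<inter> (\<Inter>x. {Y. norm (Y *v x) \<le> q * norm x})"
      by (auto simp: W_def)
    moreover have "closed {Y :: real^'d^'d. transpose Y = Y}"
      unfolding transpose_def
      by (intro closed_Collect_eq continuous_intros)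
    moreover have "closed {Y :: real^'d^'d. norm (Y *v x) \<le> q * norm x}" for x
      by (intro closed_Collect_le continuous_intros matvec.continuous_on)
    ultimately show ?thesis by auto
  qed
  moreover have "0 \<in> W" using q by (simp add: W_def transpose_def vec_eq_iff matvec.zero_left)
  ultimately have "\<exists>!Y\<in>W. f Y = Y"
    using contr q by (intro Banach_fix[of W q f]) (auto intro: Wf complete_eq_closed[THEN iffD2])
  then obtain Y where Y: "Y \<in> W" "f Y = Y" by blast
  let ?B = "mat 1 - Y"
  have "2 *\<^sub>R Y = (mat 1 - A) + Y ** Y" using arg_cong[OF Y(2), of "scaleR 2"] by (simp add: f_def)
  then have "?B ** ?B = A"
    by (simp add: matmul.diff_left matmul.diff_right scaleR_2 algebra_simps)
  moreover have "sym_psd ?B"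
  proof -
    have "0 \<le> x \<bullet> (?B *v x)" for x
    proof -
      have "x \<bullet> (Y *v x) \<le> norm x * norm (Y *v x)" by (rule norm_cauchy_schwarz)
      also have "\<dots> \<le> norm x * (q * norm x)" using Y(1) by (intro mult_left_mono) (auto simp: W_def)
      also have "\<dots> \<le> norm x * (1 * norm x)" using q by (intro mult_left_mono mult_right_mono) auto
      finally show ?thesis
        by (simp add: matvec.diff_left inner_diff_right power2_norm_eq_inner[symmetric] power2_eq_square)
    qed
    then show ?thesis using Y(1) by (simp add: sym_psd_def W_def transpose_diff)
  qed
  ultimately show ?thesis by blast
qed

lemma psd_sqrt_exists:
  assumes "sym_pd (A :: real^'d^'d)"
  shows "\<exists>B. sym_psd B \<and> B ** B = A"
proof -
  obtain c C where c: "0 < c" "c \<le> C" "\<And>x. c * (x \<bullet> x) \<le> x \<bullet> (A *v x)" "\<And>x. x \<bullet> (A *v x) \<le> C * (x \<bullet> x)"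
    using sym_pd_bounds[OF assms] by blast
  have C: "C > 0" using c by simp
  have "\<exists>B. sym_psd B \<and> B ** B = (1/C) *\<^sub>R A"
  proof (rule psd_sqrt_exists_contraction)
    show "transpose ((1/C) *\<^sub>R A) = (1/C) *\<^sub>R A" using assms by (simp add: transpose_scalar sym_pd_def)
    show "0 < c / C" using c C by simp
    show "c / C * (x \<bullet> x) \<le> x \<bullet> ((1/C) *\<^sub>R A *v x)" for x
      using c(3)[of x] C by (simp add: matvec.scaleR_left divide_right_mono)
    show "x \<bullet> ((1/C) *\<^sub>R A *v x) \<le> x \<bullet> x" for x
      using c(4)[of x] C by (simp add: matvec.scaleR_left divide_simps mult.commute)
  qed
  then obtain B where B: "sym_psd B" "B ** B = (1/C) *\<^sub>R A" by blast
  have "(sqrt C *\<^sub>R B) ** (sqrt C *\<^sub>R B) = A"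
    using B(2) C by (simp add: matmul.scaleR_left matmul.scaleR_right)
  moreover have "sym_psd (sqrt C *\<^sub>R B)" using B C by (simp add: sym_psd_scaleR)
  ultimately show ?thesis by blast
qed

text \<open>Both for uniqueness of the root and for commutation one meets an identity \<open>P E = - E Q\<close> with
  positive semidefinite \<open>P\<close>, \<open>Q\<close>; testing against \<open>E\<close> kills both sides.\<close>

lemma sylvester_zero:
  fixes P Q E :: "real^'d^'d"
  assumes P: "sym_psd P" and Q: "sym_psd Q" and eq: "P ** E + E ** Q = 0"
  shows "P ** E = 0" "Q ** transpose E = 0"
proof -
  have nn: "0 \<le> (P ** E) \<bullet> E" if "sym_psd P" for P E :: "real^'d^'d"
    using that unfolding matrix_inner_eq_sum_axis[of "P ** E"] sym_psd_def
    by (auto intro!: sum_nonneg simp: matrix_vector_mul_assoc[symmetric] inner_commute)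
  have z: "P ** E = 0" if "sym_psd P" "(P ** E) \<bullet> E = 0" for P E :: "real^'d^'d"
  proof (rule matrix_eqI_axis)
    fix j
    have "\<forall>j\<in>UNIV. (P ** E *v axis j 1) \<bullet> (E *v axis j 1) = 0"
      using that unfolding matrix_inner_eq_sum_axis[of "P ** E"] sym_psd_def
      by (subst (asm) sum_nonneg_eq_0_iff) (auto simp: matrix_vector_mul_assoc[symmetric] inner_commute)
    then have "(E *v axis j 1) \<bullet> (P *v (E *v axis j 1)) = 0"
      by (simp add: matrix_vector_mul_assoc[symmetric] inner_commute)
    then show "P ** E *v axis j 1 = 0 *v axis j 1"
      using sym_psd_form_zero[OF that(1)] by (simp add: matrix_vector_mul_assoc[symmetric])
  qed
  have "(E ** Q) \<bullet> E = (Q ** transpose E) \<bullet> transpose E"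
  proof -
    have "(E ** Q) \<bullet> E = transpose (E ** Q) \<bullet> transpose E"
      unfolding matrix_inner_eq_sum by (subst sum.swap) (simp add: transpose_def)
    then show ?thesis using Q by (simp add: matrix_transpose_mul sym_psd_def)
  qed
  moreover have "(P ** E) \<bullet> E + (E ** Q) \<bullet> E = 0"
    using eq by (metis inner_add_left inner_zero_left)
  ultimately have "(P ** E) \<bullet> E = 0" "(Q ** transpose E) \<bullet> transpose E = 0"
    using nn[OF P, of E] nn[OF Q, of "transpose E"] by linarith+
  then show "P ** E = 0" "Q ** transpose E = 0" using z P Q by blast+
qed

lemma psd_sqrt_unique:
  assumes B: "sym_psd B" and C: "sym_psd C" and eq: "B ** B = C ** C"
  shows "B = (C :: real^'d^'d)"
proof -
  define E where "E = B - C"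
  have tE: "transpose E = E" using B C by (simp add: E_def sym_psd_def transpose_diff)
  have "B ** E + E ** C = 0" using eq by (simp add: E_def matmul.diff_left matmul.diff_right)
  from sylvester_zero[OF B C this] have "E ** E = 0"
    by (simp add: tE) (simp add: E_def matmul.diff_left)
  then have "E \<bullet> E = 0" by (simp add: matrix_inner_eq_trace tE trace_def)
  then show ?thesis by (simp add: E_def)
qed

lemma psd_sqrt_eqI:
  assumes "sym_psd B" "B ** B = A" shows "psd_sqrt A = B"
  unfolding psd_sqrt_def using assms by (intro the_equality) (auto intro: psd_sqrt_unique)

lemma psd_sqrt_pd:
  assumes "sym_pd (A :: real^'d^'d)"
  shows "sym_pd (psd_sqrt A)" "psd_sqrt A ** psd_sqrt A = A" "transpose (psd_sqrt A) = psd_sqrt A"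
proof -
  obtain B where B: "sym_psd B" "B ** B = A" using psd_sqrt_exists[OF assms] by blast
  have e: "psd_sqrt A = B" using B by (rule psd_sqrt_eqI)
  have "det B \<noteq> 0" using sym_pd_det_nz[OF assms] B(2) by (metis det_mul mult_zero_left)
  then show "sym_pd (psd_sqrt A)" "psd_sqrt A ** psd_sqrt A = A" "transpose (psd_sqrt A) = psd_sqrt A"
    using B by (simp_all add: e sym_pd_iff_psd_det sym_psd_def)
qed

text \<open>Needed in the backward step, where the root of a polynomial in \<open>P\<close> must
  commute with \<open>P\<close>; its square does so trivially.\<close>

lemma sym_pd_commute_of_square:
  assumes Q: "sym_pd Q" and com: "(Q ** Q) ** P = P ** (Q ** Q)"
  shows "Q ** P = P ** (Q :: real^'d^'d)"
proof -
  define E where "E = Q ** P - P ** Q"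
  have "Q ** E + E ** Q = 0"
    using com by (simp add: E_def matmul.diff_left matmul.diff_right matrix_mul_assoc)
  with Q have "Q ** E = 0" using sylvester_zero(1) sym_pd_imp_psd by blast
  then have "matrix_inv Q ** (Q ** E) = 0" by (simp add: matmul.zero_right)
  then have "E = 0" by (simp add: matrix_mul_assoc matrix_inv_mult sym_pd_det_nz[OF Q])
  then show ?thesis by (simp add: E_def)
qed

lemma sym_pd_det_pos:
  assumes "sym_pd (A :: real^'d^'d)" shows "det A > 0"
proof -
  have "det A = det (psd_sqrt A) * det (psd_sqrt A)" using psd_sqrt_pd(2)[OF assms] by (metis det_mul)
  then show ?thesis using sym_pd_det_nz[OF assms] by (metis mult_zero_left not_real_square_gt_zero)
qed

subsection \<open>Gaussian measures\<close>

lemma matvec_measurable [measurable]: "(\<lambda>z. (B :: real^'n^'m) *v z) \<in> borel_measurable borel"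
  by (intro borel_measurable_continuous_onI continuous_intros matvec.continuous_on)

lemma nn_integral_lborel_translate:
  fixes f :: "'a::euclidean_space \<Rightarrow> ennreal"
  assumes [measurable]: "f \<in> borel_measurable borel"
  shows "(\<integral>\<^sup>+x. f (x + a) \<partial>lborel) = (\<integral>\<^sup>+x. f x \<partial>lborel)"
proof -
  have "(\<integral>\<^sup>+x. f x \<partial>lborel) = (\<integral>\<^sup>+x. f x \<partial>(distr lborel borel ((+) a)))"
    by (simp add: lborel_distr_plus)
  also have "\<dots> = (\<integral>\<^sup>+x. f (x + a) \<partial>lborel)" by (subst nn_integral_distr) (simp_all add: add.commute)
  finally show ?thesis by simp
qed

text \<open>Translating along \<open>v\<close> does not change the integral, so one may average over all translates by
  \<open>s v\<close> with \<open>s\<close> in the unit interval; Tonelli then moves the shear into the averaging window.\<close>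

lemma nn_integral_lborel_shear:
  fixes f :: "'a::euclidean_space \<Rightarrow> ennreal"
  assumes [measurable]: "f \<in> borel_measurable borel" and uv: "v \<bullet> u = 0"
  shows "(\<integral>\<^sup>+x. f (x + (x \<bullet> u) *\<^sub>R v) \<partial>lborel) = (\<integral>\<^sup>+x. f x \<partial>lborel)"
proof -
  define w :: "real \<Rightarrow> ennreal" where "w = indicator {0..1}"
  have [measurable]: "w \<in> borel_measurable borel" by (simp add: w_def)
  have w1: "(\<integral>\<^sup>+s. w s \<partial>lborel) = 1" by (simp add: w_def)
  have "(\<integral>\<^sup>+x. f (x + (x \<bullet> u) *\<^sub>R v) \<partial>lborel) = (\<integral>\<^sup>+s. w s * (\<integral>\<^sup>+x. f (x + (x \<bullet> u) *\<^sub>R v) \<partial>lborel) \<partial>lborel)"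
    by (simp add: nn_integral_multc w1)
  also have "\<dots> = (\<integral>\<^sup>+s. w s * (\<integral>\<^sup>+x. f (x + (s + x \<bullet> u) *\<^sub>R v) \<partial>lborel) \<partial>lborel)"
  proof (rule nn_integral_cong)
    fix s :: real
    show "w s * (\<integral>\<^sup>+x. f (x + (x \<bullet> u) *\<^sub>R v) \<partial>lborel) = w s * (\<integral>\<^sup>+x. f (x + (s + x \<bullet> u) *\<^sub>R v) \<partial>lborel)"
      using nn_integral_lborel_translate[of "\<lambda>x. f (x + (x \<bullet> u) *\<^sub>R v)" "s *\<^sub>R v"] uv
      by (simp add: inner_add_left scaleR_add_left algebra_simps)
  qed
  also have "\<dots> = (\<integral>\<^sup>+s. \<integral>\<^sup>+x. w s * f (x + (s + x \<bullet> u) *\<^sub>R v) \<partial>lborel \<partial>lborel)"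
    by (simp add: nn_integral_cmult)
  also have "\<dots> = (\<integral>\<^sup>+x. \<integral>\<^sup>+s. w s * f (x + (s + x \<bullet> u) *\<^sub>R v) \<partial>lborel \<partial>lborel)"
    by (rule lborel_pair.Fubini') measurable
  also have "\<dots> = (\<integral>\<^sup>+x. \<integral>\<^sup>+s. w (s - x \<bullet> u) * f (x + s *\<^sub>R v) \<partial>lborel \<partial>lborel)"
  proof (rule nn_integral_cong)
    fix x :: 'a
    show "(\<integral>\<^sup>+s. w s * f (x + (s + x \<bullet> u) *\<^sub>R v) \<partial>lborel) = (\<integral>\<^sup>+s. w (s - x \<bullet> u) * f (x + s *\<^sub>R v) \<partial>lborel)"
      using nn_integral_lborel_translate[of "\<lambda>s. w (s - x \<bullet> u) * f (x + s *\<^sub>R v)" "x \<bullet> u"] by simp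
  qed
  also have "\<dots> = (\<integral>\<^sup>+s. \<integral>\<^sup>+x. w (s - x \<bullet> u) * f (x + s *\<^sub>R v) \<partial>lborel \<partial>lborel)"
    by (rule lborel_pair.Fubini') measurable
  also have "\<dots> = (\<integral>\<^sup>+s. \<integral>\<^sup>+x. w (s - x \<bullet> u) * f x \<partial>lborel \<partial>lborel)"
  proof (rule nn_integral_cong)
    fix s :: real
    show "(\<integral>\<^sup>+x. w (s - x \<bullet> u) * f (x + s *\<^sub>R v) \<partial>lborel) = (\<integral>\<^sup>+x. w (s - x \<bullet> u) * f x \<partial>lborel)"
      using nn_integral_lborel_translate[of "\<lambda>x. w (s - x \<bullet> u) * f x" "s *\<^sub>R v"] uv
      by (simp add: inner_add_left)
  qed
  also have "\<dots> = (\<integral>\<^sup>+x. \<integral>\<^sup>+s. w (s - x \<bullet> u) * f x \<partial>lborel \<partial>lborel)"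
    by (rule lborel_pair.Fubini') measurable
  also have "\<dots> = (\<integral>\<^sup>+x. f x \<partial>lborel)"
  proof (rule nn_integral_cong)
    fix x :: 'a
    show "(\<integral>\<^sup>+s. w (s - x \<bullet> u) * f x \<partial>lborel) = f x"
      using nn_integral_lborel_translate[of w "- (x \<bullet> u)"] by (simp add: nn_integral_multc w1)
  qed
  finally show ?thesis .
qed

lemma nn_integral_lborel_matrix_diagonal:
  fixes A :: "real^'d^'d"
  assumes diag: "\<And>i j. i \<noteq> j \<Longrightarrow> A $ i $ j = 0" and nz: "det A \<noteq> 0"
    and [measurable]: "f \<in> borel_measurable borel"
  shows "(\<integral>\<^sup>+x. f x \<partial>lborel) = ennreal \<bar>det A\<bar> * (\<integral>\<^sup>+x. f (A *v x) \<partial>lborel)"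
proof -
  define c where "c b = b \<bullet> (A *v b)" for b :: "real^'d"
  have c: "c (axis i 1) = A $ i $ i" for i by (simp add: c_def inner_axis' matrix_vector_axis_nth)
  have det: "det A = (\<Prod>i\<in>UNIV. A $ i $ i)" by (rule det_diagonal) (rule diag)
  then have nzi: "A $ i $ i \<noteq> 0" for i using nz by simp
  have B: "(Basis :: (real^'d) set) = (\<lambda>i. axis i 1) ` UNIV" by (auto simp: Basis_vec_def)
  have inj: "inj (\<lambda>i. axis i (1::real) :: real^'d)" by (simp add: inj_on_def axis_eq_axis)
  have eq: "(0 :: real^'d) + (\<Sum>j\<in>Basis. (c j * (x \<bullet> j)) *\<^sub>R j) = A *v x" for x
  proof -
    have "(\<Sum>j\<in>Basis. (c j * (x \<bullet> j)) *\<^sub>R j) = (\<Sum>j\<in>UNIV. (A $ j $ j * x $ j) *\<^sub>R axis j 1)"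
      unfolding B by (subst sum.reindex[OF inj]) (simp add: c inner_axis)
    moreover have "(\<Sum>j\<in>UNIV. (A $ j $ j * x $ j) *\<^sub>R axis j 1) $ i = (A *v x) $ i" for i
    proof -
      have "(A *v x) $ i = (\<Sum>j\<in>UNIV. A $ i $ j * x $ j)" by (simp add: matrix_vector_mult_def)
      also have "\<dots> = (\<Sum>j\<in>UNIV. if j = i then A $ i $ i * x $ i else 0)"
        by (rule sum.cong) (auto simp: diag)
      finally show ?thesis by (simp add: axis_def if_distrib cong: if_cong)
    qed
    ultimately show ?thesis by (simp add: vec_eq_iff)
  qed
  have "(\<Prod>j\<in>Basis. \<bar>c j\<bar>) = \<bar>det A\<bar>"
    unfolding B det by (subst prod.reindex[OF inj]) (simp add: c abs_prod)
  moreover have "lborel = density (distr lborel borel (\<lambda>x. 0 + (\<Sum>j\<in>Basis. (c j * (x \<bullet> j)) *\<^sub>R j))) (\<lambda>_. (\<Prod>j\<in>Basis. \<bar>c j\<bar>))"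
    by (rule lborel_affine_euclidean) (auto simp: B c nzi)
  ultimately have "lborel = density (distr lborel borel ((*v) A)) (\<lambda>_. ennreal \<bar>det A\<bar>)"
    by (simp only: eq prod_ennreal abs_ge_zero)
  then have "(\<integral>\<^sup>+x. f x \<partial>lborel) = (\<integral>\<^sup>+x. f x \<partial>(density (distr lborel borel ((*v) A)) (\<lambda>_. ennreal \<bar>det A\<bar>)))"
    by simp
  then show ?thesis
    by (simp add: nn_integral_density nn_integral_distr nn_integral_cmult)
qed

lemma nn_integral_lborel_matrix_swap:
  fixes f :: "real^'d \<Rightarrow> ennreal"
  assumes [measurable]: "f \<in> borel_measurable borel"
  shows "(\<integral>\<^sup>+x. f (\<chi> i. x $ Transposition.transpose m n i) \<partial>lborel) = (\<integral>\<^sup>+x. f x \<partial>lborel)"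
proof -
  let ?h = "\<lambda>x :: real^'d. \<chi> i. x $ Transposition.transpose m n i"
  have [measurable]: "?h \<in> borel_measurable borel"
    by (intro borel_measurable_continuous_onI continuous_intros)
  have "lborel = distr lborel borel ?h"
  proof (rule lborel_eqI)
    fix l u :: "real^'d" assume lu: "\<And>b. b \<in> Basis \<Longrightarrow> l \<bullet> b \<le> u \<bullet> b"
    have card: "(\<Prod>b\<in>Basis. (u - l) \<bullet> b) = (\<Prod>i\<in>UNIV. (u - l) $ i)" for u l :: "real^'d"
    proof -
      have B: "(Basis :: (real^'d) set) = (\<lambda>i. axis i 1) ` UNIV" by (auto simp: Basis_vec_def)
      have inj: "inj (\<lambda>i. axis i (1::real) :: real^'d)" by (simp add: inj_on_def axis_eq_axis)
      show ?thesis unfolding B by (subst prod.reindex[OF inj]) (simp add: inner_axis)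
    qed
    have le: "l $ i \<le> u $ i" for i using lu[of "axis i 1"] by (auto simp: inner_axis Basis_vec_def)
    have "?h -` box l u = box (?h l) (?h u)"
      by (auto simp: mem_box_cart) (metis transpose_involutory)+
    then have "emeasure (distr lborel borel ?h) (box l u) = emeasure lborel (box (?h l) (?h u))"
      by (simp add: emeasure_distr)
    also have "\<dots> = ennreal (\<Prod>i\<in>UNIV. (?h u - ?h l) $ i)"
    proof -
      have "?h l \<bullet> b \<le> ?h u \<bullet> b" if "b \<in> Basis" for b
        using that le by (auto simp: Basis_vec_def inner_axis)
      then show ?thesis by (simp add: emeasure_lborel_box card)
    qed
    also have "(\<Prod>i\<in>UNIV. (?h u - ?h l) $ i) = (\<Prod>i\<in>UNIV. (u - l) $ i)"
      using prod.permute[OF permutes_swap_id[of m UNIV n], of "\<lambda>i. (u - l) $ i"] by (simp add: o_def)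
    finally show "emeasure (distr lborel borel ?h) (box l u) = (\<Prod>b\<in>Basis. (u - l) \<bullet> b)" by (simp add: card)
  qed simp
  then have "(\<integral>\<^sup>+x. f x \<partial>lborel) = (\<integral>\<^sup>+x. f x \<partial>(distr lborel borel ?h))" by simp
  then show ?thesis by (simp add: nn_integral_distr)
qed

lemma nn_integral_lborel_matrix:
  fixes A :: "real^'d^'d"
  assumes "det A \<noteq> 0" "f \<in> borel_measurable borel"
  shows "(\<integral>\<^sup>+x. f x \<partial>lborel) = ennreal \<bar>det A\<bar> * (\<integral>\<^sup>+x. f (A *v x) \<partial>lborel)"
proof -
  \<comment> \<open>Induction over elementary matrices. The implication makes the zero-row case
    vacuous, and \<open>f\<close> is quantified inside \<open>P\<close> because the product case
    applies the hypothesis for \<open>B\<close> to the composite of \<open>f\<close> with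
    \<open>A\<close>.\<close>
  define P where "P A \<longleftrightarrow> (det A \<noteq> 0 \<longrightarrow> (\<forall>f\<in>borel_measurable borel.
      (\<integral>\<^sup>+x. f x \<partial>lborel) = ennreal \<bar>det A\<bar> * (\<integral>\<^sup>+x. f (A *v x) \<partial>lborel)))" for A :: "real^'d^'d"
  have "P A"
  proof (induct rule: induct_matrix_elementary[where P = P], unfold P_def, goal_cases)
    case (1 A B)
    show ?case
    proof (intro impI ballI)
      fix f :: "real^'d \<Rightarrow> ennreal" assume nz: "det (A ** B) \<noteq> 0" and [measurable]: "f \<in> borel_measurable borel"
      have "(\<integral>\<^sup>+x. f x \<partial>lborel) = ennreal \<bar>det A\<bar> * (\<integral>\<^sup>+x. f (A *v x) \<partial>lborel)"
        by (rule 1(1)[rule_format]) (use nz in \<open>auto simp: det_mul\<close>)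
      also have "(\<integral>\<^sup>+x. f (A *v x) \<partial>lborel) = ennreal \<bar>det B\<bar> * (\<integral>\<^sup>+x. f (A *v (B *v x)) \<partial>lborel)"
        by (rule 1(2)[rule_format]) (use nz in \<open>auto simp: det_mul\<close>)
      finally show "(\<integral>\<^sup>+x. f x \<partial>lborel) = ennreal \<bar>det (A ** B)\<bar> * (\<integral>\<^sup>+x. f (A ** B *v x) \<partial>lborel)"
        by (simp add: det_mul abs_mult ennreal_mult matrix_vector_mul_assoc mult.assoc)
    qed
  next
    case (2 A i)
    then show ?case using det_zero_row(1)[of i A] by simp
  next
    case (3 A)
    then show ?case using nn_integral_lborel_matrix_diagonal by blast
  next
    case (4 m n)
    let ?A = "\<chi> i j. (mat 1 :: real^'d^'d) $ i $ Transposition.transpose m n j"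
    have "\<bar>det ?A\<bar> = 1"
      using det_permute_columns[OF permutes_swap_id[of m UNIV n], of "mat 1 :: real^'d^'d"]
      by (simp add: sign_swap_id 4)
    moreover have "?A *v x = (\<chi> i. x $ Transposition.transpose m n i)" for x
    proof -
      have "(?A *v x) $ i = x $ Transposition.transpose m n i" for i
      proof -
        have "(?A *v x) $ i = (\<Sum>j\<in>UNIV. if j = Transposition.transpose m n i then x $ j else 0)"
          unfolding matrix_vector_mult_def vec_lambda_beta
          by (rule sum.cong) (auto simp: mat_def transpose_eq_iff)
        then show ?thesis by simp
      qed
      then show ?thesis by (simp add: vec_eq_iff)
    qed
    ultimately show ?case by (simp add: nn_integral_lborel_matrix_swap)
  next
    case (5 m n c)
    let ?A = "\<chi> i j. if i = m \<and> j = n then c else of_bool (i = j)"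
    have "?A = (\<chi> k. if k = m then row m (mat 1) + c *s row n (mat 1) else row k (mat 1 :: real^'d^'d))"
      using 5 by (auto simp: vec_eq_iff row_def mat_def)
    then have "det ?A = 1" using det_row_operation[OF 5, where c = c and A = "mat 1 :: real^'d^'d"] by simp
    moreover have "?A *v x = x + (x \<bullet> axis n c) *\<^sub>R axis m 1" for x
    proof -
      have "(?A *v x) $ i = (x + (x \<bullet> axis n c) *\<^sub>R axis m 1) $ i" for i
      proof -
        have "(?A *v x) $ i = (\<Sum>j\<in>UNIV. (if j = i then x $ j else 0) + (if j = n then (if i = m then c * x $ n else 0) else 0))"
          unfolding matrix_vector_mult_def vec_lambda_beta using 5 by (intro sum.cong) auto
        then show ?thesis by (simp add: sum.distrib inner_axis) (simp add: axis_def)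
      qed
      then show ?thesis by (simp add: vec_eq_iff)
    qed
    ultimately show ?case using 5
      by (simp add: nn_integral_lborel_shear inner_axis_axis)
  qed
  then show ?thesis using assms unfolding P_def by blast
qed

lemma lborel_matrix_image:
  fixes B :: "real^'d^'d"
  assumes B: "det B \<noteq> 0"
  shows "lborel = density (distr lborel borel (\<lambda>z. m + B *v z)) (\<lambda>_. ennreal \<bar>det B\<bar>)"
proof (rule measure_eqI)
  fix A :: "(real^'d) set" assume "A \<in> sets lborel"
  then have [measurable]: "A \<in> sets borel" by simp
  have "emeasure (density (distr lborel borel (\<lambda>z. m + B *v z)) (\<lambda>_. ennreal \<bar>det B\<bar>)) A
    = ennreal \<bar>det B\<bar> * (\<integral>\<^sup>+z. indicator A (m + B *v z) \<partial>lborel)"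
  proof -
    have "(\<integral>\<^sup>+z. indicator A (m + B *v z) \<partial>lborel) = (\<integral>\<^sup>+y. indicator A y \<partial>(distr lborel borel (\<lambda>z. m + B *v z)))"
      by (subst nn_integral_distr) simp_all
    then show ?thesis by (simp add: emeasure_density nn_integral_cmult)
  qed
  also have "\<dots> = (\<integral>\<^sup>+y. indicator A (m + y) \<partial>lborel)"
    by (rule nn_integral_lborel_matrix[OF B, symmetric]) simp
  also have "\<dots> = (\<integral>\<^sup>+y. indicator A y \<partial>lborel)"
    using nn_integral_lborel_translate[of "indicator A" m] by (simp add: add.commute)
  finally show "emeasure lborel A = emeasure (density (distr lborel borel (\<lambda>z. m + B *v z)) (\<lambda>_. ennreal \<bar>det B\<bar>)) A"
    by simp
qed simp

section \<open>The standard Gaussian and its affine images\<close>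

definition std_gauss :: "(real^'d) measure" where
  "std_gauss = gauss 0 (mat 1)"

lemma sets_gauss [simp, measurable_cong]: "sets (gauss m S) = sets borel"
  by (simp add: gauss_def)

lemma space_gauss [simp]: "space (gauss m S) = UNIV"
  by (simp add: gauss_def)

lemma sets_std_gauss [simp, measurable_cong]: "sets std_gauss = sets borel"
  by (simp add: std_gauss_def)

lemma space_std_gauss [simp]: "space std_gauss = UNIV"
  by (simp add: std_gauss_def)

lemma gauss_dens_measurable [measurable]: "gauss_dens m S \<in> borel_measurable borel"
  unfolding gauss_dens_def by measurable

lemma gauss_dens_std: "gauss_dens 0 (mat 1) x = exp (- (x \<bullet> x) / 2) / sqrt ((2 * pi) ^ CARD('d))"
  for x :: "real^'d"
proof -
  have "matrix_inv (mat 1 :: real^'d^'d) = mat 1" by (rule matrix_inv_unique) simp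
  then show ?thesis by (simp add: gauss_dens_def)
qed

lemma affine_measurable [measurable]: "(\<lambda>z. m + (B :: real^'n^'m) *v z) \<in> borel_measurable borel"
  by (intro borel_measurable_continuous_onI continuous_intros matvec.continuous_on)

lemma matrix_inv_factor:
  fixes B :: "real^'d^'d"
  assumes B: "det B \<noteq> 0" and S: "B ** transpose B = S"
  shows "transpose B ** (matrix_inv S ** B) = mat 1"
proof -
  have "det S \<noteq> 0" using B S by (metis det_mul det_transpose mult_eq_0_iff)
  have "transpose B = matrix_inv B ** S"
    by (simp add: S[symmetric] matrix_mul_assoc matrix_inv_mult[OF B])
  then have "transpose B ** (matrix_inv S ** B) = matrix_inv B ** (S ** matrix_inv S) ** B"
    by (simp add: matrix_mul_assoc)
  then show ?thesis by (simp add: matrix_inv_mult[OF B] matrix_inv_mult[OF \<open>det S \<noteq> 0\<close>])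
qed

text \<open>Every invertible factor of \<open>S\<close> is allowed, not just the symmetric root, so
  that the factors produced by the algorithm can be driven by one and the same standard normal
  variable.\<close>

lemma gauss_eq_distr:
  fixes B :: "real^'d^'d"
  assumes B: "det B \<noteq> 0" and S: "B ** transpose B = S"
  shows "gauss m S = distr std_gauss borel (\<lambda>z. m + B *v z)"
proof -
  let ?T = "\<lambda>z. m + B *v z"
  have dS: "det S = (det B)\<^sup>2" using S by (metis det_mul det_transpose power2_eq_square)
  have inv: "transpose B ** (matrix_inv S ** B) = mat 1" by (rule matrix_inv_factor[OF B S])
  have dens: "\<bar>det B\<bar> * gauss_dens m S (?T z) = gauss_dens 0 (mat 1) z" for z
  proof -
    have "(?T z - m) \<bullet> (matrix_inv S *v (?T z - m)) = z \<bullet> z"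
      using inv by (simp add: inner_matrix_vector_transpose matrix_vector_mul_assoc)
    then have "gauss_dens m S (?T z) = exp (- (z \<bullet> z) / 2) / (sqrt ((2 * pi) ^ CARD('d)) * \<bar>det B\<bar>)"
      by (simp add: gauss_dens_def dS real_sqrt_mult)
    then show ?thesis using B by (simp add: gauss_dens_std)
  qed
  have "gauss m S = density (density (distr lborel borel ?T) (\<lambda>_. ennreal \<bar>det B\<bar>)) (\<lambda>x. ennreal (gauss_dens m S x))"
    unfolding gauss_def by (subst lborel_matrix_image[OF B, of m]) simp
  also have "\<dots> = density (distr lborel borel ?T) (\<lambda>x. ennreal (\<bar>det B\<bar> * gauss_dens m S x))"
    by (subst density_density_eq) (simp_all add: ennreal_mult')
  also have "\<dots> = distr (density lborel (\<lambda>z. ennreal (\<bar>det B\<bar> * gauss_dens m S (?T z)))) borel ?T"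
    by (subst density_distr) simp_all
  finally show ?thesis by (simp add: dens std_gauss_def gauss_def)
qed

text \<open>The rate \<open>c\<close> is free because two values are used: \<open>1/2\<close>
  normalises the standard Gaussian, \<open>1/4\<close> gives the dominating function for exponential
  moments.\<close>

lemma nn_integral_exp_neg_sq:
  fixes c :: real
  assumes "c > 0"
  shows "(\<integral>\<^sup>+x. ennreal (exp (- c * (x \<bullet> x))) \<partial>(lborel :: (real^'d) measure)) = ennreal (sqrt (pi / c) ^ CARD('d))"
proof -
  define s where "s = sqrt (1 / (2 * c))"
  have s: "s > 0" "2 * s\<^sup>2 = 1 / c" using assms by (simp_all add: s_def)
  have one: "(\<integral>\<^sup>+x. ennreal (exp (- c * x\<^sup>2)) \<partial>lborel) = ennreal (sqrt (pi / c))"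
  proof -
    have "exp (- c * x\<^sup>2) = sqrt (pi / c) * normal_density 0 s x" for x
    proof -
      have "2 * pi * s\<^sup>2 = pi / c" "(x - 0)\<^sup>2 / (2 * s\<^sup>2) = c * x\<^sup>2" by (simp_all add: s(2)) (simp add: s(2) mult.assoc[symmetric] mult.commute[of 2 pi] mult.assoc)
      then show ?thesis unfolding normal_density_def using assms by simp
    qed
    then have "(\<integral>\<^sup>+x. ennreal (exp (- c * x\<^sup>2)) \<partial>lborel) = ennreal (sqrt (pi / c)) * (\<integral>\<^sup>+x. ennreal (normal_density 0 s x) \<partial>lborel)"
      using assms by (simp add: ennreal_mult nn_integral_cmult)
    also have "(\<integral>\<^sup>+x. ennreal (normal_density 0 s x) \<partial>lborel) = ennreal 1"
      using s by (subst nn_integral_eq_integral) simp_all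
    finally show ?thesis by simp
  qed
  have "exp (- c * (x \<bullet> x)) = (\<Prod>b\<in>Basis. exp (- c * (x \<bullet> b)\<^sup>2))" for x :: "real^'d"
    by (subst euclidean_inner) (simp add: exp_sum[symmetric] sum_distrib_left power2_eq_square sum_negf)
  note prod = this
  have "(\<integral>\<^sup>+x. ennreal (exp (- c * (x \<bullet> x))) \<partial>(lborel :: (real^'d) measure)) = (\<integral>\<^sup>+x. (\<Prod>b\<in>Basis. ennreal (exp (- c * ((x :: real^'d) \<bullet> b)\<^sup>2))) \<partial>lborel)"
    unfolding prod by (intro nn_integral_cong) (simp add: prod_ennreal)
  also have "\<dots> = (\<Prod>b\<in>(Basis :: (real^'d) set). (\<integral>\<^sup>+x. ennreal (exp (- c * x\<^sup>2)) \<partial>lborel))"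
    by (rule nn_integral_lborel_prod) simp_all
  finally show ?thesis unfolding one using assms by (simp add: ennreal_power)
qed

lemma prob_space_std_gauss: "prob_space (std_gauss :: (real^'d) measure)"
proof (rule prob_spaceI)
  have "emeasure (std_gauss :: (real^'d) measure) UNIV
    = (\<integral>\<^sup>+x. ennreal (exp (- (1/2) * (x \<bullet> x))) * ennreal (1 / sqrt ((2 * pi) ^ CARD('d))) \<partial>(lborel :: (real^'d) measure))"
    unfolding std_gauss_def gauss_def
    by (subst emeasure_density) (auto simp: gauss_dens_std ennreal_mult[symmetric] intro!: nn_integral_cong)
  also have "\<dots> = ennreal (sqrt (2 * pi) ^ CARD('d)) * ennreal (1 / sqrt ((2 * pi) ^ CARD('d)))"
    using nn_integral_exp_neg_sq[of "1/2", where 'd='d]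
    by (subst nn_integral_multc) (simp_all add: mult.commute)
  also have "\<dots> = 1" by (simp add: ennreal_mult[symmetric] real_sqrt_power real_sqrt_mult power_mult_distrib)
  finally show "emeasure (std_gauss :: (real^'d) measure) (space std_gauss) = 1" by simp
qed

interpretation std_gauss: prob_space "std_gauss :: (real^'d) measure"
  by (rule prob_space_std_gauss)

lemma std_gauss_integral_lborel:
  fixes f :: "real^'d \<Rightarrow> real"
  assumes [measurable]: "f \<in> borel_measurable borel"
  shows "integrable std_gauss f \<longleftrightarrow> integrable lborel (\<lambda>x. gauss_dens 0 (mat 1) x * f x)"
    and "(\<integral>x. f x \<partial>std_gauss) = (\<integral>x. gauss_dens 0 (mat 1) x * f x \<partial>lborel)"
  unfolding std_gauss_def gauss_def
  by (simp_all add: integrable_density integral_density gauss_dens_std)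

text \<open>Completing the square, \<open>c * norm x\<close> is at most \<open>c\<^sup>2\<close>
  plus half of the Gaussian exponent; the other half stays integrable.\<close>

lemma std_gauss_integrable_exp_norm: "integrable std_gauss (\<lambda>z :: real^'d. exp (c * norm z))"
proof -
  let ?k = "exp (c\<^sup>2) / sqrt ((2 * pi) ^ CARD('d))"
  have int: "integrable lborel (\<lambda>x :: real^'d. exp (- (1/4) * (x \<bullet> x)))"
    using nn_integral_exp_neg_sq[of "1/4", where 'd='d]
    by (intro integrableI_nn_integral_finite[where x="sqrt (pi / (1/4)) ^ CARD('d)"]) simp_all
  have le: "gauss_dens 0 (mat 1) x * exp (c * norm x) \<le> ?k * exp (- (1/4) * (x \<bullet> x))" for x :: "real^'d"
  proof -
    have "0 \<le> (c - norm x / 2)\<^sup>2" by simp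
    then have "- (x \<bullet> x) / 2 + c * norm x \<le> c\<^sup>2 + - (1/4) * (x \<bullet> x)"
      unfolding power2_diff power2_norm_eq_inner[symmetric] by (simp add: power_divide algebra_simps)
    then have "exp (- (x \<bullet> x) / 2) * exp (c * norm x) \<le> exp (c\<^sup>2) * exp (- (1/4) * (x \<bullet> x))"
      by (simp only: exp_add[symmetric] exp_le_cancel_iff)
    then show ?thesis by (simp add: gauss_dens_std divide_right_mono)
  qed
  have "integrable lborel (\<lambda>x :: real^'d. gauss_dens 0 (mat 1) x * exp (c * norm x))"
  proof (rule Bochner_Integration.integrable_bound[OF integrable_mult_right[OF int, of ?k]])
    have "norm (gauss_dens 0 (mat 1) x * exp (c * norm x)) \<le> norm (?k * exp (- (1/4) * (x \<bullet> x)))" for x :: "real^'d"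
      using le[of x] by (simp add: gauss_dens_std)
    then show "AE x in lborel. norm (gauss_dens 0 (mat 1) x * exp (c * norm x)) \<le> norm (?k * exp (- (1/4) * ((x :: real^'d) \<bullet> x)))"
      by (intro AE_I2)
    show "(\<lambda>x :: real^'d. gauss_dens 0 (mat 1) x * exp (c * norm x)) \<in> borel_measurable lborel"
      by measurable
  qed
  moreover have "(\<lambda>z :: real^'d. exp (c * norm z)) \<in> borel_measurable borel" by measurable
  ultimately show ?thesis using std_gauss_integral_lborel(1) by blast
qed

lemma std_gauss_integrable_of_bound:
  fixes f :: "real^'d \<Rightarrow> real"
  assumes "f \<in> borel_measurable borel" "\<And>z. \<bar>f z\<bar> \<le> C * exp (c * norm z)"
  shows "integrable std_gauss f"
proof (rule Bochner_Integration.integrable_bound[OF integrable_mult_right[OF std_gauss_integrable_exp_norm[of c], of C]])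
  have "norm (f z) \<le> norm (C * exp (c * norm z))" for z
    using assms(2)[of z] by simp
  then show "AE z in std_gauss. norm (f z) \<le> norm (C * exp (c * norm z))" by (intro AE_I2)
qed (use assms in simp)

lemma measure_std_gauss_UNIV [simp]: "measure std_gauss (UNIV :: (real^'d) set) = 1"
  using prob_space.prob_space[OF prob_space_std_gauss[where 'd='d]] by simp

lemma std_gauss_integrable_quadratic:
  fixes f :: "real^'d \<Rightarrow> real"
  assumes "f \<in> borel_measurable borel" "\<And>z. \<bar>f z\<bar> \<le> C * (1 + norm z)\<^sup>2"
  shows "integrable std_gauss f"
proof (rule std_gauss_integrable_of_bound[OF assms(1), of C 2])
  fix z :: "real^'d"
  have C: "0 \<le> C" using assms(2)[of 0] by simp
  have "(1 + norm z)\<^sup>2 \<le> (exp (norm z))\<^sup>2" by (intro power_mono) auto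
  also have "\<dots> = exp (2 * norm z)" by (simp add: exp_double)
  finally show "\<bar>f z\<bar> \<le> C * exp (2 * norm z)"
    using assms(2)[of z] C by (meson mult_left_mono order_trans)
qed

section \<open>The Cameron-Martin shift and Stein's identity\<close>

lemma std_gauss_integral_shift:
  fixes f :: "real^'d \<Rightarrow> real"
  assumes [measurable]: "f \<in> borel_measurable borel"
  shows "(\<integral>z. f (z + a) \<partial>std_gauss) = (\<integral>z. f z * exp (a \<bullet> z - a \<bullet> a / 2) \<partial>std_gauss)"
proof -
  have "(\<integral>z. f (z + a) \<partial>std_gauss) = (\<integral>x. gauss_dens 0 (mat 1) x * f (a + x) \<partial>lborel)"
    by (subst std_gauss_integral_lborel(2)) (simp_all add: add.commute)
  also have "\<dots> = (\<integral>x. gauss_dens 0 (mat 1) ((a + x) - a) * f (a + x) \<partial>lborel)" by simp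
  also have "\<dots> = (\<integral>y. gauss_dens 0 (mat 1) (y - a) * f y \<partial>(distr lborel borel ((+) a)))"
    by (rule integral_distr[symmetric]) measurable
  also have "\<dots> = (\<integral>y. gauss_dens 0 (mat 1) y * (f y * exp (a \<bullet> y - a \<bullet> a / 2)) \<partial>lborel)"
  proof -
    have "gauss_dens 0 (mat 1) (y - a) = gauss_dens 0 (mat 1) y * exp (a \<bullet> y - a \<bullet> a / 2)" for y
    proof -
      have "- ((y - a) \<bullet> (y - a)) / 2 = - (y \<bullet> y) / 2 + (a \<bullet> y - a \<bullet> a / 2)"
        by (simp add: inner_diff_left inner_diff_right inner_commute field_simps)
      then show ?thesis unfolding gauss_dens_std by (simp only: exp_add) simp
    qed
    then show ?thesis by (simp add: lborel_distr_plus mult_ac)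
  qed
  also have "\<dots> = (\<integral>z. f z * exp (a \<bullet> z - a \<bullet> a / 2) \<partial>std_gauss)"
    by (rule std_gauss_integral_lborel(2)[symmetric]) simp
  finally show ?thesis .
qed

text \<open>Dominates the difference quotients of the exponential weight in Stein's identity,
  uniformly in the increment.\<close>

lemma abs_exp_minus_1_le: "\<bar>exp x - 1\<bar> \<le> \<bar>x\<bar> * exp \<bar>x\<bar>" for x :: real
proof (cases "x \<ge> 0")
  case True
  have "1 - x \<le> exp (- x)" using exp_ge_add_one_self[of "- x"] by simp
  then have "(1 - x) * exp x \<le> exp (- x) * exp x" by (intro mult_right_mono) auto
  then show ?thesis using True by (simp add: exp_minus_inverse algebra_simps)
next
  case False
  have "1 + x \<le> exp x" by (rule exp_ge_add_one_self)
  moreover have "exp x \<le> 1" using False by simp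
  ultimately have "\<bar>exp x - 1\<bar> \<le> \<bar>x\<bar> * 1" using False by linarith
  also have "\<dots> \<le> \<bar>x\<bar> * exp \<bar>x\<bar>" by (intro mult_left_mono) auto
  finally show ?thesis .
qed

lemma lipschitz_abs_le_exp:
  fixes f :: "real^'d \<Rightarrow> real"
  assumes "\<And>x y. \<bar>f x - f y\<bar> \<le> M * norm (x - y)" "0 \<le> M"
  shows "\<bar>f z\<bar> \<le> (\<bar>f 0\<bar> + M) * exp (norm z)"
proof -
  have "\<bar>f z\<bar> \<le> \<bar>f 0\<bar> * 1 + M * norm z" using assms(1)[of z 0] by simp
  also have "\<dots> \<le> \<bar>f 0\<bar> * exp (norm z) + M * exp (norm z)"
    using assms(2) exp_ge_add_one_self[of "norm z"]
    by (intro add_mono mult_left_mono) (auto intro: order_trans[of _ "1 + norm z"])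
  finally show ?thesis by (simp add: algebra_simps)
qed

text \<open>Stein's identity: differentiate \<open>E f(Z + t h) = E f(Z) exp (t h\<bullet>Z - t\<^sup>2 |h|\<^sup>2 / 2)\<close> at \<open>t = 0\<close>.\<close>

lemma std_gauss_stein:
  fixes f g :: "real^'d \<Rightarrow> real"
  assumes lip: "\<And>x y. \<bar>f x - f y\<bar> \<le> M * norm (x - y)" and M: "0 \<le> M"
    and der: "\<And>z. ((\<lambda>t. f (z + t *\<^sub>R h)) has_real_derivative g z) (at 0)"
    and [measurable]: "g \<in> borel_measurable borel"
  shows "integrable std_gauss (\<lambda>z. f z * (h \<bullet> z))" "integrable std_gauss g"
    and "(\<integral>z. f z * (h \<bullet> z) \<partial>std_gauss) = (\<integral>z. g z \<partial>std_gauss)"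
proof -
  define b where "b = h \<bullet> h / 2"
  have b: "0 \<le> b" by (simp add: b_def)
  \<comment> \<open>A sequence of increments, for dominated convergence; \<open>t n \<le> 1\<close>
    keeps the dominating functions independent of \<open>n\<close>.\<close>
  define t where "t n = 1 / (real n + 1)" for n :: nat
  have t: "0 < t n" "t n \<le> 1" for n by (simp_all add: t_def)
  have t0: "filterlim t (at 0) sequentially"
  proof -
    have "t \<longlonglongrightarrow> 0" unfolding t_def using LIMSEQ_inverse_real_of_nat by (simp add: inverse_eq_divide add.commute)
    then show ?thesis using t by (auto simp: filterlim_at intro!: always_eventually) (metis less_irrefl)
  qed
  have "M-lipschitz_on UNIV f" using lip M by (intro lipschitz_onI) (auto simp: dist_norm)
  then have cf: "continuous_on UNIV f" by (rule lipschitz_on_continuous_on)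
  have [measurable]: "f \<in> borel_measurable borel" using cf by (rule borel_measurable_continuous_onI)
  have fb: "\<bar>f z\<bar> \<le> (\<bar>f 0\<bar> + M) * exp (norm z)" for z by (rule lipschitz_abs_le_exp[OF lip M])
  define C where "C = (\<bar>f 0\<bar> + M) * exp (2 * b)"
  define w where "w z = C * exp ((1 + 2 * norm h) * norm z)" for z :: "real^'d"
  have wi: "integrable std_gauss w"
    unfolding w_def by (intro integrable_mult_right std_gauss_integrable_exp_norm)
  \<comment> \<open>The polynomial factor is absorbed by a second copy of the exponential, whence
    the doubled \<open>b\<close> and \<open>norm h\<close> in \<open>C\<close> and
    \<open>w\<close>.\<close>
  have dom: "\<bar>f z\<bar> * ((\<bar>h \<bullet> z\<bar> + b) * exp (\<bar>h \<bullet> z\<bar> + b)) \<le> w z" for z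
  proof -
    let ?r = "norm h * norm z + b"
    have h: "\<bar>h \<bullet> z\<bar> + b \<le> ?r" using Cauchy_Schwarz_ineq2[of h z] by simp
    have er: "\<bar>h \<bullet> z\<bar> + b \<le> exp ?r" using h exp_ge_add_one_self[of ?r] by linarith
    have "(\<bar>h \<bullet> z\<bar> + b) * exp (\<bar>h \<bullet> z\<bar> + b) \<le> exp ?r * exp ?r"
      using h b er by (intro mult_mono) auto
    then have "\<bar>f z\<bar> * ((\<bar>h \<bullet> z\<bar> + b) * exp (\<bar>h \<bullet> z\<bar> + b)) \<le> ((\<bar>f 0\<bar> + M) * exp (norm z)) * (exp ?r * exp ?r)"
      using fb[of z] b M by - (rule mult_mono, auto)
    also have "\<dots> = w z"
      by (simp add: w_def C_def exp_add[symmetric] algebra_simps)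
    finally show ?thesis .
  qed
  define u where "u n z = (f (z + t n *\<^sub>R h) - f z) / t n" for n z
  define v where "v n z = f z * ((exp (t n * (h \<bullet> z) - (t n)\<^sup>2 * b) - 1) / t n)" for n z
  have [measurable]: "u n \<in> borel_measurable borel" "v n \<in> borel_measurable borel" for n
    unfolding u_def v_def by measurable
  have vb: "\<bar>v n z\<bar> \<le> w z" for n z
  proof -
    let ?x = "t n * (h \<bullet> z) - (t n)\<^sup>2 * b"
    have x: "\<bar>?x\<bar> \<le> t n * (\<bar>h \<bullet> z\<bar> + b)"
    proof -
      have "\<bar>?x\<bar> \<le> t n * \<bar>h \<bullet> z\<bar> + (t n)\<^sup>2 * b" 
        using t[of n] b abs_triangle_ineq4[of "t n * (h \<bullet> z)" "(t n)\<^sup>2 * b"] by (simp add: abs_mult)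
      also have "(t n)\<^sup>2 * b \<le> t n * b" using t[of n] b by (intro mult_right_mono) (auto simp: power2_eq_square mult_left_le)
      finally show ?thesis by (simp add: algebra_simps)
    qed
    have "t n * (\<bar>h \<bullet> z\<bar> + b) \<le> 1 * (\<bar>h \<bullet> z\<bar> + b)" using t[of n] b by (intro mult_right_mono) auto
    with x have x': "\<bar>?x\<bar> \<le> \<bar>h \<bullet> z\<bar> + b" by simp
    have "\<bar>exp ?x - 1\<bar> \<le> \<bar>?x\<bar> * exp \<bar>?x\<bar>" by (rule abs_exp_minus_1_le)
    also have "\<dots> \<le> (t n * (\<bar>h \<bullet> z\<bar> + b)) * exp (\<bar>h \<bullet> z\<bar> + b)"
      using x x' t[of n] b by (intro mult_mono) auto
    finally have "\<bar>exp ?x - 1\<bar> / t n \<le> (\<bar>h \<bullet> z\<bar> + b) * exp (\<bar>h \<bullet> z\<bar> + b)"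
      using t[of n] by (simp add: divide_simps algebra_simps)
    then have "\<bar>v n z\<bar> \<le> \<bar>f z\<bar> * ((\<bar>h \<bullet> z\<bar> + b) * exp (\<bar>h \<bullet> z\<bar> + b))"
      unfolding v_def abs_mult using t[of n] by (intro mult_left_mono) auto
    then show ?thesis using dom[of z] by linarith
  qed
  have ub: "\<bar>u n z\<bar> \<le> M * norm h" for n z
    using lip[of "z + t n *\<^sub>R h" z] t[of n] by (simp add: u_def divide_simps algebra_simps)
  have vl: "(\<lambda>n. v n z) \<longlonglongrightarrow> f z * (h \<bullet> z)" for z
  proof -
    have "((\<lambda>s. exp (s * (h \<bullet> z) - s\<^sup>2 * b)) has_real_derivative (h \<bullet> z)) (at 0)"
      by (auto intro!: derivative_eq_intros)
    then have "((\<lambda>s. (exp (s * (h \<bullet> z) - s\<^sup>2 * b) - 1) / s) \<longlongrightarrow> h \<bullet> z) (at 0)"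
      by (simp add: DERIV_def)
    from filterlim_compose[OF this t0] show ?thesis
      unfolding v_def by (intro tendsto_mult_left) 
  qed
  have ul: "(\<lambda>n. u n z) \<longlonglongrightarrow> g z" for z
  proof -
    have "((\<lambda>s. (f (z + s *\<^sub>R h) - f z) / s) \<longlongrightarrow> g z) (at 0)"
      using der[of z] by (simp add: DERIV_def)
    from filterlim_compose[OF this t0] show ?thesis unfolding u_def .
  qed
  \<comment> \<open>\<open>u\<close> is the difference quotient of the shifted function,
    \<open>v\<close> that of the exponential weight; the shift formula equates their integrals
    before any limit is taken.\<close>
  have eq: "(\<integral>z. u n z \<partial>std_gauss) = (\<integral>z. v n z \<partial>std_gauss)" for n
  proof -
    have i1: "integrable std_gauss f"
      by (rule std_gauss_integrable_of_bound[where C="\<bar>f 0\<bar> + M" and c=1]) (use fb in simp_all)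
    have "integrable std_gauss (u n)"
      by (rule std_gauss_integrable_of_bound[where C="M * norm h" and c=0]) (use ub in simp_all)
    then have "integrable std_gauss (\<lambda>z. t n * u n z + f z)" using i1 by simp
    then have i2: "integrable std_gauss (\<lambda>z. f (z + t n *\<^sub>R h))"
      using t[of n] by (simp add: u_def)
    have "integrable std_gauss (v n)"
    proof (rule Bochner_Integration.integrable_bound[OF wi])
      have "norm (v n z) \<le> norm (w z)" for z using vb[of n z] by simp
      then show "AE z in std_gauss. norm (v n z) \<le> norm (w z)" by (intro AE_I2)
    qed simp
    then have "integrable std_gauss (\<lambda>z. t n * v n z + f z)" using i1 by simp
    then have i3: "integrable std_gauss (\<lambda>z. f z * exp (t n * (h \<bullet> z) - (t n)\<^sup>2 * b))"
    proof -
      have "t n * v n z + f z = f z * exp (t n * (h \<bullet> z) - (t n)\<^sup>2 * b)" for z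
        using t[of n] by (simp add: v_def right_diff_distrib diff_divide_distrib)
      with \<open>integrable std_gauss (\<lambda>z. t n * v n z + f z)\<close> show ?thesis by simp
    qed
    have "(\<integral>z. u n z \<partial>std_gauss) = ((\<integral>z. f (z + t n *\<^sub>R h) \<partial>std_gauss) - (\<integral>z. f z \<partial>std_gauss)) / t n"
      unfolding u_def using i1 i2 by simp
    also have "(\<integral>z. f (z + t n *\<^sub>R h) \<partial>std_gauss) = (\<integral>z. f z * exp (t n * (h \<bullet> z) - (t n)\<^sup>2 * b) \<partial>std_gauss)"
      by (subst std_gauss_integral_shift) (simp_all add: b_def power2_eq_square mult.assoc)
    also have "(\<dots> - (\<integral>z. f z \<partial>std_gauss)) / t n = (\<integral>z. (f z * exp (t n * (h \<bullet> z) - (t n)\<^sup>2 * b) - f z) / t n \<partial>std_gauss)"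
      using i1 i3 by simp
    also have "\<dots> = (\<integral>z. v n z \<partial>std_gauss)"
      by (intro Bochner_Integration.integral_cong) (simp_all add: v_def right_diff_distrib diff_divide_distrib)
    finally show ?thesis .
  qed
  have M2: "(\<lambda>z. f z * (h \<bullet> z)) \<in> borel_measurable std_gauss" by measurable
  have vA: "AE z in std_gauss. (\<lambda>n. v n z) \<longlonglongrightarrow> f z * (h \<bullet> z)" "AE z in std_gauss. norm (v n z) \<le> w z"
    and uA: "AE z in std_gauss. (\<lambda>n. u n z) \<longlonglongrightarrow> g z" "AE z in std_gauss. norm (u n z) \<le> M * norm h" for n
    using vl vb ul ub by (simp_all add: AE_I2)
  have ci: "integrable std_gauss (\<lambda>z :: real^'d. M * norm h)" by simp
  show "integrable std_gauss (\<lambda>z. f z * (h \<bullet> z))"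
    by (rule integrable_dominated_convergence[OF M2 _ wi vA]) simp
  show "integrable std_gauss g"
    by (rule integrable_dominated_convergence[OF _ _ ci uA]) simp_all
  have "(\<lambda>n. \<integral>z. v n z \<partial>std_gauss) \<longlonglongrightarrow> (\<integral>z. f z * (h \<bullet> z) \<partial>std_gauss)"
    by (rule integral_dominated_convergence[OF M2 _ wi vA]) simp
  moreover have "(\<lambda>n. \<integral>z. u n z \<partial>std_gauss) \<longlonglongrightarrow> (\<integral>z. g z \<partial>std_gauss)"
    by (rule integral_dominated_convergence[OF _ _ ci uA]) simp_all
  ultimately show "(\<integral>z. f z * (h \<bullet> z) \<partial>std_gauss) = (\<integral>z. g z \<partial>std_gauss)"
    unfolding eq by (rule LIMSEQ_unique)
qed

section \<open>First and second Gaussian moments\<close>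

lemma std_gauss_mean:
  "has_bochner_integral std_gauss (\<lambda>z :: real^'d. h \<bullet> z) 0"
proof -
  have "integrable std_gauss (\<lambda>z :: real^'d. 1 * (h \<bullet> z))"
    by (rule std_gauss_stein(1)[where M = 0 and g = "\<lambda>_. 0"]) simp_all
  moreover have "(\<integral>z. 1 * (h \<bullet> z) \<partial>std_gauss) = (\<integral>z. 0 \<partial>(std_gauss :: (real^'d) measure))"
    by (rule std_gauss_stein(3)[where M = 0 and g = "\<lambda>_. 0"]) simp_all
  ultimately show ?thesis by (simp add: has_bochner_integral_iff)
qed

lemma std_gauss_second_moment:
  "has_bochner_integral std_gauss (\<lambda>z :: real^'d. (k \<bullet> z) * (h \<bullet> z)) (k \<bullet> h)"
proof -
  have lip: "\<bar>k \<bullet> x - k \<bullet> y\<bar> \<le> norm k * norm (x - y)" for x y :: "real^'d"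
    using Cauchy_Schwarz_ineq2[of k "x - y"] by (simp add: inner_diff_right)
  have der: "((\<lambda>t. k \<bullet> (z + t *\<^sub>R h)) has_real_derivative k \<bullet> h) (at 0)" for z :: "real^'d"
    unfolding inner_add_right inner_scaleR_right by (auto intro!: derivative_eq_intros)
  show ?thesis
    using std_gauss_stein(1)[OF lip _ der] std_gauss_stein(3)[OF lip _ der]
    by (simp add: has_bochner_integral_iff)
qed

text \<open>The isometry between Frobenius inner products and Gaussian expectations. Through it,
  pointwise inequalities in \<open>z\<close> integrate to inequalities between factors.\<close>

lemma std_gauss_inner_linear:
  fixes P Q :: "real^'d^'n"
  shows "has_bochner_integral std_gauss (\<lambda>z. (P *v z) \<bullet> (Q *v z)) (P \<bullet> Q)"
proof -
  have "has_bochner_integral std_gauss (\<lambda>z. \<Sum>i\<in>UNIV. (P $ i \<bullet> z) * (Q $ i \<bullet> z)) (\<Sum>i\<in>UNIV. P $ i \<bullet> Q $ i)"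
    by (intro has_bochner_integral_sum std_gauss_second_moment)
  then show ?thesis by (simp add: inner_vec_def[of "P *v _"] inner_vec_def[of P Q] matrix_vector_mul_component)
qed

lemma std_gauss_inner_affine:
  fixes P Q :: "real^'d^'n"
  shows "has_bochner_integral std_gauss (\<lambda>z. (c + P *v z) \<bullet> (e + Q *v z)) (c \<bullet> e + P \<bullet> Q)"
proof -
  have c: "has_bochner_integral std_gauss (\<lambda>z :: real^'d. c \<bullet> e) (c \<bullet> e)"
    by (simp add: has_bochner_integral_iff)
  have l: "has_bochner_integral std_gauss (\<lambda>z. v \<bullet> (R *v z)) 0" for v and R :: "real^'d^'n"
    using std_gauss_mean[of "transpose R *v v"] by (simp add: inner_matrix_vector_transpose)
  have "has_bochner_integral std_gauss (\<lambda>z. c \<bullet> e + (c \<bullet> (Q *v z) + (e \<bullet> (P *v z) + (P *v z) \<bullet> (Q *v z))))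
    (c \<bullet> e + (0 + (0 + P \<bullet> Q)))"
    by (intro has_bochner_integral_add c l std_gauss_inner_linear)
  then show ?thesis by (simp add: inner_add_left inner_add_right inner_commute add_ac)
qed

subsection \<open>Strongly convex smooth potentials\<close>

locale smooth_potential =
  fixes V :: "real^'d \<Rightarrow> real" and gradV :: "real^'d \<Rightarrow> real^'d" and hessV :: "real^'d \<Rightarrow> real^'d^'d"
    and \<alpha> \<beta> :: real
  assumes grad: "\<And>x. (V has_derivative (\<lambda>h. gradV x \<bullet> h)) (at x)"
    and hess: "\<And>x. (gradV has_derivative (\<lambda>h. hessV x *v h)) (at x)"
    and hess_cont: "continuous_on UNIV hessV"
    and alpha_pos: "0 < \<alpha>" and alpha_le_beta: "\<alpha> \<le> \<beta>"
    and strongly_convex: "\<And>x h. \<alpha> * (h \<bullet> h) \<le> h \<bullet> (hessV x *v h)"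
    and smooth: "\<And>x h. \<bar>h \<bullet> (hessV x *v h)\<bar> \<le> \<beta> * (h \<bullet> h)"
begin

lemma beta_pos: "0 < \<beta>" using alpha_pos alpha_le_beta by simp

lemma DERIV_V_line: "((\<lambda>t. V (y + t *\<^sub>R d)) has_real_derivative gradV (y + t *\<^sub>R d) \<bullet> d) (at t)"
proof -
  have "((\<lambda>t. y + t *\<^sub>R d) has_derivative (\<lambda>s. s *\<^sub>R d)) (at t)"
    by (auto intro!: derivative_eq_intros)
  from has_derivative_compose[OF this grad]
  show ?thesis by (simp add: has_field_derivative_def mult_commute_abs)
qed

lemma DERIV_grad_line:
  "((\<lambda>t. gradV (y + t *\<^sub>R d) \<bullet> w) has_real_derivative (hessV (y + t *\<^sub>R d) *v d) \<bullet> w) (at t)"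
proof -
  have "((\<lambda>t. y + t *\<^sub>R d) has_derivative (\<lambda>s. s *\<^sub>R d)) (at t)"
    by (auto intro!: derivative_eq_intros)
  from has_derivative_inner_left[OF has_derivative_compose[OF this hess], of w]
  show ?thesis by (simp add: has_field_derivative_def mult_commute_abs matvec.scaleR_right)
qed

section \<open>Symmetry of the Hessian\<close>

lemma second_difference_mvt:
  assumes t: "t > 0"
  shows "\<exists>\<xi> \<zeta>. \<xi> \<in> {0<..<t} \<and> \<zeta> \<in> {0<..<t} \<and>
    V (x + t *\<^sub>R h + t *\<^sub>R k) - V (x + t *\<^sub>R h) - V (x + t *\<^sub>R k) + V x
      = t\<^sup>2 * ((hessV (x + \<xi> *\<^sub>R h + \<zeta> *\<^sub>R k) *v k) \<bullet> h)"
proof -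
  define g where "g s = V ((x + t *\<^sub>R k) + s *\<^sub>R h) - V (x + s *\<^sub>R h)" for s
  have "(g has_real_derivative (gradV ((x + t *\<^sub>R k) + s *\<^sub>R h) \<bullet> h - gradV (x + s *\<^sub>R h) \<bullet> h)) (at s)" for s
    unfolding g_def by (intro DERIV_diff DERIV_V_line)
  from MVT2[OF t, of g, OF this] obtain \<xi> where \<xi>: "0 < \<xi>" "\<xi> < t"
    and g: "g t - g 0 = (t - 0) * (gradV ((x + t *\<^sub>R k) + \<xi> *\<^sub>R h) \<bullet> h - gradV (x + \<xi> *\<^sub>R h) \<bullet> h)" by blast
  obtain \<zeta> where \<zeta>: "0 < \<zeta>" "\<zeta> < t"
    and d: "gradV ((x + \<xi> *\<^sub>R h) + t *\<^sub>R k) \<bullet> h - gradV ((x + \<xi> *\<^sub>R h) + 0 *\<^sub>R k) \<bullet> h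
      = (t - 0) * ((hessV ((x + \<xi> *\<^sub>R h) + \<zeta> *\<^sub>R k) *v k) \<bullet> h)"
    using MVT2[OF t, of "\<lambda>s. gradV ((x + \<xi> *\<^sub>R h) + s *\<^sub>R k) \<bullet> h", OF DERIV_grad_line] by blast
  have "g t - g 0 = t\<^sup>2 * ((hessV (x + \<xi> *\<^sub>R h + \<zeta> *\<^sub>R k) *v k) \<bullet> h)"
    using g d by (simp add: power2_eq_square add_ac)
  then show ?thesis using \<xi> \<zeta> by (intro exI[of _ \<xi>] exI[of _ \<zeta>]) (simp add: g_def add_ac)
qed

text \<open>The second difference of \<open>V\<close> is symmetric in the two directions. Two mean
  value expansions, one for each order of the directions, express it through \<open>hessV\<close> at
  points that tend to \<open>x\<close>, where continuity applies.\<close>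

lemma hess_form_symmetric: "(hessV x *v k) \<bullet> h = (hessV x *v h) \<bullet> k"
proof -
  define t where "t n = 1 / (real n + 1)" for n :: nat
  have t: "t n > 0" for n by (simp add: t_def)
  have t0: "t \<longlonglongrightarrow> 0" unfolding t_def using LIMSEQ_inverse_real_of_nat by (simp add: inverse_eq_divide add.commute)
  have lim: "(\<lambda>n. (hessV (x + a n *\<^sub>R u + b n *\<^sub>R v) *v v) \<bullet> u) \<longlonglongrightarrow> (hessV x *v v) \<bullet> u"
    if "\<And>n. a n \<in> {0<..<t n}" "\<And>n. b n \<in> {0<..<t n}" for a b u v
  proof -
    have "a \<longlonglongrightarrow> 0" "b \<longlonglongrightarrow> 0"
      using that by (auto intro!: tendsto_sandwich[OF _ _ tendsto_const t0] always_eventually less_imp_le)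
    then have p: "(\<lambda>n. x + a n *\<^sub>R u + b n *\<^sub>R v) \<longlonglongrightarrow> x" by (auto intro!: tendsto_eq_intros)
    have "isCont hessV x" using hess_cont by (simp add: continuous_on_eq_continuous_at)
    from isCont_tendsto_compose[OF this p] show ?thesis
      by (intro tendsto_inner matvec.tendsto tendsto_const)
  qed
  obtain a b where ab: "\<And>n. a n \<in> {0<..<t n}" "\<And>n. b n \<in> {0<..<t n}"
    and e1: "\<And>n. V (x + t n *\<^sub>R h + t n *\<^sub>R k) - V (x + t n *\<^sub>R h) - V (x + t n *\<^sub>R k) + V x
      = (t n)\<^sup>2 * ((hessV (x + a n *\<^sub>R h + b n *\<^sub>R k) *v k) \<bullet> h)"
    using second_difference_mvt[OF t, where x = x and h = h and k = k] by metis
  obtain c d where cd: "\<And>n. c n \<in> {0<..<t n}" "\<And>n. d n \<in> {0<..<t n}"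
    and e2: "\<And>n. V (x + t n *\<^sub>R k + t n *\<^sub>R h) - V (x + t n *\<^sub>R k) - V (x + t n *\<^sub>R h) + V x
      = (t n)\<^sup>2 * ((hessV (x + c n *\<^sub>R k + d n *\<^sub>R h) *v h) \<bullet> k)"
    using second_difference_mvt[OF t, where x = x and h = k and k = h] by metis
  have "(hessV (x + a n *\<^sub>R h + b n *\<^sub>R k) *v k) \<bullet> h = (hessV (x + c n *\<^sub>R k + d n *\<^sub>R h) *v h) \<bullet> k" for n
  proof -
    have "V (x + t n *\<^sub>R h + t n *\<^sub>R k) = V (x + t n *\<^sub>R k + t n *\<^sub>R h)" by (simp add: add_ac)
    then have "(t n)\<^sup>2 * ((hessV (x + a n *\<^sub>R h + b n *\<^sub>R k) *v k) \<bullet> h)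
      = (t n)\<^sup>2 * ((hessV (x + c n *\<^sub>R k + d n *\<^sub>R h) *v h) \<bullet> k)"
      using e1[of n] e2[of n] by linarith
    then show ?thesis using t[of n] by simp
  qed
  then have "(\<lambda>n. (hessV (x + a n *\<^sub>R h + b n *\<^sub>R k) *v k) \<bullet> h) \<longlonglongrightarrow> (hessV x *v h) \<bullet> k"
    using lim[OF cd, of k h] by simp
  then show ?thesis by (rule LIMSEQ_unique[OF lim[OF ab, of h k]])
qed

lemma hess_transpose: "transpose (hessV x) = hessV x"
proof -
  have "hessV x $ i $ j = hessV x $ j $ i" for i j
    using hess_form_symmetric[of x "axis j 1" "axis i 1"] by (simp add: inner_axis matrix_vector_axis_nth)
  then show ?thesis by (simp add: transpose_def vec_eq_iff)
qed

lemma hess_psd: "sym_psd (hessV x)"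
  using hess_transpose alpha_pos
  by (auto simp: sym_psd_def intro!: order_trans[OF _ strongly_convex])

section \<open>Cocoercivity, monotonicity and quadratic bounds\<close>

lemma hess_norm_sq: "(norm (hessV x *v h))\<^sup>2 \<le> \<beta> * (h \<bullet> (hessV x *v h))"
proof (rule sym_psd_norm_sq_le[OF hess_psd])
  fix y show "y \<bullet> (hessV x *v y) \<le> \<beta> * (y \<bullet> y)" using smooth[of y x] by simp
qed

text \<open>Monotonicity of a scalar function replaces an integral of the Hessian along the segment.
  The direction \<open>w\<close> is chosen so that the derivative of \<psi> equals \<open>\<beta> *
  (d \<bullet> H) - (norm H)\<^sup>2 + (norm (H - D))\<^sup>2\<close>, with \<open>H\<close> the
  Hessian applied to \<open>d\<close>; this is nonnegative by \<open>hess_norm_sq\<close>, and the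
  total increment of \<psi> is the claim.\<close>

lemma grad_cocoercive: "(norm (gradV x - gradV y))\<^sup>2 \<le> \<beta> * ((gradV x - gradV y) \<bullet> (x - y))"
proof -
  define d where "d = x - y"
  define D where "D = gradV x - gradV y"
  define w where "w = \<beta> *\<^sub>R d - 2 *\<^sub>R D"
  define \<psi> where "\<psi> t = gradV (y + t *\<^sub>R d) \<bullet> w + t * (D \<bullet> D)" for t
  have mono: "\<exists>l. (\<psi> has_real_derivative l) (at t) \<and> 0 \<le> l" for t
  proof (intro exI conjI)
    let ?H = "hessV (y + t *\<^sub>R d) *v d"
    show "(\<psi> has_real_derivative (?H \<bullet> w + D \<bullet> D)) (at t)"
      unfolding \<psi>_def by (auto intro!: derivative_eq_intros DERIV_grad_line)
    have "?H \<bullet> w + D \<bullet> D = (\<beta> * (d \<bullet> ?H) - (norm ?H)\<^sup>2) + (norm (?H - D))\<^sup>2"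
      by (simp add: w_def power2_norm_eq_inner inner_diff_left inner_diff_right inner_commute algebra_simps)
    then show "0 \<le> ?H \<bullet> w + D \<bullet> D" using hess_norm_sq[of "y + t *\<^sub>R d" d] by simp
  qed
  have "\<psi> 0 \<le> \<psi> 1" by (rule DERIV_nonneg_imp_nondecreasing[OF zero_le_one], rule mono)
  moreover have "\<psi> 1 - \<psi> 0 = D \<bullet> w + D \<bullet> D"
    by (simp add: \<psi>_def d_def D_def inner_diff_left)
  ultimately have "0 \<le> D \<bullet> w + D \<bullet> D" by simp
  then have "0 \<le> \<beta> * (D \<bullet> d) - D \<bullet> D" by (simp add: w_def inner_diff_right)
  then show ?thesis by (simp add: d_def D_def power2_norm_eq_inner)
qed

lemma grad_lipschitz: "norm (gradV x - gradV y) \<le> \<beta> * norm (x - y)"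
proof -
  let ?D = "gradV x - gradV y"
  have "(norm ?D)\<^sup>2 \<le> \<beta> * (?D \<bullet> (x - y))" by (rule grad_cocoercive)
  also have "\<dots> \<le> \<beta> * (norm ?D * norm (x - y))"
    using beta_pos by (intro mult_left_mono norm_cauchy_schwarz) simp
  finally have "norm ?D * norm ?D \<le> norm ?D * (\<beta> * norm (x - y))" by (simp add: power2_eq_square mult_ac)
  then show ?thesis using beta_pos by (cases "norm ?D = 0") (auto simp: mult_le_cancel_left)
qed

lemma grad_strongly_monotone: "\<alpha> * (norm (x - y))\<^sup>2 \<le> (gradV x - gradV y) \<bullet> (x - y)"
proof -
  define d where "d = x - y"
  define \<psi> where "\<psi> t = gradV (y + t *\<^sub>R d) \<bullet> d - t * (\<alpha> * (d \<bullet> d))" for t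
  have mono: "\<exists>l. (\<psi> has_real_derivative l) (at t) \<and> 0 \<le> l" for t
  proof (intro exI conjI)
    show "(\<psi> has_real_derivative ((hessV (y + t *\<^sub>R d) *v d) \<bullet> d - \<alpha> * (d \<bullet> d))) (at t)"
      unfolding \<psi>_def by (auto intro!: derivative_eq_intros DERIV_grad_line)
    show "0 \<le> (hessV (y + t *\<^sub>R d) *v d) \<bullet> d - \<alpha> * (d \<bullet> d)"
      using strongly_convex[of d "y + t *\<^sub>R d"] by (simp add: inner_commute)
  qed
  have "\<psi> 0 \<le> \<psi> 1" by (rule DERIV_nonneg_imp_nondecreasing[OF zero_le_one], rule mono)
  then show ?thesis by (simp add: \<psi>_def d_def inner_diff_left power2_norm_eq_inner)
qed

lemma V_upper: "V y \<le> V x + gradV x \<bullet> (y - x) + \<beta> / 2 * (norm (y - x))\<^sup>2"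
proof -
  define d where "d = y - x"
  define \<psi> where "\<psi> t = t * (gradV x \<bullet> d) + t\<^sup>2 * (\<beta> / 2 * (d \<bullet> d)) - V (x + t *\<^sub>R d)" for t
  have mono: "\<exists>l. (\<psi> has_real_derivative l) (at t) \<and> 0 \<le> l" if "0 \<le> t" for t
  proof (intro exI conjI)
    show "(\<psi> has_real_derivative (gradV x \<bullet> d + t * (\<beta> * (d \<bullet> d)) - gradV (x + t *\<^sub>R d) \<bullet> d)) (at t)"
      unfolding \<psi>_def by (auto intro!: derivative_eq_intros DERIV_V_line)
    have "(gradV (x + t *\<^sub>R d) - gradV x) \<bullet> d \<le> norm (gradV (x + t *\<^sub>R d) - gradV x) * norm d"
      by (rule norm_cauchy_schwarz)
    also have "\<dots> \<le> (\<beta> * norm (x + t *\<^sub>R d - x)) * norm d"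
      by (intro mult_right_mono grad_lipschitz) simp
    also have "\<dots> = t * (\<beta> * (d \<bullet> d))"
      using that by (simp add: power2_norm_eq_inner[symmetric] power2_eq_square)
    finally show "0 \<le> gradV x \<bullet> d + t * (\<beta> * (d \<bullet> d)) - gradV (x + t *\<^sub>R d) \<bullet> d"
      by (simp add: inner_diff_left)
  qed
  have "\<psi> 0 \<le> \<psi> 1" by (rule DERIV_nonneg_imp_nondecreasing[OF zero_le_one], rule mono, assumption)
  then show ?thesis by (simp add: \<psi>_def d_def power2_norm_eq_inner)
qed

lemma V_lower: "V x + gradV x \<bullet> (y - x) + \<alpha> / 2 * (norm (y - x))\<^sup>2 \<le> V y"
proof -
  define d where "d = y - x"
  define \<psi> where "\<psi> t = V (x + t *\<^sub>R d) - t * (gradV x \<bullet> d) - t\<^sup>2 * (\<alpha> / 2 * (d \<bullet> d))" for t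
  have mono: "\<exists>l. (\<psi> has_real_derivative l) (at t) \<and> 0 \<le> l" if "0 \<le> t" for t
  proof (intro exI conjI)
    show "(\<psi> has_real_derivative (gradV (x + t *\<^sub>R d) \<bullet> d - gradV x \<bullet> d - t * (\<alpha> * (d \<bullet> d)))) (at t)"
      unfolding \<psi>_def by (auto intro!: derivative_eq_intros DERIV_V_line)
    \<comment> \<open>Strong monotonicity between \<open>x\<close> and
      \<open>x + t *\<^sub>R d\<close> carries one factor \<open>t\<close> too many; it is cancelled
      for \<open>t > 0\<close>, and \<open>t = 0\<close> is trivial.\<close>
    have "t * (t * (\<alpha> * (d \<bullet> d))) \<le> t * ((gradV (x + t *\<^sub>R d) - gradV x) \<bullet> d)"
      using grad_strongly_monotone[of "x + t *\<^sub>R d" x]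
      by (simp add: power_mult_distrib power2_eq_square power2_norm_eq_inner[symmetric] mult_ac)
    then show "0 \<le> gradV (x + t *\<^sub>R d) \<bullet> d - gradV x \<bullet> d - t * (\<alpha> * (d \<bullet> d))"
      using that by (cases "t = 0") (auto simp: inner_diff_left mult_le_cancel_left)
  qed
  have "\<psi> 0 \<le> \<psi> 1" by (rule DERIV_nonneg_imp_nondecreasing[OF zero_le_one], rule mono, assumption)
  then show ?thesis by (simp add: \<psi>_def d_def power2_norm_eq_inner)
qed

lemma grad_norm_le: "norm (gradV x) \<le> (norm (gradV 0) + \<beta>) * (1 + norm x)"
proof -
  have "norm (gradV x) \<le> norm (gradV 0) + \<beta> * norm x"
    using grad_lipschitz[of x 0] norm_triangle_ineq2[of "gradV x" "gradV 0"] by simp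
  also have "\<dots> \<le> (norm (gradV 0) + \<beta>) * (1 + norm x)"
    using beta_pos by (simp add: algebra_simps)
  finally show ?thesis .
qed

lemma V_abs_le: "\<bar>V x\<bar> \<le> (\<bar>V 0\<bar> + norm (gradV 0) + \<beta>) * (1 + norm x)\<^sup>2"
proof -
  have q: "\<bar>gradV 0 \<bullet> x\<bar> \<le> norm (gradV 0) * norm x" by (rule Cauchy_Schwarz_ineq2)
  have "\<alpha> / 2 * (norm x)\<^sup>2 \<ge> 0" using alpha_pos by simp
  moreover have "V 0 + gradV 0 \<bullet> x + \<alpha> / 2 * (norm x)\<^sup>2 \<le> V x" using V_lower[of 0 x] by simp
  moreover have "V x \<le> V 0 + gradV 0 \<bullet> x + \<beta> / 2 * (norm x)\<^sup>2" using V_upper[of x 0] by simp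
  moreover have "\<beta> / 2 * (norm x)\<^sup>2 \<le> \<beta> * (norm x)\<^sup>2" "0 \<le> \<beta> * (norm x)\<^sup>2" using beta_pos by simp_all
  ultimately have "\<bar>V x\<bar> \<le> \<bar>V 0\<bar> + norm (gradV 0) * norm x + \<beta> * (norm x)\<^sup>2" using q by linarith
  also have "\<dots> \<le> \<bar>V 0\<bar> * (1 + norm x)\<^sup>2 + norm (gradV 0) * (1 + norm x)\<^sup>2 + \<beta> * (1 + norm x)\<^sup>2"
  proof (intro add_mono mult_left_mono)
    show "\<bar>V 0\<bar> \<le> \<bar>V 0\<bar> * (1 + norm x)\<^sup>2"
      using mult_left_mono[of 1 "(1 + norm x)\<^sup>2" "\<bar>V 0\<bar>"] by (simp add: one_le_power)
    show "norm x \<le> (1 + norm x)\<^sup>2" by (simp add: power2_eq_square algebra_simps)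
    show "(norm x)\<^sup>2 \<le> (1 + norm x)\<^sup>2" by (intro power_mono) auto
  qed (use beta_pos in auto)
  finally show ?thesis by (simp add: algebra_simps)
qed

lemma V_cont: "continuous_on UNIV V"
  by (intro continuous_at_imp_continuous_on ballI has_derivative_continuous[OF grad])

lemma grad_cont: "continuous_on UNIV gradV"
  by (intro continuous_at_imp_continuous_on ballI has_derivative_continuous[OF hess])

lemma V_measurable [measurable]: "V \<in> borel_measurable borel"
  by (rule borel_measurable_continuous_onI[OF V_cont])

lemma grad_measurable [measurable]: "gradV \<in> borel_measurable borel"
  by (rule borel_measurable_continuous_onI[OF grad_cont])

lemma hess_measurable [measurable]: "hessV \<in> borel_measurable borel"
  by (rule borel_measurable_continuous_onI[OF hess_cont])

end

subsection \<open>Gaussian expectations, entropy and the trace inequality\<close>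

lemma gauss_integral:
  fixes B :: "real^'d^'d" and f :: "real^'d \<Rightarrow> real"
  assumes "det B \<noteq> 0" "B ** transpose B = S" and f: "f \<in> borel_measurable borel"
  shows "(\<integral>x. f x \<partial>gauss m S) = (\<integral>z. f (m + B *v z) \<partial>std_gauss)"
    and "integrable (gauss m S) f \<longleftrightarrow> integrable std_gauss (\<lambda>z. f (m + B *v z))"
  unfolding gauss_eq_distr[OF assms(1,2), of m] using f
  by (simp_all add: integral_distr integrable_distr_eq)

lemma prob_space_gauss:
  assumes "sym_pd S" shows "prob_space (gauss m S)"
proof -
  have "gauss m S = distr std_gauss borel (\<lambda>z. m + psd_sqrt S *v z)"
    by (rule gauss_eq_distr) (simp_all add: psd_sqrt_pd[OF assms] sym_pd_det_nz)
  then show ?thesis by (simp add: prob_space.prob_space_distr[OF prob_space_std_gauss])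
qed

lemma entropy_gauss:
  assumes S: "sym_pd (S :: real^'d^'d)"
  shows "entropy_dens (gauss_dens m S) = - ln (det S) / 2 - (ln ((2 * pi) ^ CARD('d)) + real CARD('d)) / 2"
proof -
  let ?B = "psd_sqrt S" and ?c = "(2 * pi) ^ CARD('d)"
  have B: "det ?B \<noteq> 0" "?B ** transpose ?B = S" by (simp_all add: psd_sqrt_pd[OF S] sym_pd_det_nz)
  have dS: "det S > 0" by (rule sym_pd_det_pos[OF S])
  have c: "?c > 0" by simp
  have ln: "ln (gauss_dens m S (m + ?B *v z)) = - (z \<bullet> z) / 2 - ln (?c * det S) / 2" for z
  proof -
    have q: "(?B *v z) \<bullet> (matrix_inv S *v (?B *v z)) = z \<bullet> z"
      using matrix_inv_factor[OF B] by (simp add: inner_matrix_vector_transpose matrix_vector_mul_assoc)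
    have "gauss_dens m S (m + ?B *v z) = exp (- (z \<bullet> z) / 2) / sqrt (?c * det S)"
      by (simp add: gauss_dens_def q)
    moreover have "ln (exp a / sqrt q) = a - ln q / 2" if "q > 0" for a q :: real
      using that by (simp add: ln_div ln_sqrt)
    ultimately show ?thesis using mult_pos_pos[OF c dS] by simp
  qed
  have zz: "has_bochner_integral std_gauss (\<lambda>z :: real^'d. z \<bullet> z) (real CARD('d))"
    using std_gauss_inner_linear[of "mat 1 :: real^'d^'d" "mat 1"] by (simp add: inner_mat_1)
  have "entropy_dens (gauss_dens m S) = (\<integral>x. ln (gauss_dens m S x) \<partial>gauss m S)"
    by (simp add: entropy_dens_def gauss_def)
  also have "\<dots> = (\<integral>z. - (z \<bullet> z) / 2 - ln (?c * det S) / 2 \<partial>(std_gauss :: (real^'d) measure))"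
    by (subst gauss_integral(1)[OF B]) (simp_all add: ln)
  also have "\<dots> = - real CARD('d) / 2 - ln (?c * det S) / 2"
    using zz by (simp add: has_bochner_integral_iff)
  also have "ln (?c * det S) = ln ?c + ln (det S)" using c dS by (rule ln_mult_pos)
  finally show ?thesis by (simp add: field_simps)
qed

text \<open>Gibbs' inequality for the centred Gaussians with covariances \<open>P\<close> and the identity.\<close>

lemma trace_ge_ln_det:
  assumes P: "sym_pd (P :: real^'d^'d)"
  shows "real CARD('d) + ln (det P) \<le> trace P"
proof -
  define B where "B = psd_sqrt P"
  have B: "sym_pd B" "B ** B = P" "transpose B = B" by (simp_all add: B_def psd_sqrt_pd[OF P])
  have dB: "det B > 0" using B(1) by (rule sym_pd_det_pos)
  \<comment> \<open>\<open>exp (u z)\<close> is the ratio of the density of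
    \<open>B\<^sup>-\<^sup>1 Z\<close> to that of \<open>Z\<close>, so it has mean 1; then
    \<open>1 + u \<le> exp u\<close> forces the mean of \<open>u\<close> to be at most 0.\<close>
  define u where "u z = (z \<bullet> z) / 2 - ((B *v z) \<bullet> (B *v z)) / 2 + ln (det B)" for z :: "real^'d"
  have [measurable]: "u \<in> borel_measurable borel" unfolding u_def by measurable
  have dens: "gauss_dens 0 (mat 1) z * exp (u z) = det B * gauss_dens 0 (mat 1) (B *v z)" for z
  proof -
    have "exp (- (z \<bullet> z) / 2) * exp (u z) = exp (- ((B *v z) \<bullet> (B *v z)) / 2 + ln (det B))"
      unfolding u_def exp_add[symmetric] by simp
    also have "\<dots> = exp (- ((B *v z) \<bullet> (B *v z)) / 2) * det B" using dB by (subst exp_add) simp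
    finally have "exp (- (z \<bullet> z) / 2) * exp (u z) = exp (- ((B *v z) \<bullet> (B *v z)) / 2) * det B" .
    then show ?thesis by (simp add: gauss_dens_std mult.commute)
  qed
  have gp: "0 \<le> gauss_dens 0 (mat 1) z" for z :: "real^'d" by (simp add: gauss_dens_std)
  have "(\<integral>\<^sup>+z. ennreal (exp (u z)) \<partial>std_gauss) = (\<integral>\<^sup>+z. ennreal (gauss_dens 0 (mat 1) z) * ennreal (exp (u z)) \<partial>lborel)"
    unfolding std_gauss_def gauss_def by (subst nn_integral_density) simp_all
  also have "\<dots> = (\<integral>\<^sup>+z. ennreal \<bar>det B\<bar> * ennreal (gauss_dens 0 (mat 1) (B *v z)) \<partial>lborel)"
    using dB by (intro nn_integral_cong) (simp add: ennreal_mult[symmetric] gp dens)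
  also have "\<dots> = ennreal \<bar>det B\<bar> * (\<integral>\<^sup>+z. ennreal (gauss_dens 0 (mat 1) (B *v z)) \<partial>lborel)"
    by (rule nn_integral_cmult) simp
  also have "\<dots> = (\<integral>\<^sup>+z. ennreal (gauss_dens 0 (mat 1) (z :: real^'d)) \<partial>lborel)"
    using dB by (intro nn_integral_lborel_matrix[symmetric]) simp_all
  also have "\<dots> = emeasure (std_gauss :: (real^'d) measure) UNIV"
    unfolding std_gauss_def gauss_def by (simp add: emeasure_density)
  also have "\<dots> = 1" using prob_space.emeasure_space_1[OF prob_space_std_gauss[where 'd='d]] by simp
  finally have one: "(\<integral>\<^sup>+z. ennreal (exp (u z)) \<partial>std_gauss) = ennreal 1" by simp
  have ei: "integrable std_gauss (\<lambda>z. exp (u z))"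
    by (rule integrableI_nn_integral_finite[OF _ _ one]) simp_all
  have e1: "(\<integral>z. exp (u z) \<partial>std_gauss) = 1"
    using one by (simp add: integral_eq_nn_integral)
  have zz: "has_bochner_integral std_gauss (\<lambda>z :: real^'d. z \<bullet> z) (real CARD('d))"
    using std_gauss_inner_linear[of "mat 1 :: real^'d^'d" "mat 1"] by (simp add: inner_mat_1)
  have "B \<bullet> B = trace P" by (simp add: matrix_inner_eq_trace B)
  with std_gauss_inner_linear[of B B]
  have BB: "has_bochner_integral std_gauss (\<lambda>z :: real^'d. (B *v z) \<bullet> (B *v z)) (trace P)" by simp
  have ui: "has_bochner_integral std_gauss u (real CARD('d) / 2 - trace P / 2 + ln (det B))"
    using zz BB unfolding u_def by (simp add: has_bochner_integral_iff)
  have "(\<integral>z. 1 + u z \<partial>std_gauss) \<le> (\<integral>z. exp (u z) \<partial>std_gauss)"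
    using ui ei by (intro integral_mono) (auto simp: has_bochner_integral_iff exp_ge_add_one_self)
  then have "1 + (real CARD('d) / 2 - trace P / 2 + ln (det B)) \<le> 1"
    using ui by (simp add: e1 has_bochner_integral_iff)
  moreover have "ln (det P) = 2 * ln (det B)"
  proof -
    have "det P = det B * det B" using B(2) by (metis det_mul)
    then show ?thesis using dB by (simp add: ln_mult_pos)
  qed
  ultimately show ?thesis by simp
qed

text \<open>\<open>J ** N\<close> need not be symmetric; conjugating \<open>N\<close> by the root of
  \<open>J\<close> restores symmetry and preserves trace and determinant.\<close>

lemma trace_mult_ge_ln_det:
  assumes J: "sym_pd J" and N: "sym_pd (N :: real^'d^'d)"
  shows "real CARD('d) + ln (det J) + ln (det N) \<le> trace (J ** N)"
proof -
  define G where "G = psd_sqrt J"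
  have G: "sym_pd G" "G ** G = J" "transpose G = G" by (simp_all add: G_def psd_sqrt_pd[OF J])
  have "sym_pd (G ** N ** transpose G)" using N G sym_pd_congruence sym_pd_det_nz by blast
  from trace_ge_ln_det[OF this] have "real CARD('d) + ln (det (G ** N ** G)) \<le> trace (G ** N ** G)"
    by (simp add: G)
  moreover have "det (G ** N ** G) = det J * det N" by (simp add: det_mul G(2)[symmetric] mult_ac)
  moreover have "trace (G ** N ** G) = trace (J ** N)"
    by (metis G(2) matrix_mul_assoc trace_mul_sym)
  moreover have "ln (det J * det N) = ln (det J) + ln (det N)"
    by (rule ln_mult_pos) (simp_all add: sym_pd_det_pos J N)
  ultimately show ?thesis by simp
qed

section \<open>Potential, gradient and Hessian averaged over a Gaussian\<close>

lemma affine_growth: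
  fixes B :: "real^'d^'n"
  obtains \<kappa> where "0 \<le> \<kappa>" "\<And>z. 1 + norm (m + B *v z) \<le> \<kappa> * (1 + norm z)" "\<And>z. norm (B *v z) \<le> \<kappa> * norm z"
proof -
  obtain k where k: "0 \<le> k" "\<And>A x. norm ((A :: real^'d^'n) *v x) \<le> norm A * norm x * k"
    using matvec.nonneg_bounded by blast
  let ?\<kappa> = "1 + norm m + norm B * k"
  show ?thesis
  proof
    show "0 \<le> ?\<kappa>" using k by simp
    show "1 + norm (m + B *v z) \<le> ?\<kappa> * (1 + norm z)" for z
    proof -
      have "norm (m + B *v z) \<le> norm m + norm B * k * norm z"
        using norm_triangle_ineq[of m "B *v z"] k(2)[of B z] by (simp add: mult_ac)
      moreover have "0 \<le> norm z + norm m * norm z + norm B * k" using k by simp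
      ultimately show ?thesis by (simp add: algebra_simps)
    qed
    show "norm (B *v z) \<le> ?\<kappa> * norm z" for z
    proof -
      have "norm (B *v z) \<le> norm B * k * norm z" using k(2)[of B z] by (simp add: mult_ac)
      also have "\<dots> \<le> ?\<kappa> * norm z" by (intro mult_right_mono) auto
      finally show ?thesis .
    qed
  qed
qed

context smooth_potential
begin

lemma V_integrable: "integrable std_gauss (\<lambda>z. V (m + B *v z))"
proof -
  obtain \<kappa> where \<kappa>: "0 \<le> \<kappa>" "\<And>z. 1 + norm (m + B *v z) \<le> \<kappa> * (1 + norm z)" using affine_growth[of m B] by metis
  let ?c = "\<bar>V 0\<bar> + norm (gradV 0) + \<beta>"
  show ?thesis
  proof (rule std_gauss_integrable_quadratic[where C = "?c * \<kappa>\<^sup>2"])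
    fix z
    have "\<bar>V (m + B *v z)\<bar> \<le> ?c * (1 + norm (m + B *v z))\<^sup>2" by (rule V_abs_le)
    also have "\<dots> \<le> ?c * (\<kappa> * (1 + norm z))\<^sup>2"
      using \<kappa> beta_pos by (intro mult_left_mono power_mono) auto
    finally show "\<bar>V (m + B *v z)\<bar> \<le> ?c * \<kappa>\<^sup>2 * (1 + norm z)\<^sup>2" by (simp add: power_mult_distrib mult_ac)
  qed measurable
qed

lemma grad_affine_bound:
  obtains \<kappa> where "0 \<le> \<kappa>" "\<And>z. norm (gradV (m + B *v z)) \<le> \<kappa> * (1 + norm z)"
proof -
  obtain \<kappa> where \<kappa>: "0 \<le> \<kappa>" "\<And>z. 1 + norm (m + B *v z) \<le> \<kappa> * (1 + norm z)" using affine_growth[of m B] by metis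
  let ?c = "norm (gradV 0) + \<beta>"
  show ?thesis
  proof
    show "0 \<le> ?c * \<kappa>" using \<kappa> beta_pos by simp
    fix z
    have "norm (gradV (m + B *v z)) \<le> ?c * (1 + norm (m + B *v z))" by (rule grad_norm_le)
    also have "\<dots> \<le> ?c * (\<kappa> * (1 + norm z))" using \<kappa> beta_pos by (intro mult_left_mono) auto
    finally show "norm (gradV (m + B *v z)) \<le> ?c * \<kappa> * (1 + norm z)" by (simp add: mult_ac)
  qed
qed

lemma grad_norm_sq_integrable: "integrable std_gauss (\<lambda>z. (norm (gradV (m + B *v z) - a))\<^sup>2)"
proof -
  obtain \<kappa> where \<kappa>: "0 \<le> \<kappa>" "\<And>z. norm (gradV (m + B *v z)) \<le> \<kappa> * (1 + norm z)" using grad_affine_bound[of m B] by metis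
  show ?thesis
  proof (rule std_gauss_integrable_quadratic[where C = "(\<kappa> + norm a)\<^sup>2"])
    fix z
    have "norm (gradV (m + B *v z) - a) \<le> \<kappa> * (1 + norm z) + norm a"
      using norm_triangle_ineq4[of "gradV (m + B *v z)" a] \<kappa>(2)[of z] by simp
    also have "\<dots> \<le> (\<kappa> + norm a) * (1 + norm z)" by (simp add: algebra_simps)
    finally have "(norm (gradV (m + B *v z) - a))\<^sup>2 \<le> ((\<kappa> + norm a) * (1 + norm z))\<^sup>2" by (intro power_mono) auto
    then show "\<bar>(norm (gradV (m + B *v z) - a))\<^sup>2\<bar> \<le> (\<kappa> + norm a)\<^sup>2 * (1 + norm z)\<^sup>2"
      by (simp add: power_mult_distrib)
  qed measurable
qed

lemma grad_integrable: "integrable std_gauss (\<lambda>z. gradV (m + B *v z))"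
proof (rule Bochner_Integration.integrable_bound[where f = "\<lambda>z. 1 + (norm (gradV (m + B *v z) - 0))\<^sup>2"])
  show "integrable std_gauss (\<lambda>z. 1 + (norm (gradV (m + B *v z) - 0))\<^sup>2)"
    by (intro Bochner_Integration.integrable_add grad_norm_sq_integrable) simp
  have "norm v \<le> norm (1 + (norm (v - 0))\<^sup>2)" for v :: "real^'d"
    using zero_le_power2[of "norm v - 1"] by (simp add: power2_diff) (smt (verit) zero_le_power2)
  then show "AE z in std_gauss. norm (gradV (m + B *v z)) \<le> norm (1 + (norm (gradV (m + B *v z) - 0))\<^sup>2)"
    by (intro AE_I2)
qed measurable

lemma hess_norm_le: "norm (hessV x *v h) \<le> \<beta> * norm h"
proof -
  have "(norm (hessV x *v h))\<^sup>2 \<le> \<beta> * (h \<bullet> (hessV x *v h))" by (rule hess_norm_sq)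
  also have "\<dots> \<le> \<beta> * (\<beta> * (h \<bullet> h))" using smooth[of h x] beta_pos by (intro mult_left_mono) auto
  also have "\<dots> = (\<beta> * norm h)\<^sup>2" by (simp add: power_mult_distrib power2_norm_eq_inner power2_eq_square[of \<beta>])
  finally show ?thesis using beta_pos by (simp add: power2_le_iff_abs_le)
qed

lemma hess_integrable: "integrable std_gauss (\<lambda>z. hessV (m + B *v z))"
proof (rule Bochner_Integration.integrable_bound[where f = "\<lambda>z. \<beta> * norm (mat 1 :: real^'d^'d)"])
  have "norm (hessV x) \<le> norm (\<beta> * norm (mat 1 :: real^'d^'d))" for x
    using norm_matrix_mult_left_le[of \<beta> "hessV x" "mat 1 :: real^'d^'d"] hess_norm_le beta_pos by simp
  then show "AE z in std_gauss. norm (hessV (m + B *v z)) \<le> norm (\<beta> * norm (mat 1 :: real^'d^'d))"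
    by (intro AE_I2)
qed simp_all

definition mean_grad :: "real^'d \<Rightarrow> real^'d^'d \<Rightarrow> real^'d" where
  "mean_grad m B = (\<integral>z. gradV (m + B *v z) \<partial>std_gauss)"

definition mean_hess :: "real^'d \<Rightarrow> real^'d^'d \<Rightarrow> real^'d^'d" where
  "mean_hess m B = (\<integral>z. hessV (m + B *v z) \<partial>std_gauss)"

lemma mean_grad_inner: "has_bochner_integral std_gauss (\<lambda>z. gradV (m + B *v z) \<bullet> c) (mean_grad m B \<bullet> c)"
  using grad_integrable[of m B]
  by (simp add: has_bochner_integral_iff mean_grad_def)

lemma mean_hess_inner:
  "has_bochner_integral std_gauss (\<lambda>z. hessV (m + B *v z) \<bullet> C) (mean_hess m B \<bullet> C)"
  using hess_integrable[of m B]
  by (simp add: has_bochner_integral_iff mean_hess_def)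

lemma mean_hess_form:
  "has_bochner_integral std_gauss (\<lambda>z. (hessV (m + B *v z) *v w) \<bullet> v) ((mean_hess m B *v w) \<bullet> v)"
proof -
  have bl: "bounded_linear (\<lambda>H :: real^'d^'d. (H *v w) \<bullet> v)"
    using bounded_linear_inner_left_comp[OF matvec.bounded_linear_left] .
  show ?thesis
    using integrable_bounded_linear[OF bl hess_integrable[of m B]]
      integral_bounded_linear[OF bl hess_integrable[of m B]]
    by (simp add: has_bochner_integral_iff mean_hess_def)
qed

text \<open>Stein's identity along each coordinate axis, summed over the columns of
  \<open>C\<close>. The pair \<open>mean_grad m B\<close>, \<open>mean_hess m B ** B\<close> thereby
  acts as the gradient of the mean potential with respect to the mean and the factor.\<close>

lemma grad_stein:
  "has_bochner_integral std_gauss (\<lambda>z. gradV (m + B *v z) \<bullet> (c + C *v z)) (mean_grad m B \<bullet> c + (mean_hess m B ** B) \<bullet> C)"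
proof -
  obtain \<kappa> where \<kappa>: "0 \<le> \<kappa>" "\<And>z. norm (B *v z) \<le> \<kappa> * norm z" using affine_growth[of 0 B] by metis
  have st: "has_bochner_integral std_gauss (\<lambda>z. (gradV (m + B *v z) \<bullet> v) * (axis j 1 \<bullet> z)) ((mean_hess m B *v (B *v axis j 1)) \<bullet> v)" for j v
  proof -
    let ?f = "\<lambda>z. gradV (m + B *v z) \<bullet> v"
    let ?g = "\<lambda>z. (hessV (m + B *v z) *v (B *v axis j 1)) \<bullet> v"
    have lip: "\<bar>?f x - ?f y\<bar> \<le> (\<beta> * \<kappa> * norm v) * norm (x - y)" for x y
    proof -
      have "\<bar>?f x - ?f y\<bar> = \<bar>(gradV (m + B *v x) - gradV (m + B *v y)) \<bullet> v\<bar>" by (simp add: inner_diff_left)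
      also have "\<dots> \<le> norm (gradV (m + B *v x) - gradV (m + B *v y)) * norm v" by (rule Cauchy_Schwarz_ineq2)
      also have "\<dots> \<le> (\<beta> * norm (B *v (x - y))) * norm v"
        using grad_lipschitz[of "m + B *v x" "m + B *v y"]
        by (intro mult_right_mono) (simp_all add: matvec.diff_right)
      also have "\<dots> \<le> (\<beta> * (\<kappa> * norm (x - y))) * norm v"
        using \<kappa>(2)[of "x - y"] beta_pos by (intro mult_right_mono mult_left_mono) auto
      finally show ?thesis by (simp add: mult_ac)
    qed
    have M: "0 \<le> \<beta> * \<kappa> * norm v" using beta_pos \<kappa> by simp
    have der: "((\<lambda>t. ?f (z + t *\<^sub>R axis j 1)) has_real_derivative ?g z) (at 0)" for z
      using DERIV_grad_line[of "m + B *v z" "B *v axis j 1" v 0]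
      by (simp add: matvec.add_right matvec.scaleR_right add.assoc)
    have gi: "has_bochner_integral std_gauss ?g ((mean_hess m B *v (B *v axis j 1)) \<bullet> v)"
      by (rule mean_hess_form)
    have gm: "?g \<in> borel_measurable borel"
      using has_bochner_integral_iff[THEN iffD1, OF gi] borel_measurable_integrable by force
    show ?thesis
      using std_gauss_stein(1,3)[OF lip M der gm] gi by (simp add: has_bochner_integral_iff)
  qed
  have "gradV (m + B *v z) \<bullet> (C *v z) = (\<Sum>j\<in>UNIV. (gradV (m + B *v z) \<bullet> (C *v axis j 1)) * (axis j 1 \<bullet> z))" for z
  proof -
    have "C *v z = (\<Sum>j\<in>UNIV. (axis j 1 \<bullet> z) *\<^sub>R (C *v axis j 1))"
      by (simp add: vec_eq_iff matrix_vector_axis_nth inner_axis')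
        (simp add: matrix_vector_mult_def mult.commute)
    then show ?thesis by (simp add: inner_sum_right mult.commute)
  qed
  moreover have "has_bochner_integral std_gauss (\<lambda>z. \<Sum>j\<in>UNIV. (gradV (m + B *v z) \<bullet> (C *v axis j 1)) * (axis j 1 \<bullet> z))
    (\<Sum>j\<in>UNIV. (mean_hess m B *v (B *v axis j 1)) \<bullet> (C *v axis j 1))"
    by (intro has_bochner_integral_sum st)
  ultimately have "has_bochner_integral std_gauss (\<lambda>z. gradV (m + B *v z) \<bullet> (C *v z)) ((mean_hess m B ** B) \<bullet> C)"
    by (simp add: matrix_inner_eq_sum_axis[of "mean_hess m B ** B"] matrix_vector_mul_assoc)
  from has_bochner_integral_add[OF mean_grad_inner[of m B c] this]
  show ?thesis by (simp add: inner_add_right)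
qed

lemma free_energy_factor:
  assumes B: "det B \<noteq> 0" and S: "B ** transpose B = S"
  shows "free_energy V m S = (\<integral>z. V (m + B *v z) \<partial>std_gauss) - ln (det S) / 2
    - (ln ((2 * pi) ^ CARD('d)) + real CARD('d)) / 2"
proof -
  have "sym_pd S" using sym_pd_factor[OF B] S by simp
  then show ?thesis
    by (simp add: free_energy_def potential_def gauss_integral(1)[OF B S] entropy_gauss)
qed

end

subsection \<open>The Wasserstein distance between Gaussians\<close>

text \<open>\<open>opt_factor K S\<close> is \<open>L ** K\<close> for the optimal transport map
  \<open>L = K\<^sup>-\<^sup>1 (K S K)\<^sup>1\<^sup>/\<^sup>2 K\<^sup>-\<^sup>1\<close> from the
  centred Gaussian of covariance \<open>K\<^sup>2\<close> to that of covariance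
  \<open>S\<close>.\<close>

definition opt_factor :: "real^'d^'d \<Rightarrow> real^'d^'d \<Rightarrow> real^'d^'d" where
  "opt_factor K S = matrix_inv K ** psd_sqrt (K ** S ** K)"

definition bw_sq :: "real^'d \<Rightarrow> real^'d^'d \<Rightarrow> real^'d \<Rightarrow> real^'d^'d \<Rightarrow> real" where
  "bw_sq mh K m S = (norm (m - mh))\<^sup>2 + (norm (opt_factor K S - K))\<^sup>2"

lemma bw_sq_nonneg: "0 \<le> bw_sq mh K m S"
  by (simp add: bw_sq_def)

lemma opt_factor:
  assumes K: "sym_pd K" and S: "sym_pd (S :: real^'d^'d)"
  obtains L where "sym_pd L" "opt_factor K S = L ** K"
    "det (opt_factor K S) \<noteq> 0" "opt_factor K S ** transpose (opt_factor K S) = S"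
proof -
  let ?I = "matrix_inv K"
  define M where "M = psd_sqrt (K ** S ** K)"
  have tK: "transpose K = K" and dK: "det K \<noteq> 0" using K sym_pd_det_nz by (auto simp: sym_pd_def)
  have I: "sym_pd ?I" "transpose ?I = ?I" "det ?I \<noteq> 0"
    using sym_pd_inv[OF K] sym_pd_det_nz by (auto simp: sym_pd_def)
  have "sym_pd (K ** S ** K)" using sym_pd_congruence[OF S dK] by (simp add: tK)
  note M = psd_sqrt_pd[OF this, folded M_def]
  show ?thesis
  proof
    show "sym_pd (?I ** M ** ?I)" using sym_pd_congruence[OF M(1) I(3)] by (simp add: I)
    show "opt_factor K S = ?I ** M ** ?I ** K"
    proof -
      have "?I ** M ** ?I ** K = ?I ** M ** (?I ** K)" by (simp only: matrix_mul_assoc)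
      then show ?thesis by (simp add: opt_factor_def M_def matrix_inv_mult[OF dK])
    qed
    show "det (opt_factor K S) \<noteq> 0"
      using I(3) sym_pd_det_nz[OF M(1)] by (simp add: opt_factor_def M_def[symmetric] det_mul)
    have "opt_factor K S ** transpose (opt_factor K S) = ?I ** (M ** M) ** ?I"
      by (simp add: opt_factor_def M_def[symmetric] matrix_transpose_mul M(3) I(2) matrix_mul_assoc)
    also have "\<dots> = (?I ** K) ** S ** (K ** ?I)" by (simp add: M(2) matrix_mul_assoc)
    finally show "opt_factor K S ** transpose (opt_factor K S) = S" by (simp add: matrix_inv_mult[OF dK])
  qed
qed

text \<open>Both Gaussians are driven by the same standard normal variable; the cost of this
  coupling is a second moment.\<close>

lemma W2sq_le_factor:
  fixes B K :: "real^'d^'d"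
  assumes B: "det B \<noteq> 0" "B ** transpose B = S" and K: "det K \<noteq> 0" "K ** transpose K = T"
  shows "W2sq (gauss m S) (gauss mh T) \<le> ennreal ((norm (m - mh))\<^sup>2 + (norm (B - K))\<^sup>2)"
proof -
  define f where "f z = (m + B *v z, mh + K *v z)" for z
  have [measurable]: "f \<in> std_gauss \<rightarrow>\<^sub>M borel"
    unfolding f_def by (intro borel_measurable_Pair) measurable
  have [measurable]: "fst \<in> borel_measurable (borel :: ((real^'d) \<times> (real^'d)) measure)" "snd \<in> borel_measurable (borel :: ((real^'d) \<times> (real^'d)) measure)"
    by (intro borel_measurable_continuous_onI continuous_intros)+
  define \<pi> where "\<pi> = distr std_gauss borel f"
  have "coupling (gauss m S) (gauss mh T) \<pi>"
    unfolding coupling_def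
  proof (intro conjI)
    show "prob_space \<pi>" unfolding \<pi>_def by (rule prob_space.prob_space_distr[OF prob_space_std_gauss]) measurable
    show "distr \<pi> borel fst = gauss m S"
      by (simp add: \<pi>_def distr_distr gauss_eq_distr[OF B] o_def f_def)
    show "distr \<pi> borel snd = gauss mh T"
      by (simp add: \<pi>_def distr_distr gauss_eq_distr[OF K] o_def f_def)
  qed (simp add: \<pi>_def)
  then have "W2sq (gauss m S) (gauss mh T) \<le> (\<integral>\<^sup>+ z. ennreal ((norm (fst z - snd z))\<^sup>2) \<partial>\<pi>)"
    unfolding W2sq_def by (intro INF_lower) simp
  also have "\<dots> = (\<integral>\<^sup>+ z. ennreal ((norm ((m - mh) + (B - K) *v z))\<^sup>2) \<partial>std_gauss)"
    unfolding \<pi>_def by (subst nn_integral_distr) (auto simp: f_def matvec.diff_left algebra_simps)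
  also have "\<dots> = ennreal ((norm (m - mh))\<^sup>2 + (norm (B - K))\<^sup>2)"
    using std_gauss_inner_affine[of "m - mh" "B - K" "m - mh" "B - K"]
    by (subst nn_integral_eq_integral) (simp_all add: has_bochner_integral_iff power2_norm_eq_inner)
  finally show ?thesis .
qed

text \<open>For integrands of either sign, such as the dual potentials: truncation at 0 only
  enlarges the integral.\<close>

lemma ennreal_integral_le_nn_integral:
  fixes q :: "'a \<Rightarrow> real"
  assumes "integrable M q" shows "ennreal (\<integral>x. q x \<partial>M) \<le> (\<integral>\<^sup>+x. ennreal (q x) \<partial>M)"
proof -
  have i: "integrable M (\<lambda>x. max 0 (q x))" using assms by simp
  have "ennreal (\<integral>x. q x \<partial>M) \<le> ennreal (\<integral>x. max 0 (q x) \<partial>M)"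
    using assms i by (intro ennreal_leI integral_mono) auto
  also have "\<dots> = (\<integral>\<^sup>+x. ennreal (max 0 (q x)) \<partial>M)"
    using i by (subst nn_integral_eq_integral) auto
  also have "\<dots> = (\<integral>\<^sup>+x. ennreal (q x) \<partial>M)"
    by (intro nn_integral_cong) (simp add: ennreal_max_0)
  finally show ?thesis .
qed

text \<open>Kantorovich duality with the quadratic potentials attached to the linear map \<open>L\<close>.\<close>

lemma W2sq_ge_factor:
  fixes K L :: "real^'d^'d"
  assumes L: "sym_pd L" and B: "det (L ** K) \<noteq> 0" "(L ** K) ** transpose (L ** K) = S"
    and K: "det K \<noteq> 0" "K ** transpose K = T"
  shows "ennreal ((norm (m - mh))\<^sup>2 + (norm (L ** K - K))\<^sup>2) \<le> W2sq (gauss m S) (gauss mh T)"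
  unfolding W2sq_def
proof (rule INF_greatest)
  fix \<pi> assume "\<pi> \<in> {\<pi>. coupling (gauss m S) (gauss mh T) \<pi>}"
  then have sp [measurable_cong]: "sets \<pi> = sets borel" and d1: "distr \<pi> borel fst = gauss m S" and d2: "distr \<pi> borel snd = gauss mh T"
    by (auto simp: coupling_def)
  let ?B = "L ** K" and ?N = "matrix_inv L" and ?a = "m - mh"
  have dL: "det L \<noteq> 0" by (rule sym_pd_det_nz[OF L])
  have N: "sym_pd ?N" by (rule sym_pd_inv[OF L])
  have tN: "transpose ?N = ?N" and tL: "transpose L = L" using N L by (simp_all add: sym_pd_def)
  have [measurable]: "fst \<in> borel_measurable (borel :: ((real^'d) \<times> (real^'d)) measure)" "snd \<in> borel_measurable (borel :: ((real^'d) \<times> (real^'d)) measure)"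
    by (intro borel_measurable_continuous_onI continuous_intros)+
  \<comment> \<open>With \<open>u = x - m\<close> and \<open>v = y - mh\<close>, the only term of
    \<open>(norm (x - y))\<^sup>2\<close> that couples \<open>u\<close> and \<open>v\<close> is
    \<open>- 2 * (u \<bullet> v)\<close>. The Fenchel-Young inequality for the form of
    \<open>L\<close> separates it, with equality at \<open>u = L *v v\<close>. The terms linear in
    \<open>u\<close> and \<open>v\<close> have mean zero.\<close>
  define \<Phi> where "\<Phi> x = (x - m) \<bullet> (x - m) - (x - m) \<bullet> (?N *v (x - m)) + 2 * (?a \<bullet> (x - m))" for x
  define \<Psi> where "\<Psi> y = (y - mh) \<bullet> (y - mh) - (y - mh) \<bullet> (L *v (y - mh)) - 2 * (?a \<bullet> (y - mh)) + ?a \<bullet> ?a" for y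
  have [measurable]: "\<Phi> \<in> borel_measurable borel" "\<Psi> \<in> borel_measurable borel"
    unfolding \<Phi>_def \<Psi>_def by measurable
  have le: "\<Phi> x + \<Psi> y \<le> (norm (x - y))\<^sup>2" for x y
  proof -
    define u v where "u = x - m" and "v = y - mh"
    have "0 \<le> (L *v v - u) \<bullet> (?N *v (L *v v - u))" using sym_pd_imp_psd[OF N] by (simp add: sym_psd_def)
    also have "?N *v (L *v v - u) = v - ?N *v u"
      by (simp add: matvec.diff_right matrix_vector_mul_assoc matrix_inv_mult[OF dL])
    also have "(L *v v - u) \<bullet> (v - ?N *v u) = v \<bullet> (L *v v) - (L *v v) \<bullet> (?N *v u) - u \<bullet> v + u \<bullet> (?N *v u)"
      by (simp add: inner_diff_left inner_diff_right inner_commute algebra_simps)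
    also have "(L *v v) \<bullet> (?N *v u) = v \<bullet> u"
      by (simp add: inner_matrix_vector_transpose tL matrix_vector_mul_assoc matrix_inv_mult[OF dL])
    finally have "2 * (u \<bullet> v) \<le> v \<bullet> (L *v v) + u \<bullet> (?N *v u)" by (simp add: inner_commute)
    moreover have "x - y = ?a + u - v" by (simp add: u_def v_def)
    then have "(norm (x - y))\<^sup>2 = ?a \<bullet> ?a + u \<bullet> u + v \<bullet> v + 2 * (?a \<bullet> u) - 2 * (?a \<bullet> v) - 2 * (u \<bullet> v)"
      by (simp only: power2_norm_eq_inner) (simp add: inner_add_left inner_diff_left inner_add_right inner_diff_right inner_commute algebra_simps)
    ultimately show ?thesis unfolding \<Phi>_def \<Psi>_def u_def[symmetric] v_def[symmetric] by linarith
  qed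
  have zm: "has_bochner_integral std_gauss (\<lambda>z. c \<bullet> (P *v z)) 0" for c and P :: "real^'d^'d"
    using std_gauss_mean[of "transpose P *v c"] by (simp add: inner_matrix_vector_transpose)
  have NB: "?N ** ?B = K" by (simp add: matrix_mul_assoc matrix_inv_mult[OF dL])
  have "has_bochner_integral std_gauss (\<lambda>z. (?B *v z) \<bullet> (?B *v z) - (?B *v z) \<bullet> ((?N ** ?B) *v z) + 2 * (?a \<bullet> (?B *v z))) (?B \<bullet> ?B - ?B \<bullet> (?N ** ?B) + 2 * 0)"
    by (intro has_bochner_integral_add has_bochner_integral_diff has_bochner_integral_mult_right std_gauss_inner_linear zm)
  then have I1: "has_bochner_integral std_gauss (\<lambda>z. \<Phi> (m + ?B *v z)) (?B \<bullet> ?B - ?B \<bullet> K)"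
    by (simp add: \<Phi>_def matrix_vector_mul_assoc[symmetric, of ?N] NB) (simp add: matrix_vector_mul_assoc NB)
  have c: "has_bochner_integral std_gauss (\<lambda>z :: real^'d. ?a \<bullet> ?a) (?a \<bullet> ?a)" by (simp add: has_bochner_integral_iff)
  have "has_bochner_integral std_gauss (\<lambda>z. (K *v z) \<bullet> (K *v z) - (K *v z) \<bullet> ((L ** K) *v z) - 2 * (?a \<bullet> (K *v z)) + ?a \<bullet> ?a) (K \<bullet> K - K \<bullet> (L ** K) - 2 * 0 + ?a \<bullet> ?a)"
    by (intro has_bochner_integral_add has_bochner_integral_diff has_bochner_integral_mult_right std_gauss_inner_linear zm c)
  then have I2: "has_bochner_integral std_gauss (\<lambda>z. \<Psi> (mh + K *v z)) (K \<bullet> K - K \<bullet> ?B + ?a \<bullet> ?a)"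
    by (simp add: \<Psi>_def matrix_vector_mul_assoc)
  have P1: "integrable \<pi> (\<lambda>w. \<Phi> (fst w))" "(\<integral>w. \<Phi> (fst w) \<partial>\<pi>) = ?B \<bullet> ?B - ?B \<bullet> K"
  proof -
    have "integrable (gauss m S) \<Phi>" "(\<integral>x. \<Phi> x \<partial>gauss m S) = ?B \<bullet> ?B - ?B \<bullet> K"
      using I1 by (simp_all add: gauss_integral[OF B] has_bochner_integral_iff)
    then show "integrable \<pi> (\<lambda>w. \<Phi> (fst w))" "(\<integral>w. \<Phi> (fst w) \<partial>\<pi>) = ?B \<bullet> ?B - ?B \<bullet> K"
      unfolding d1[symmetric] by (simp_all add: integrable_distr_eq integral_distr)
  qed
  have P2: "integrable \<pi> (\<lambda>w. \<Psi> (snd w))" "(\<integral>w. \<Psi> (snd w) \<partial>\<pi>) = K \<bullet> K - K \<bullet> ?B + ?a \<bullet> ?a"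
  proof -
    have "integrable (gauss mh T) \<Psi>" "(\<integral>x. \<Psi> x \<partial>gauss mh T) = K \<bullet> K - K \<bullet> ?B + ?a \<bullet> ?a"
      using I2 by (simp_all add: gauss_integral[OF K] has_bochner_integral_iff)
    then show "integrable \<pi> (\<lambda>w. \<Psi> (snd w))" "(\<integral>w. \<Psi> (snd w) \<partial>\<pi>) = K \<bullet> K - K \<bullet> ?B + ?a \<bullet> ?a"
      unfolding d2[symmetric] by (simp_all add: integrable_distr_eq integral_distr)
  qed
  have "(norm ?a)\<^sup>2 + (norm (?B - K))\<^sup>2 = (\<integral>w. \<Phi> (fst w) + \<Psi> (snd w) \<partial>\<pi>)"
    using P1 P2 by (simp add: power2_norm_eq_inner inner_diff_left inner_diff_right inner_commute)
  also have "ennreal (\<integral>w. \<Phi> (fst w) + \<Psi> (snd w) \<partial>\<pi>) \<le> (\<integral>\<^sup>+w. ennreal (\<Phi> (fst w) + \<Psi> (snd w)) \<partial>\<pi>)"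
    using P1 P2 by (intro ennreal_integral_le_nn_integral) simp
  also have "\<dots> \<le> (\<integral>\<^sup>+w. ennreal ((norm (fst w - snd w))\<^sup>2) \<partial>\<pi>)"
    by (intro nn_integral_mono ennreal_leI le)
  finally show "ennreal ((norm ?a)\<^sup>2 + (norm (?B - K))\<^sup>2) \<le> (\<integral>\<^sup>+w. ennreal ((norm (fst w - snd w))\<^sup>2) \<partial>\<pi>)" .
qed

text \<open>The coupling bound and the dual bound meet at the factor \<open>L ** K\<close>: as
  \<open>L\<close> is positive definite, it is the gradient of a convex function and hence an
  optimal map.\<close>

lemma W2sq_gauss:
  assumes K: "sym_pd K" and S: "sym_pd (S :: real^'d^'d)"
  shows "W2sq (gauss m S) (gauss mh (K ** K)) = ennreal (bw_sq mh K m S)"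
proof -
  obtain L where L: "sym_pd L" "opt_factor K S = L ** K"
    and B: "det (opt_factor K S) \<noteq> 0" "opt_factor K S ** transpose (opt_factor K S) = S"
    using opt_factor[OF K S] by metis
  have tK: "det K \<noteq> 0" "K ** transpose K = K ** K" using K sym_pd_det_nz by (auto simp: sym_pd_def)
  have "ennreal (bw_sq mh K m S) \<le> W2sq (gauss m S) (gauss mh (K ** K))"
    unfolding bw_sq_def L(2) by (rule W2sq_ge_factor[OF L(1) _ _ tK]) (use B L(2) in simp_all)
  moreover have "W2sq (gauss m S) (gauss mh (K ** K)) \<le> ennreal (bw_sq mh K m S)"
    unfolding bw_sq_def by (rule W2sq_le_factor[OF B tK])
  ultimately show ?thesis by (rule antisym[rotated])
qed

text \<open>Minimality of the optimal factor among all factors, obtained without matrix analysis: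
  every factor gives a coupling.\<close>

lemma bw_sq_le_factor:
  fixes B K :: "real^'d^'d"
  assumes K: "sym_pd K" and B: "det B \<noteq> 0" "B ** transpose B = S"
  shows "bw_sq mh K m S \<le> (norm (m - mh))\<^sup>2 + (norm (B - K))\<^sup>2"
proof -
  have S: "sym_pd S" using sym_pd_factor[OF B(1)] B(2) by simp
  have tK: "det K \<noteq> 0" "K ** transpose K = K ** K" using K sym_pd_det_nz by (auto simp: sym_pd_def)
  have "ennreal (bw_sq mh K m S) \<le> ennreal ((norm (m - mh))\<^sup>2 + (norm (B - K))\<^sup>2)"
    unfolding W2sq_gauss[OF K S, symmetric] by (rule W2sq_le_factor[OF B tK])
  then show ?thesis by (subst (asm) ennreal_le_iff) simp_all
qed

subsection \<open>Measurability\<close>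

text \<open>For functions defined by a description operator, which are constant off their natural
  domain. A closed graph is a countable union of compact sets, so its projections are Borel.\<close>

lemma borel_measurable_closed_graph:
  fixes f :: "'a::euclidean_space \<Rightarrow> 'b::euclidean_space"
  assumes cl: "closed \<Gamma>" and on: "\<And>x y. (x, y) \<in> \<Gamma> \<Longrightarrow> f x = y" and off: "\<And>x. x \<notin> fst ` \<Gamma> \<Longrightarrow> f x = c"
  shows "f \<in> borel_measurable borel"
proof (rule borel_measurableI)
  have proj: "fst ` (\<Gamma> \<inter> UNIV \<times> C) \<in> sets borel" if "closed C" for C
  proof -
    have eq: "fst ` (\<Gamma> \<inter> UNIV \<times> C) = (\<Union>n. fst ` (\<Gamma> \<inter> UNIV \<times> C \<inter> cball 0 (real n)))"
    proof -
      have "(\<Union>n. cball (0 :: 'a \<times> 'b) (real n)) = UNIV"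
        by (auto simp: real_arch_simple)
      then show ?thesis by (simp only: image_UN[symmetric] Int_UN_distrib[symmetric] Int_UNIV_right)
    qed
    have cpt: "compact (fst ` (\<Gamma> \<inter> UNIV \<times> C \<inter> cball 0 (real n)))" for n
      using cl that
      by (intro compact_continuous_image continuous_intros closed_Int_compact closed_Int closed_Times) auto
    show ?thesis unfolding eq by (intro sets.countable_UN image_subsetI borel_compact cpt)
  qed
  fix U :: "'b set" assume U: "open U"
  have "f -` (- U) = fst ` (\<Gamma> \<inter> UNIV \<times> (- U)) \<union> (if c \<in> - U then - fst ` (\<Gamma> \<inter> UNIV \<times> UNIV) else {})"
    (is "_ = ?R")
  proof (intro set_eqI iffI)
    fix x assume x: "x \<in> f -` (- U)"
    show "x \<in> ?R"
    proof (cases "x \<in> fst ` \<Gamma>")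
      case True
      then obtain y where y: "(x, y) \<in> \<Gamma>" by force
      then have "(x, y) \<in> \<Gamma> \<inter> UNIV \<times> (- U)" using x on[OF y] by simp
      from imageI[OF this, of fst] show ?thesis by simp
    next
      case False
      then show ?thesis using x off[OF False] by simp
    qed
  next
    fix x assume "x \<in> ?R"
    then show "x \<in> f -` (- U)"
    proof
      assume "x \<in> fst ` (\<Gamma> \<inter> UNIV \<times> (- U))"
      then show ?thesis using on by auto
    next
      assume "x \<in> (if c \<in> - U then - fst ` (\<Gamma> \<inter> UNIV \<times> UNIV) else {})"
      then have "c \<in> - U" "x \<notin> fst ` \<Gamma>" by (simp_all split: if_splits)
      then show ?thesis using off by simp
    qed
  qed
  also have "\<dots> \<in> sets borel" 
    using proj[of "- U"] borel_comp[OF proj[of UNIV]] U by (auto simp: closed_def intro!: sets.Un)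
  finally have "- (f -` (- U)) \<in> sets borel" by (rule borel_comp)
  moreover have "- (f -` (- U)) = f -` U" by auto
  ultimately show "f -` U \<inter> space borel \<in> sets borel" by simp
qed

lemma closed_sym_psd: "closed {B :: real^'d^'d. sym_psd B}"
proof -
  have eq: "{B :: real^'d^'d. sym_psd B} = {B. transpose B = B} \<inter> (\<Inter>x. {B. 0 \<le> x \<bullet> (B *v x)})"
    by (auto simp: sym_psd_def)
  have c1: "closed {B :: real^'d^'d. transpose B = B}"
    unfolding transpose_def by (intro closed_Collect_eq continuous_intros)
  have c2: "closed {B :: real^'d^'d. 0 \<le> x \<bullet> (B *v x)}" for x
    by (intro closed_Collect_le continuous_intros matvec.continuous_on)
  show ?thesis unfolding eq by (intro closed_Int closed_INT ballI c1 c2)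
qed

lemma psd_sqrt_measurable [measurable]: "(psd_sqrt :: real^'d^'d \<Rightarrow> _) \<in> borel_measurable borel"
proof (rule borel_measurable_closed_graph)
  let ?\<Gamma> = "{p :: (real^'d^'d) \<times> (real^'d^'d). sym_psd (snd p) \<and> snd p ** snd p = fst p}"
  have "?\<Gamma> = (UNIV \<times> {B. sym_psd B}) \<inter> {p. snd p ** snd p = fst p}" by auto
  moreover have "closed {p :: (real^'d^'d) \<times> (real^'d^'d). snd p ** snd p = fst p}"
    by (intro closed_Collect_eq matmul.continuous_on continuous_intros)
  ultimately show "closed ?\<Gamma>" by (simp add: closed_Int closed_Times closed_sym_psd)
  show "psd_sqrt x = y" if "(x, y) \<in> ?\<Gamma>" for x y using that by (auto intro: psd_sqrt_eqI)
  \<comment> \<open>Where no root exists the describing predicate is identically false, so all such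
    \<open>x\<close> share one unspecified value.\<close>
  show "psd_sqrt x = (THE B. False)" if "x \<notin> fst ` ?\<Gamma>" for x
  proof -
    have "\<not> (sym_psd B \<and> B ** B = x)" for B
    proof
      assume "sym_psd B \<and> B ** B = x"
      then have "(x, B) \<in> ?\<Gamma>" by simp
      from imageI[OF this, of fst] that show False by simp
    qed
    then show ?thesis by (simp only: psd_sqrt_def)
  qed
qed

lemma matrix_inv_measurable [measurable]: "(matrix_inv :: real^'d^'d \<Rightarrow> _) \<in> borel_measurable borel"
proof (rule borel_measurable_closed_graph)
  let ?\<Gamma> = "{p :: (real^'d^'d) \<times> (real^'d^'d). fst p ** snd p = mat 1}"
  show "closed ?\<Gamma>" by (intro closed_Collect_eq matmul.continuous_on continuous_intros)
  show "matrix_inv x = y" if "(x, y) \<in> ?\<Gamma>" for x y using that by (auto intro: matrix_inv_unique)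
  show "matrix_inv x = (SOME B. False)" if "x \<notin> fst ` ?\<Gamma>" for x
  proof -
    have "\<not> (x ** B = mat 1 \<and> B ** x = mat 1)" for B
    proof
      assume "x ** B = mat 1 \<and> B ** x = mat 1"
      then have "(x, B) \<in> ?\<Gamma>" by simp
      from imageI[OF this, of fst] that show False by simp
    qed
    then show ?thesis by (simp only: matrix_inv_def)
  qed
qed

lemma det_measurable [measurable]: "(det :: real^'d^'d \<Rightarrow> real) \<in> borel_measurable borel"
  unfolding det_def by (intro borel_measurable_continuous_onI continuous_intros)

lemma matmul_measurable [measurable]:
  "f \<in> borel_measurable M \<Longrightarrow> g \<in> borel_measurable M \<Longrightarrow> (\<lambda>x. (f x :: real^'n^'m) ** (g x :: real^'p^'n)) \<in> borel_measurable M"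
  by (rule borel_measurable_continuous_Pair) (auto intro!: matmul.continuous_on continuous_intros)

lemma matvec_fun_measurable [measurable]:
  "f \<in> borel_measurable M \<Longrightarrow> g \<in> borel_measurable M \<Longrightarrow> (\<lambda>x. (f x :: real^'n^'m) *v g x) \<in> borel_measurable M"
  by (rule borel_measurable_continuous_Pair) (auto intro!: matvec.continuous_on continuous_intros)

lemma sym_pd_measurable: "{s :: (real^'d) \<times> (real^'d^'d). sym_pd (snd s)} \<in> sets borel"
proof -
  have "{S :: real^'d^'d. sym_pd S} = {S. sym_psd S} \<inter> det -` (- {0}) \<inter> space borel"
    by (auto simp: sym_pd_iff_psd_det)
  also have "\<dots> \<in> sets borel"
    using borel_closed[OF closed_sym_psd] measurable_sets[OF det_measurable, of "- {0}"]
    by (subst Int_assoc) (intro sets.Int, auto)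
  finally have "snd -` {S :: real^'d^'d. sym_pd S} \<inter> space borel \<in> sets (borel :: ((real^'d) \<times> (real^'d^'d)) measure)"
    by (intro measurable_sets[of snd borel borel] borel_measurable_continuous_onI continuous_intros)
  then show ?thesis by (simp add: vimage_def)
qed

subsection \<open>The proximal step of the entropy\<close>

text \<open>The larger root \<open>S\<close>, commuting with \<open>P\<close>, of the quadratic
  equation \<open>S\<^sup>2 - (P + 2 \<eta> I) S + \<eta>\<^sup>2 I = 0\<close>.\<close>

definition entropy_prox :: "real \<Rightarrow> real^'d^'d \<Rightarrow> real^'d^'d" where
  "entropy_prox \<eta> P = (1/2) *\<^sub>R (P + (2 * \<eta>) *\<^sub>R mat 1 + psd_sqrt (P ** (P + (4 * \<eta>) *\<^sub>R mat 1)))"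

text \<open>The identity for \<open>P\<close> says that the step is implicit in \<open>S\<close>:
  \<open>J S J\<close> equals \<open>(S - \<eta> I)\<^sup>2 S\<^sup>-\<^sup>1\<close>, which the
  quadratic equation for \<open>S\<close> turns into \<open>P\<close>.\<close>

lemma entropy_prox:
  fixes P :: "real^'d^'d"
  assumes P: "sym_pd P" and \<eta>: "\<eta> > 0"
  defines "S \<equiv> entropy_prox \<eta> P"
  defines "J \<equiv> mat 1 - \<eta> *\<^sub>R matrix_inv S"
  shows "sym_pd S" "sym_pd J" "J ** S ** J = P"
proof -
  note ms = matmul.add_left matmul.add_right matmul.diff_left matmul.diff_right
    matmul.scaleR_left matmul.scaleR_right
  define Q where "Q = psd_sqrt (P ** (P + (4 * \<eta>) *\<^sub>R mat 1))"
  have tP: "transpose P = P" using P by (simp add: sym_pd_def)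
  have sq: "sym_pd (W ** W)" if "sym_pd W" for W :: "real^'d^'d"
    using sym_pd_factor[OF sym_pd_det_nz[OF that]] that by (simp add: sym_pd_def)
  have "sym_pd (P ** P + (4 * \<eta>) *\<^sub>R P)"
    using P \<eta> by (intro sym_pd_add_psd sq sym_psd_scaleR sym_pd_imp_psd) auto
  then have "sym_pd (P ** (P + (4 * \<eta>) *\<^sub>R mat 1))" by (simp add: ms)
  note Q = psd_sqrt_pd[OF this, folded Q_def]
  have QP: "Q ** P = P ** Q"
    by (rule sym_pd_commute_of_square[OF Q(1)]) (simp add: Q(2) ms matrix_mul_assoc)
  have S2: "2 *\<^sub>R S = P + (2 * \<eta>) *\<^sub>R mat 1 + Q" by (simp add: S_def entropy_prox_def Q_def)
  define W where "W = (1/2) *\<^sub>R (P + Q)"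
  have W: "sym_pd W" unfolding W_def using P Q(1) by (intro sym_pd_scaleR sym_pd_add_psd sym_pd_imp_psd) auto
  have SW: "S = W + \<eta> *\<^sub>R mat 1"
    by (simp add: S_def entropy_prox_def W_def Q_def[symmetric] scaleR_add_right)
  show S: "sym_pd S"
    unfolding SW using W \<eta> by (intro sym_pd_add_psd sym_psd_scaleR sym_pd_imp_psd sym_pd_mat_1) auto
  let ?I = "matrix_inv S"
  have dS: "det S \<noteq> 0" by (rule sym_pd_det_nz[OF S])
  have I: "sym_pd ?I" by (rule sym_pd_inv[OF S])
  have tI: "transpose ?I = ?I" "det ?I \<noteq> 0" using I sym_pd_det_nz by (auto simp: sym_pd_def)
  \<comment> \<open>Writes \<open>J\<close> as a congruence of a positive definite matrix; this
    rests on \<open>S = W + \<eta> I\<close>, which gives \<open>W\<^sup>2 + \<eta> W = S W\<close>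
    and \<open>J = W S\<^sup>-\<^sup>1\<close>.\<close>
  have JW: "J = ?I ** (W ** W + \<eta> *\<^sub>R W) ** ?I"
  proof -
    have "W ** W + \<eta> *\<^sub>R W = S ** W" by (simp add: SW ms)
    then have "?I ** (W ** W + \<eta> *\<^sub>R W) ** ?I = W ** ?I" by (simp add: matrix_mul_assoc matrix_inv_mult[OF dS])
    also have "\<dots> = (S - \<eta> *\<^sub>R mat 1) ** ?I" by (simp add: SW)
    finally show ?thesis by (simp add: ms matrix_inv_mult[OF dS] J_def)
  qed
  have "sym_pd (W ** W + \<eta> *\<^sub>R W)"
    using W \<eta> by (intro sym_pd_add_psd sq sym_psd_scaleR sym_pd_imp_psd) auto
  from sym_pd_congruence[OF this tI(2)] show "sym_pd J" by (simp add: JW tI)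
  have quad: "S ** S - (2 * \<eta>) *\<^sub>R S + \<eta>\<^sup>2 *\<^sub>R mat 1 = P ** S"
  proof -
    \<comment> \<open>With this \<open>A\<close> the discriminant is
      \<open>A\<^sup>2 - 4 \<eta>\<^sup>2 I = P (P + 4 \<eta> I)\<close>, and
      \<open>2 S = A + Q\<close> is the usual root formula.\<close>
    define A where "A = P + (2 * \<eta>) *\<^sub>R mat 1"
    have AQ: "Q ** A = A ** Q" by (simp add: A_def ms QP)
    have QQ: "Q ** Q = A ** A - (4 * \<eta>\<^sup>2) *\<^sub>R mat 1"
    proof -
      define X where "X = (2 * \<eta>) *\<^sub>R P"
      have dbl: "X + X = (4 * \<eta>) *\<^sub>R P" unfolding X_def by (simp flip: scaleR_add_left)
      have "A ** A = P ** P + X + (X + (4 * \<eta>\<^sup>2) *\<^sub>R mat 1)"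
        by (simp add: A_def ms scaleR_add_right power2_eq_square X_def[symmetric])
      then have "A ** A = P ** P + (X + X) + (4 * \<eta>\<^sup>2) *\<^sub>R mat 1" by (simp only: add.assoc)
      then show ?thesis unfolding dbl by (simp add: Q(2) ms)
    qed
    have "4 *\<^sub>R (S ** S) = (2 *\<^sub>R S) ** (2 *\<^sub>R S)" by (simp add: ms)
    also have "\<dots> = A ** A + 2 *\<^sub>R (A ** Q) + Q ** Q"
      unfolding S2 A_def[symmetric] by (simp add: ms AQ scaleR_2)
    also have "\<dots> = 2 *\<^sub>R (A ** (A + Q)) - (4 * \<eta>\<^sup>2) *\<^sub>R mat 1"
      by (simp add: QQ ms scaleR_2 algebra_simps)
    also have "A + Q = 2 *\<^sub>R S" by (simp add: S2 A_def)
    finally have "4 *\<^sub>R (S ** S) = 4 *\<^sub>R (A ** S - \<eta>\<^sup>2 *\<^sub>R mat 1)" by (simp add: ms algebra_simps)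
    then have "S ** S = A ** S - \<eta>\<^sup>2 *\<^sub>R mat 1" by simp
    then show ?thesis by (simp add: A_def ms)
  qed
  have "J ** S ** J = (S - \<eta> *\<^sub>R mat 1) ** J"
    by (simp add: J_def ms matrix_inv_mult[OF dS])
  also have "\<dots> = S - (2 * \<eta>) *\<^sub>R mat 1 + \<eta>\<^sup>2 *\<^sub>R ?I"
  proof -
    define X where "X = \<eta> *\<^sub>R (mat 1 :: real^'d^'d)"
    have dbl: "(2 * \<eta>) *\<^sub>R mat 1 = X + X" unfolding X_def by (simp flip: scaleR_add_left)
    have "(S - X) ** J = S - X - (X - \<eta>\<^sup>2 *\<^sub>R ?I)"
      by (simp add: J_def X_def ms matrix_inv_mult[OF dS] power2_eq_square scaleR_diff_right)
    then show ?thesis unfolding dbl X_def[symmetric] by (simp only: diff_diff_eq diff_diff_eq2 add_diff_eq diff_add_eq)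
  qed
  also have "\<dots> = (S ** S - (2 * \<eta>) *\<^sub>R S + \<eta>\<^sup>2 *\<^sub>R mat 1) ** ?I"
    by (simp add: ms matrix_mul_assoc[symmetric] matrix_inv_mult[OF dS])
  also have "\<dots> = P" unfolding quad by (simp add: matrix_mul_assoc[symmetric] matrix_inv_mult[OF dS])
  finally show "J ** S ** J = P" .
qed

lemma norm_sq_mult_factor:
  fixes B C N :: "real^'d^'d"
  assumes "B ** transpose B = C ** transpose C"
  shows "(norm (N ** B))\<^sup>2 = (norm (N ** C))\<^sup>2"
proof -
  have "(norm (N ** B))\<^sup>2 = trace (N ** (B ** transpose B) ** transpose N)" for B :: "real^'d^'d"
    by (simp add: power2_norm_eq_inner matrix_inner_eq_trace matrix_transpose_mul matrix_mul_assoc)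
  then show ?thesis using assms by metis
qed

text \<open>Evolution variational inequality for the proximal step. With the optimal factor \<open>B = L K\<close> of
  \<open>P\<close> and \<open>J = I - \<eta> S\<^sup>-\<^sup>1\<close>, the first order term of \<open>\<parallel>J\<^sup>-\<^sup>1 B - K\<parallel>\<^sup>2\<close> is the trace of \<open>J L\<^sup>-\<^sup>1\<close>, a product
  of two positive definite matrices.\<close>

lemma entropy_prox_evi:
  fixes P K C :: "real^'d^'d"
  assumes K: "sym_pd K" and \<eta>: "\<eta> > 0" and C: "det C \<noteq> 0" "C ** transpose C = P"
  obtains R where "det (R ** C) \<noteq> 0" "(R ** C) ** transpose (R ** C) = entropy_prox \<eta> P"
    "bw_sq mh K m (entropy_prox \<eta> P) \<le> (norm (m - mh))\<^sup>2 + (norm (C - K))\<^sup>2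
      + \<eta> * (ln (det (entropy_prox \<eta> P)) - ln (det (K ** K))) - (norm (R ** C - C))\<^sup>2"
proof -
  define S where "S = entropy_prox \<eta> P"
  define J where "J = mat 1 - \<eta> *\<^sub>R matrix_inv S"
  have P: "sym_pd P" using sym_pd_factor[OF C(1)] C(2) by simp
  note SJ = entropy_prox[OF P \<eta>, folded S_def, folded J_def]
  have dJ: "det J \<noteq> 0" and dS: "det S \<noteq> 0" using SJ sym_pd_det_nz by blast+
  define R where "R = matrix_inv J"
  have R: "sym_pd R" "R ** J = mat 1" "J ** R = mat 1"
    by (simp_all add: R_def sym_pd_inv[OF SJ(2)] matrix_inv_mult[OF dJ])
  have tR: "transpose R = R" using R(1) by (simp add: sym_pd_def)
  have dR: "det R \<noteq> 0" by (rule sym_pd_det_nz[OF R(1)])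
  have RPR: "R ** P ** R = S"
  proof -
    have "R ** P ** R = (R ** J) ** S ** (J ** R)" by (simp add: SJ(3)[symmetric] matrix_mul_assoc)
    then show ?thesis by (simp add: R)
  qed
  have fac: "det (R ** F) \<noteq> 0" "(R ** F) ** transpose (R ** F) = S"
    if "det F \<noteq> 0" "F ** transpose F = P" for F
  proof -
    show "det (R ** F) \<noteq> 0" using dR that by (simp add: det_mul)
    have "(R ** F) ** transpose (R ** F) = R ** (F ** transpose F) ** R"
      by (simp add: matrix_transpose_mul tR matrix_mul_assoc)
    then show "(R ** F) ** transpose (R ** F) = S" by (simp add: that RPR)
  qed
  \<comment> \<open>The trace inequality requires the form \<open>L K\<close> with \<open>L\<close>
    positive definite, so the optimal factor of \<open>P\<close> is moved by \<open>R\<close> first;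
    the given factor \<open>C\<close> returns at the end.\<close>
  define B where "B = opt_factor K P"
  obtain L where L: "sym_pd L" "B = L ** K" and B: "det B \<noteq> 0" "B ** transpose B = P"
    using opt_factor[OF K P] unfolding B_def by metis
  define U where "U = R ** B"
  have U: "det U \<noteq> 0" "U ** transpose U = S" unfolding U_def using fac[OF B] by auto
  have JU: "B = J ** U" by (simp add: U_def matrix_mul_assoc R)
  have dU: "U - B = \<eta> *\<^sub>R (matrix_inv S ** U)"
    unfolding JU J_def by (simp add: matmul.diff_left matmul.scaleR_left)
  have tK: "transpose K = K" and dK: "det K \<noteq> 0" using K sym_pd_det_nz by (auto simp: sym_pd_def)
  have tL: "transpose L = L" and dL: "det L \<noteq> 0" using L sym_pd_det_nz by (auto simp: sym_pd_def)
  let ?N = "matrix_inv L"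
  have N: "sym_pd ?N" by (rule sym_pd_inv[OF L(1)])
  have LKL: "L ** (K ** K) ** L = P"
    using B(2) by (simp add: L(2) matrix_transpose_mul tK tL matrix_mul_assoc)
  have UU: "(U - B) \<bullet> U = \<eta> * real CARD('d)"
  proof -
    have "(matrix_inv S ** U) \<bullet> U = trace (matrix_inv S ** (U ** transpose U))"
      by (simp add: matrix_inner_eq_trace matrix_mul_assoc)
    also have "\<dots> = real CARD('d)" by (simp add: U(2) matrix_inv_mult[OF dS] trace_I)
    finally show ?thesis by (simp add: dU)
  qed
  \<comment> \<open>\<open>U K = R L K\<^sup>2 = R P L\<^sup>-\<^sup>1 = S J
    L\<^sup>-\<^sup>1\<close>, since \<open>P = L K\<^sup>2 L\<close> and
    \<open>R P = S J\<close>.\<close>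
  have UK: "(U - B) \<bullet> K = \<eta> * trace (J ** ?N)"
  proof -
    have LKK: "L ** (K ** K) = P ** ?N"
      by (simp add: LKL[symmetric] matrix_mul_assoc[symmetric] matrix_inv_mult[OF dL])
    have "U ** K = R ** (L ** (K ** K))" by (simp add: U_def L(2) matrix_mul_assoc)
    also have "\<dots> = (R ** J) ** S ** J ** ?N" 
      unfolding LKK SJ(3)[symmetric] by (simp only: matrix_mul_assoc)
    finally have "U ** K = S ** J ** ?N" by (simp add: R)
    then have "matrix_inv S ** (U ** K) = J ** ?N" by (simp add: matrix_mul_assoc matrix_inv_mult[OF dS])
    then have "(matrix_inv S ** U) \<bullet> K = trace (J ** ?N)"
      by (simp add: matrix_inner_eq_trace tK matrix_mul_assoc)
    then show ?thesis by (simp add: dU)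
  qed
  have tr: "real CARD('d) + ln (det J) + ln (det ?N) \<le> trace (J ** ?N)"
    by (rule trace_mult_ge_ln_det[OF SJ(2) N])
  \<comment> \<open>The two factorisations \<open>J S J\<close> and \<open>L K\<^sup>2 L\<close> of
    \<open>P\<close> link the determinants.\<close>
  have ld: "ln (det J) + ln (det ?N) = (ln (det (K ** K)) - ln (det S)) / 2"
  proof -
    have pos: "det J > 0" "det S > 0" "det L > 0" "det K > 0" "det ?N > 0"
      using SJ(1,2) L(1) K N sym_pd_det_pos by blast+
    have "det ?N * det L = 1" using matrix_inv_mult(2)[OF dL] by (metis det_I det_mul)
    then have "ln (det ?N) + ln (det L) = 0" using pos by (metis ln_mult_pos ln_one)
    moreover have "ln (det P) = 2 * ln (det J) + ln (det S)"
      unfolding SJ(3)[symmetric] using pos by (simp add: det_mul ln_mult_pos)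
    moreover have "ln (det P) = 2 * ln (det L) + ln (det (K ** K))"
      unfolding LKL[symmetric] using pos by (simp add: det_mul ln_mult_pos)
    ultimately show ?thesis by (simp add: field_simps)
  qed
  have exp: "(norm (U - K))\<^sup>2 = (norm (B - K))\<^sup>2 + 2 * ((U - B) \<bullet> U - (U - B) \<bullet> K) - (norm (U - B))\<^sup>2"
    by (simp add: power2_norm_eq_inner inner_diff_left inner_diff_right inner_commute algebra_simps)
  have "(norm (B - K))\<^sup>2 \<le> (norm (C - K))\<^sup>2"
    using bw_sq_le_factor[OF K C, of 0 0] by (simp add: bw_sq_def B_def)
  moreover have "2 * ((U - B) \<bullet> U - (U - B) \<bullet> K) \<le> \<eta> * (ln (det S) - ln (det (K ** K)))"
  proof -
    have "2 * ((U - B) \<bullet> U - (U - B) \<bullet> K) = 2 * \<eta> * (real CARD('d) - trace (J ** ?N))"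
      unfolding UU UK by (simp add: algebra_simps)
    also have "\<dots> \<le> 2 * \<eta> * ((ln (det S) - ln (det (K ** K))) / 2)"
      using tr ld \<eta> by (intro mult_left_mono) (auto simp: field_simps)
    finally show ?thesis by simp
  qed
  \<comment> \<open>Passing from \<open>B\<close> to \<open>C\<close> costs nothing here: the norm
    of \<open>(R - I) F\<close> depends on the factor \<open>F\<close> only through its covariance
    \<open>P\<close>.\<close>
  moreover have "(norm (U - B))\<^sup>2 = (norm (R ** C - C))\<^sup>2"
  proof -
    have "U - B = (R - mat 1) ** B" "R ** C - C = (R - mat 1) ** C" by (simp_all add: U_def matmul.diff_left)
    then show ?thesis using norm_sq_mult_factor[of B C "R - mat 1"] B(2) C(2) by simp
  qed
  moreover have "bw_sq mh K m S \<le> (norm (m - mh))\<^sup>2 + (norm (U - K))\<^sup>2" by (rule bw_sq_le_factor[OF K U])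
  ultimately have "bw_sq mh K m S \<le> (norm (m - mh))\<^sup>2 + (norm (C - K))\<^sup>2
      + \<eta> * (ln (det S) - ln (det (K ** K))) - (norm (R ** C - C))\<^sup>2" using exp by linarith
  with fac[OF C] show ?thesis using that unfolding S_def by blast
qed

subsection \<open>One step of the algorithm\<close>

lemma det_scaleR_matrix: "det (c *\<^sub>R A) = c ^ CARD('d) * det (A :: real^'d^'d)"
proof -
  have "c *\<^sub>R A = mat c ** A"
    by (simp add: vec_eq_iff matrix_matrix_mult_def mat_def if_distrib if_distribR cong: if_cong)
  moreover have "det (mat c :: real^'d^'d) = c ^ CARD('d)"
    using det_matrix_scaleR[of c, where 'n='d] by (simp add: matrix_scaleR)
  ultimately show ?thesis by (simp add: det_mul)
qed

lemma has_bochner_integral_le: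
  fixes f g :: "'x \<Rightarrow> real"
  assumes "has_bochner_integral M f a" "has_bochner_integral M g b" "\<And>x. f x \<le> g x"
  shows "a \<le> b"
  using assms by (metis has_bochner_integral_iff integral_mono)

lemma std_gauss_norm_sq_affine:
  "has_bochner_integral std_gauss (\<lambda>z. (norm (c + P *v z))\<^sup>2) ((norm c)\<^sup>2 + (norm (P :: real^'d^'d))\<^sup>2)"
  using std_gauss_inner_affine[of c P c P] by (simp add: power2_norm_eq_inner)

lemma std_gauss_norm_sq_linear:
  "has_bochner_integral std_gauss (\<lambda>z. (norm (P *v z))\<^sup>2) ((norm (P :: real^'d^'d))\<^sup>2)"
  using std_gauss_norm_sq_affine[of 0 P] by simp

lemma std_gauss_inner_linear_mean_zero:
  "has_bochner_integral std_gauss (\<lambda>z. c \<bullet> ((P :: real^'d^'d) *v z)) 0"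
  using std_gauss_mean[of "transpose P *v c"] by (simp add: inner_matrix_vector_transpose)

locale gauss_vi = smooth_potential V gradV hessV \<alpha> \<beta>
  for V :: "real^'d \<Rightarrow> real" and gradV hessV \<alpha> \<beta> +
  fixes mh :: "real^'d" and Sh :: "real^'d^'d" and \<eta> :: real
  assumes min_pd: "sym_pd Sh"
    and minimizer: "\<And>m S. sym_pd S \<Longrightarrow> free_energy V mh Sh \<le> free_energy V m S"
    and eta_pos: "0 < \<eta>" and eta_le: "\<eta> \<le> \<alpha>\<^sup>2 / (48 * \<beta> ^ 3)"
begin

section \<open>Consequences of minimality\<close>

definition K :: "real^'d^'d" where "K = psd_sqrt Sh"

lemma K: "sym_pd K" "K ** K = Sh" "transpose K = K" "det K \<noteq> 0" "K ** transpose K = Sh"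
  using psd_sqrt_pd[OF min_pd] sym_pd_det_nz unfolding K_def by auto

definition EV :: "real^'d \<Rightarrow> real^'d^'d \<Rightarrow> real" where
  "EV m B = (\<integral>z. V (m + B *v z) \<partial>std_gauss)"

lemma EV_integral: "has_bochner_integral std_gauss (\<lambda>z. V (m + B *v z)) (EV m B)"
  using V_integrable[of m B] by (simp add: has_bochner_integral_iff EV_def)

text \<open>Applied at the new iterate, this exchanges the log determinants of the evolution
  variational inequality for a difference of mean potentials.\<close>

lemma minimizer_factor:
  assumes B: "det B \<noteq> 0" "B ** transpose B = S"
  shows "ln (det S) - ln (det (K ** K)) \<le> 2 * (EV m B - EV mh K)"
proof -
  have "sym_pd S" using sym_pd_factor[OF B(1)] B(2) by simp
  from minimizer[OF this, of m] show ?thesis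
    unfolding free_energy_factor[OF B] free_energy_factor[OF K(4,5)] EV_def K(2) by simp
qed

lemma EV_le:
  "EV (m + c) (B + C) \<le> EV m B + (mean_grad m B \<bullet> c + (mean_hess m B ** B) \<bullet> C)
    + \<beta> / 2 * ((norm c)\<^sup>2 + (norm C)\<^sup>2)"
proof (rule has_bochner_integral_le[OF EV_integral])
  show "has_bochner_integral std_gauss (\<lambda>z. V (m + B *v z) + gradV (m + B *v z) \<bullet> (c + C *v z) + \<beta> / 2 * (norm (c + C *v z))\<^sup>2)
    (EV m B + (mean_grad m B \<bullet> c + (mean_hess m B ** B) \<bullet> C) + \<beta> / 2 * ((norm c)\<^sup>2 + (norm C)\<^sup>2))"
    by (intro has_bochner_integral_add has_bochner_integral_mult_right EV_integral grad_stein std_gauss_norm_sq_affine)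
  fix z
  show "V (m + c + (B + C) *v z) \<le> V (m + B *v z) + gradV (m + B *v z) \<bullet> (c + C *v z) + \<beta> / 2 * (norm (c + C *v z))\<^sup>2"
    using V_upper[of "m + c + (B + C) *v z" "m + B *v z"] by (simp add: matvec.add_left algebra_simps)
qed

text \<open>Only the derivative of the free energy along the dilations \<open>(1 - s) K\<close> is needed.\<close>

lemma minimizer_dilation: "(mean_hess mh K ** K) \<bullet> K \<le> real CARD('d)"
proof -
  let ?q = "(mean_hess mh K ** K) \<bullet> K" and ?d = "real CARD('d)"
  \<comment> \<open>Comparison of the target with the dilated factor
    \<open>(1 - s) *\<^sub>R K\<close> gives \<open>s * ?q \<le> s * f s\<close>; the claim is the
    limit \<open>f 0 = ?d\<close>.\<close>
  define f where "f s = ?d / (1 - s) + \<beta> / 2 * s * (norm K)\<^sup>2" for s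
  have le: "?q \<le> f s" if s: "0 < s" "s < 1" for s
  proof -
    have B: "det ((1 - s) *\<^sub>R K) \<noteq> 0" "((1 - s) *\<^sub>R K) ** transpose ((1 - s) *\<^sub>R K) = (1 - s)\<^sup>2 *\<^sub>R Sh"
      using s K by (simp_all add: transpose_scalar matmul.scaleR_left matmul.scaleR_right power2_eq_square
          sym_pd_det_nz sym_pd_scaleR)
    have "det ((1 - s)\<^sup>2 *\<^sub>R Sh) = ((1 - s)\<^sup>2) ^ CARD('d) * det Sh"
      by (rule det_scaleR_matrix)
    then have "ln (det ((1 - s)\<^sup>2 *\<^sub>R Sh)) = 2 * ?d * ln (1 - s) + ln (det Sh)"
      using s sym_pd_det_pos[OF min_pd] by (simp add: ln_mult_pos ln_realpow power_mult[symmetric])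
    then have "?d * ln (1 - s) \<le> EV mh ((1 - s) *\<^sub>R K) - EV mh K"
      using minimizer_factor[OF B, of mh] by (simp add: K)
    moreover have "EV mh ((1 - s) *\<^sub>R K) \<le> EV mh K - s * ?q + \<beta> / 2 * (s\<^sup>2 * (norm K)\<^sup>2)"
      using EV_le[of mh 0 K "- s *\<^sub>R K"] by (simp add: scaleR_diff_left power_mult_distrib)
    moreover have "- ln (1 - s) \<le> s / (1 - s)"
      using ln_le_minus_one[of "1 / (1 - s)"] s by (simp add: ln_div field_simps)
    then have "- (?d * ln (1 - s)) \<le> ?d * (s / (1 - s))"
      using mult_left_mono[of "- ln (1 - s)" "s / (1 - s)" ?d] by simp
    ultimately have "s * ?q \<le> ?d * (s / (1 - s)) + \<beta> / 2 * (s\<^sup>2 * (norm K)\<^sup>2)" by linarith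
    also have "\<dots> = s * f s" by (simp add: f_def power2_eq_square algebra_simps)
    finally show ?thesis using s by simp
  qed
  have "(f \<longlongrightarrow> f 0) (at_right 0)"
    unfolding f_def by (auto intro!: tendsto_eq_intros)
  moreover have "\<forall>\<^sub>F s in at_right 0. ?q \<le> f s"
    unfolding eventually_at_right_field using le by (intro exI[of _ 1]) auto
  ultimately have "?q \<le> f 0" by (rule tendsto_lowerbound) simp
  then show ?thesis by (simp add: f_def)
qed

text \<open>Comparison with the target along \<open>?X\<close> and \<open>?Y\<close>. The gradient
  at \<open>?X z\<close> is split into its value at \<open>mh\<close>, the change \<open>a\<close>
  from \<open>mh\<close> to \<open>?Y z\<close> and the change \<open>b\<close> from there to
  \<open>?X z\<close>; \<open>B *v z\<close> is split into \<open>u = K *v z\<close> and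
  \<open>w\<close>. Each cross term of \<open>a\<close> or \<open>b\<close> goes into
  \<open>a \<bullet> u\<close>, whose mean is controlled by \<open>minimizer_dilation\<close>, or
  into squared distances; terms with the constant gradient at \<open>mh\<close> have mean
  zero.\<close>

lemma mean_hess_factor_bound:
  fixes m :: "real^'d" and B :: "real^'d^'d"
  defines "D \<equiv> (norm (m - mh))\<^sup>2 + (norm (B - K))\<^sup>2"
  shows "(mean_hess m B ** B) \<bullet> B \<le> 5/2 * real CARD('d) + 7/4 * (\<beta>\<^sup>2 / \<alpha>) * D"
proof -
  let ?qh = "(mean_hess mh K ** K) \<bullet> K"
  let ?g = "gradV mh"
  let ?X = "\<lambda>z. m + B *v z" and ?Y = "\<lambda>z. mh + K *v z"
  let ?E = "\<lambda>z. (m - mh) + (B - K) *v z"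
  have XY: "?X z - ?Y z = ?E z" for z by (simp add: matvec.diff_left algebra_simps)
  have bp: "\<beta> > 0" by (rule beta_pos)
  have pt: "gradV (?X z) \<bullet> (0 + B *v z) \<le> (\<beta> / 2 + \<beta>\<^sup>2 / (4 * \<alpha>)) * (norm (?E z))\<^sup>2 + \<beta> * (norm ((B - K) *v z))\<^sup>2
      + (5/2) * (gradV (?Y z) \<bullet> (0 + K *v z)) - (3/2) * (?g \<bullet> (K *v z)) + ?g \<bullet> ((B - K) *v z)" for z
  proof -
    define u where "u = K *v z"
    define w where "w = (B - K) *v z"
    define a where "a = gradV (?Y z) - ?g"
    define b where "b = gradV (?X z) - gradV (?Y z)"
    define e where "e = norm (?E z)"
    have Bz: "B *v z = w + u" by (simp add: w_def u_def matvec.diff_left)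
    have aw: "a \<bullet> w \<le> a \<bullet> u / 2 + \<beta> / 2 * (norm w)\<^sup>2"
    proof -
      have "(norm a)\<^sup>2 \<le> \<beta> * (a \<bullet> u)" using grad_cocoercive[of "?Y z" mh] by (simp add: a_def u_def)
      moreover have "0 \<le> (norm (a - \<beta> *\<^sub>R w))\<^sup>2" by simp
      then have "2 * \<beta> * (a \<bullet> w) \<le> (norm a)\<^sup>2 + \<beta>\<^sup>2 * (norm w)\<^sup>2"
        by (simp add: power2_norm_eq_inner inner_diff_left inner_diff_right inner_commute power2_eq_square[of \<beta>] algebra_simps)
      ultimately have "2 * \<beta> * (a \<bullet> w) \<le> 2 * \<beta> * (a \<bullet> u / 2 + \<beta> / 2 * (norm w)\<^sup>2)"
        by (simp add: algebra_simps power2_eq_square)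
      then show ?thesis using bp by simp
    qed
    have au: "\<alpha> * (norm u)\<^sup>2 \<le> a \<bullet> u"
      using grad_strongly_monotone[of "?Y z" mh] by (simp add: a_def u_def)
    have nb: "norm b \<le> \<beta> * e" using grad_lipschitz[of "?X z" "?Y z"] by (simp add: b_def e_def XY)
    have bw: "b \<bullet> w \<le> \<beta> / 2 * e\<^sup>2 + \<beta> / 2 * (norm w)\<^sup>2"
    proof -
      have "b \<bullet> w \<le> norm b * norm w" by (rule norm_cauchy_schwarz)
      also have "\<dots> \<le> \<beta> * e * norm w" using nb by (intro mult_right_mono) auto
      also have "\<dots> \<le> \<beta> * ((e\<^sup>2 + (norm w)\<^sup>2) / 2)"
        using bp zero_le_power2[of "e - norm w"] by (simp add: power2_diff mult.assoc)
      finally show ?thesis by (simp add: algebra_simps)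
    qed
    have bu: "b \<bullet> u \<le> a \<bullet> u + \<beta>\<^sup>2 / (4 * \<alpha>) * e\<^sup>2"
    proof -
      have "b \<bullet> u \<le> norm b * norm u" by (rule norm_cauchy_schwarz)
      also have "\<dots> \<le> \<beta> * e * norm u" using nb by (intro mult_right_mono) auto
      also have "\<dots> \<le> \<alpha> * (norm u)\<^sup>2 + \<beta>\<^sup>2 / (4 * \<alpha>) * e\<^sup>2"
      proof -
        have "0 \<le> (2 * \<alpha> * norm u - \<beta> * e)\<^sup>2 / (4 * \<alpha>)" using alpha_pos by simp
        also have "\<dots> = \<alpha> * (norm u)\<^sup>2 + \<beta>\<^sup>2 / (4 * \<alpha>) * e\<^sup>2 - \<beta> * e * norm u"
          using alpha_pos by (simp add: power2_eq_square field_simps)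
        finally show ?thesis by simp
      qed
      finally show ?thesis using au by simp
    qed
    have s1: "gradV (?X z) \<bullet> (0 + B *v z) = b \<bullet> w + b \<bullet> u + a \<bullet> w + ?g \<bullet> w + gradV (?Y z) \<bullet> u"
      by (simp add: Bz b_def a_def inner_diff_left inner_add_right)
    have s2: "a \<bullet> u = gradV (?Y z) \<bullet> u - ?g \<bullet> u" by (simp add: a_def inner_diff_left)
    have "(\<beta> / 2 + \<beta>\<^sup>2 / (4 * \<alpha>)) * e\<^sup>2 = \<beta> / 2 * e\<^sup>2 + \<beta>\<^sup>2 / (4 * \<alpha>) * e\<^sup>2" by (rule distrib_right)
    \<comment> \<open>The coefficient 5/2 collects 1 from the last term on the left, 1 from
      \<open>bu\<close> and 1/2 from \<open>aw\<close>.\<close>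
    then have "b \<bullet> w + b \<bullet> u + a \<bullet> w + ?g \<bullet> w + gradV (?Y z) \<bullet> u \<le> (\<beta> / 2 + \<beta>\<^sup>2 / (4 * \<alpha>)) * e\<^sup>2
        + \<beta> * (norm w)\<^sup>2 + (5/2) * (gradV (?Y z) \<bullet> u) - (3/2) * (?g \<bullet> u) + ?g \<bullet> w"
      using aw bw bu s2 by linarith
    then show ?thesis unfolding s1 by (simp add: e_def w_def u_def)
  qed
  have "(mean_hess m B ** B) \<bullet> B \<le> (\<beta> / 2 + \<beta>\<^sup>2 / (4 * \<alpha>)) * D + \<beta> * (norm (B - K))\<^sup>2 + (5/2) * ?qh"
  proof (rule has_bochner_integral_le[OF _ _ pt])
    show "has_bochner_integral std_gauss (\<lambda>z. gradV (?X z) \<bullet> (0 + B *v z)) ((mean_hess m B ** B) \<bullet> B)"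
      using grad_stein[of m B 0 B] by simp
    have "has_bochner_integral std_gauss (\<lambda>z. (\<beta> / 2 + \<beta>\<^sup>2 / (4 * \<alpha>)) * (norm (?E z))\<^sup>2 + \<beta> * (norm ((B - K) *v z))\<^sup>2
      + (5/2) * (gradV (?Y z) \<bullet> (0 + K *v z)) - (3/2) * (?g \<bullet> (K *v z)) + ?g \<bullet> ((B - K) *v z))
      ((\<beta> / 2 + \<beta>\<^sup>2 / (4 * \<alpha>)) * D + \<beta> * (norm (B - K))\<^sup>2 + (5/2) * (mean_grad mh K \<bullet> 0 + ?qh) - (3/2) * 0 + 0)"
      unfolding D_def
      by (intro has_bochner_integral_add has_bochner_integral_diff has_bochner_integral_mult_right
          std_gauss_norm_sq_affine std_gauss_norm_sq_linear grad_stein std_gauss_inner_linear_mean_zero)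
    then show "has_bochner_integral std_gauss (\<lambda>z. (\<beta> / 2 + \<beta>\<^sup>2 / (4 * \<alpha>)) * (norm (?E z))\<^sup>2 + \<beta> * (norm ((B - K) *v z))\<^sup>2
      + (5/2) * (gradV (?Y z) \<bullet> (0 + K *v z)) - (3/2) * (?g \<bullet> (K *v z)) + ?g \<bullet> ((B - K) *v z))
      ((\<beta> / 2 + \<beta>\<^sup>2 / (4 * \<alpha>)) * D + \<beta> * (norm (B - K))\<^sup>2 + (5/2) * ?qh)" by simp
  qed
  \<comment> \<open>After \<open>\<beta> \<le> \<beta>\<^sup>2 / \<alpha>\<close> the distance terms
    add up to 1/2 + 1/4 + 1 = 7/4.\<close>
  also have "\<dots> \<le> 5/2 * real CARD('d) + 7/4 * (\<beta>\<^sup>2 / \<alpha>) * D"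
  proof -
    have D: "0 \<le> D" "(norm (B - K))\<^sup>2 \<le> D" by (simp_all add: D_def)
    have "\<beta> * \<alpha> \<le> \<beta> * \<beta>" using bp alpha_le_beta by (intro mult_left_mono) auto
    then have bb: "\<beta> \<le> \<beta>\<^sup>2 / \<alpha>" using alpha_pos by (simp add: field_simps power2_eq_square)
    have "\<beta> * (norm (B - K))\<^sup>2 \<le> \<beta> * D" using D bp by (intro mult_left_mono) auto
    define X where "X = \<beta>\<^sup>2 / \<alpha> * D"
    have "\<beta> * D \<le> X" unfolding X_def using bb D by (intro mult_right_mono) auto
    moreover have e1: "(\<beta> / 2 + \<beta>\<^sup>2 / (4 * \<alpha>)) * D = (\<beta> * D) / 2 + X / 4" by (simp add: X_def field_simps)
    moreover have e2: "7/4 * (\<beta>\<^sup>2 / \<alpha>) * D = 7/4 * X" by (simp add: X_def)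
    ultimately show ?thesis unfolding e1 e2
      using minimizer_dilation \<open>\<beta> * (norm (B - K))\<^sup>2 \<le> \<beta> * D\<close> by linarith
  qed
  finally show ?thesis .
qed

text \<open>One half serves both purposes: invertibility of the forward matrix, and smoothness
  errors of at most half of a square.\<close>

lemma eta_beta_le: "\<eta> * \<beta> \<le> 1 / 2"
proof -
  have bp: "\<beta> > 0" by (rule beta_pos)
  have "\<eta> * \<beta> \<le> \<alpha>\<^sup>2 / (48 * \<beta> ^ 3) * \<beta>" using eta_le bp by (intro mult_right_mono) auto
  also have "\<dots> = \<alpha>\<^sup>2 / \<beta>\<^sup>2 / 48" using bp by (simp add: power2_eq_square power3_eq_cube field_simps)
  also have "\<dots> \<le> 1 / 48"
    using bp alpha_pos alpha_le_beta by (intro divide_right_mono) (simp_all add: power_mono)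
  finally show ?thesis by simp
qed

section \<open>One step for a fixed sample\<close>

lemma update_eq:
  "fbgvi_update gradV hessV \<eta> (m, S) x =
    (m - \<eta> *\<^sub>R gradV x, entropy_prox \<eta> ((mat 1 - \<eta> *\<^sub>R hessV x) ** S ** (mat 1 - \<eta> *\<^sub>R hessV x)))"
  by (simp add: fbgvi_update_def entropy_prox_def Let_def)

lemma forward_matrix_pd: "sym_pd (mat 1 - \<eta> *\<^sub>R hessV x)"
proof -
  have "0 < h \<bullet> ((mat 1 - \<eta> *\<^sub>R hessV x) *v h)" if "h \<noteq> 0" for h
  proof -
    have "\<eta> * (h \<bullet> (hessV x *v h)) \<le> \<eta> * (\<beta> * (h \<bullet> h))"
      using smooth[of h x] eta_pos by (intro mult_left_mono) auto
    also have "\<dots> \<le> 1 / 2 * (h \<bullet> h)"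
      using mult_right_mono[OF eta_beta_le, of "h \<bullet> h"] by simp
    also have "\<dots> < h \<bullet> h" using that by simp
    finally show ?thesis by (simp add: matvec.diff_left matvec.scaleR_left inner_diff_right)
  qed
  then show ?thesis by (simp add: sym_pd_def transpose_diff transpose_scalar hess_transpose)
qed

text \<open>Holds for every sample point \<open>x\<close>, before averaging. Only \<open>b\<close>
  and \<open>s\<close> depend on \<open>x\<close>; \<open>g0\<close> and \<open>Hb\<close> are their
  Gaussian means, so the last line averages to a variance.\<close>

lemma step_pointwise:
  fixes m :: "real^'d" and B :: "real^'d^'d" and x :: "real^'d"
  assumes B: "det B \<noteq> 0" "B ** transpose B = S"
  defines "b \<equiv> gradV x" and "s \<equiv> hessV x" and "g0 \<equiv> mean_grad m B" and "Hb \<equiv> mean_hess m B"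
  defines "u \<equiv> fbgvi_update gradV hessV \<eta> (m, S) x"
  shows "sym_pd (snd u)"
    and "bw_sq mh K (fst u) (snd u) \<le> (norm (m - mh))\<^sup>2 + (norm (B - K))\<^sup>2
      - 2 * \<eta> * (b \<bullet> (m - mh) + (s ** B) \<bullet> (B - K)) + 2 * \<eta> * (EV m B - EV mh K)
      + 2 * \<eta>\<^sup>2 * ((norm (g0 - b))\<^sup>2 + (norm ((Hb - s) ** B))\<^sup>2)"
proof -
  define A where "A = mat 1 - \<eta> *\<^sub>R s"
  define P where "P = A ** S ** A"
  define S1 where "S1 = entropy_prox \<eta> P"
  define m1 where "m1 = m - \<eta> *\<^sub>R b"
  have A: "sym_pd A" unfolding A_def s_def by (rule forward_matrix_pd)
  have tA: "transpose A = A" "det A \<noteq> 0" using A sym_pd_det_nz by (auto simp: sym_pd_def)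
  have u: "u = (m1, S1)" by (simp add: u_def update_eq m1_def S1_def P_def A_def s_def b_def)
  let ?C = "A ** B"
  have C: "det ?C \<noteq> 0" "?C ** transpose ?C = P"
  proof -
    show "det ?C \<noteq> 0" using tA B(1) by (simp add: det_mul)
    show "?C ** transpose ?C = P"
      unfolding P_def B(2)[symmetric] by (simp add: matrix_transpose_mul tA matrix_mul_assoc)
  qed
  obtain R where R: "det (R ** ?C) \<noteq> 0" "(R ** ?C) ** transpose (R ** ?C) = S1"
    and evi: "bw_sq mh K m1 S1 \<le> (norm (m1 - mh))\<^sup>2 + (norm (?C - K))\<^sup>2
      + \<eta> * (ln (det S1) - ln (det (K ** K))) - (norm (R ** ?C - ?C))\<^sup>2"
    using entropy_prox_evi[OF K(1) eta_pos C, of mh m1] unfolding S1_def by metis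
  show "sym_pd (snd u)" using sym_pd_factor[OF R(1)] R(2) by (simp add: u)
  \<comment> \<open>\<open>c\<close> and \<open>E\<close> are the displacements of mean and factor
    over the whole step, forward and backward parts together; smoothness is applied along
    them.\<close>
  define c where "c = - \<eta> *\<^sub>R b"
  define E where "E = R ** ?C - B"
  define T where "T = s ** B"
  have CT: "?C = B - \<eta> *\<^sub>R T" by (simp add: A_def T_def matmul.diff_left matmul.scaleR_left)
  have "ln (det S1) - ln (det (K ** K)) \<le> 2 * (EV m1 (R ** ?C) - EV mh K)"
    by (rule minimizer_factor[OF R])
  also have "EV m1 (R ** ?C) \<le> EV m B + (g0 \<bullet> c + (Hb ** B) \<bullet> E) + \<beta> / 2 * ((norm c)\<^sup>2 + (norm E)\<^sup>2)"
    using EV_le[of m c B E] by (simp add: m1_def c_def E_def g0_def Hb_def)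
  finally have "ln (det S1) - ln (det (K ** K)) \<le> 2 * (EV m B + (g0 \<bullet> c + (Hb ** B) \<bullet> E) + \<beta> / 2 * ((norm c)\<^sup>2 + (norm E)\<^sup>2) - EV mh K)"
    by simp
  from mult_left_mono[OF this, of \<eta>]
  have lnle: "\<eta> * (ln (det S1) - ln (det (K ** K))) \<le> 2 * \<eta> * (EV m B - EV mh K) + 2 * \<eta> * (g0 \<bullet> c) + 2 * \<eta> * ((Hb ** B) \<bullet> E)
     + \<eta> * \<beta> * (norm c)\<^sup>2 + \<eta> * \<beta> * (norm E)\<^sup>2"
    using eta_pos by (simp add: algebra_simps)
  have q: "\<eta> * \<beta> * (norm v)\<^sup>2 \<le> (norm v)\<^sup>2 / 2" for v :: "'z::real_normed_vector"
    using mult_right_mono[OF eta_beta_le, of "(norm v)\<^sup>2"] by simp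
  have y: "2 * \<eta> * (p \<bullet> v) \<le> (norm v)\<^sup>2 / 2 + 2 * \<eta>\<^sup>2 * (norm p)\<^sup>2" for p v :: "'z::real_inner"
  proof -
    have "0 \<le> (norm ((2 * \<eta>) *\<^sub>R p - v))\<^sup>2" by simp
    then show ?thesis
      by (simp add: power2_norm_eq_inner inner_diff_left inner_diff_right inner_commute power2_eq_square[of \<eta>] algebra_simps)
  qed
  \<comment> \<open>Since \<open>- 2 * \<eta> * (b \<bullet> c)\<close> is twice
    \<open>(norm c)\<^sup>2\<close>, this regroups the expansion so that the mean, like the factor,
    has a negative square to spend.\<close>
  have i1: "(norm (m1 - mh))\<^sup>2 = (norm (m - mh))\<^sup>2 - 2 * \<eta> * (b \<bullet> (m - mh)) - (norm c)\<^sup>2 - 2 * \<eta> * (b \<bullet> c)"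
    by (simp add: m1_def c_def power2_norm_eq_inner inner_diff_left inner_diff_right inner_commute power2_eq_square[of \<eta>] algebra_simps)
  \<comment> \<open>The term in \<open>(norm T)\<^sup>2\<close> cancels against the one in
    \<open>i3\<close>, which enters negatively; \<open>- (norm E)\<^sup>2\<close> remains.\<close>
  have i2: "(norm (?C - K))\<^sup>2 = (norm (B - K))\<^sup>2 - 2 * \<eta> * (T \<bullet> (B - K)) + \<eta>\<^sup>2 * (norm T)\<^sup>2"
    unfolding CT by (simp add: power2_norm_eq_inner inner_diff_left inner_diff_right inner_commute power2_eq_square[of \<eta>] algebra_simps)
  have i3: "(norm (R ** ?C - ?C))\<^sup>2 = (norm E)\<^sup>2 + 2 * \<eta> * (T \<bullet> E) + \<eta>\<^sup>2 * (norm T)\<^sup>2"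
  proof -
    have "R ** ?C - ?C = E + \<eta> *\<^sub>R T" unfolding E_def by (subst (2) CT) simp
    then show ?thesis
      by (simp add: power2_norm_eq_inner inner_add_left inner_add_right inner_commute power2_eq_square[of \<eta>] algebra_simps)
  qed
  have i4: "(Hb - s) ** B = Hb ** B - T" by (simp add: T_def matmul.diff_left)
  \<comment> \<open>Smoothness uses half of each of the squares of \<open>c\<close> and
    \<open>E\<close>, through \<open>q\<close>; Young's inequality \<open>y\<close> uses the other
    half.\<close>
  have "2 * \<eta> * (g0 \<bullet> c) - 2 * \<eta> * (b \<bullet> c) \<le> (norm c)\<^sup>2 / 2 + 2 * \<eta>\<^sup>2 * (norm (g0 - b))\<^sup>2"
    using y[of "g0 - b" c] by (simp add: inner_diff_left algebra_simps)
  moreover have "2 * \<eta> * ((Hb ** B) \<bullet> E) - 2 * \<eta> * (T \<bullet> E) \<le> (norm E)\<^sup>2 / 2 + 2 * \<eta>\<^sup>2 * (norm ((Hb - s) ** B))\<^sup>2"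
    using y[of "Hb ** B - T" E] unfolding i4 by (simp add: inner_diff_left algebra_simps)
  moreover have "2 * \<eta> * (b \<bullet> (m - mh) + T \<bullet> (B - K)) = 2 * \<eta> * (b \<bullet> (m - mh)) + 2 * \<eta> * (T \<bullet> (B - K))"
    by (simp add: distrib_left)
  moreover have "2 * \<eta>\<^sup>2 * ((norm (g0 - b))\<^sup>2 + (norm ((Hb - s) ** B))\<^sup>2) = 2 * \<eta>\<^sup>2 * (norm (g0 - b))\<^sup>2 + 2 * \<eta>\<^sup>2 * (norm ((Hb - s) ** B))\<^sup>2"
    by (simp add: distrib_left)
  ultimately show "bw_sq mh K (fst u) (snd u) \<le> (norm (m - mh))\<^sup>2 + (norm (B - K))\<^sup>2
      - 2 * \<eta> * (b \<bullet> (m - mh) + (s ** B) \<bullet> (B - K)) + 2 * \<eta> * (EV m B - EV mh K)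
      + 2 * \<eta>\<^sup>2 * ((norm (g0 - b))\<^sup>2 + (norm ((Hb - s) ** B))\<^sup>2)"
    using evi lnle q[of c] q[of E] i1 i2 i3 unfolding u fst_conv snd_conv T_def[symmetric] by linarith
qed

end

section \<open>Joint measurability in state and sample\<close>

lemma fst_borel [measurable]:
  "fst \<in> borel_measurable (borel :: ('a::second_countable_topology \<times> 'b::second_countable_topology) measure)"
  by (intro borel_measurable_continuous_onI continuous_intros)

lemma snd_borel [measurable]:
  "snd \<in> borel_measurable (borel :: ('a::second_countable_topology \<times> 'b::second_countable_topology) measure)"
  by (intro borel_measurable_continuous_onI continuous_intros)

lemma gauss_dens_joint_measurable [measurable]:
  assumes [measurable]: "f \<in> borel_measurable M" "g \<in> borel_measurable M" "h \<in> borel_measurable M"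
  shows "(\<lambda>x. gauss_dens (f x :: real^'d) (g x) (h x)) \<in> borel_measurable M"
  unfolding gauss_dens_def by measurable

lemma bw_sq_measurable [measurable]:
  assumes [measurable]: "f \<in> borel_measurable M" "g \<in> borel_measurable M"
  shows "(\<lambda>x. bw_sq mh K (f x :: real^'d) (g x)) \<in> borel_measurable M"
  unfolding bw_sq_def opt_factor_def by measurable

subsection \<open>Monadic bind with a kernel that is only almost surely a subprobability\<close>

text \<open>\<open>bind\<close> sees its kernel only through preimages of sets of the subprobability
  algebra. Such sets contain nothing but subprobabilities, so replacing \<open>f\<close> on a null
  set by the null measure changes these preimages by null sets only.\<close>

lemma bind_AE_subprob:
  fixes f :: "'a \<Rightarrow> 'b measure"
  assumes M: "space M \<noteq> {}"
    and sets: "\<And>x. sets (f x) = sets N"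
    and meas: "\<And>A. A \<in> sets N \<Longrightarrow> (\<lambda>x. emeasure (f x) A) \<in> borel_measurable M"
    and le1: "AE x in M. emeasure (f x) (space N) \<le> 1" and N: "space N \<noteq> {}"
  obtains f' where "f' \<in> M \<rightarrow>\<^sub>M subprob_algebra N" "AE x in M. f' x = f x" "M \<bind> f = M \<bind> f'"
proof
  let ?S = "subprob_algebra N"
  define G where "G = {x \<in> space M. emeasure (f x) (space N) \<le> 1}"
  define f' where "f' x = (if x \<in> G then f x else null_measure N)" for x
  have [measurable]: "(\<lambda>x. emeasure (f x) (space N)) \<in> borel_measurable M" using meas by blast
  have G [measurable]: "G \<in> sets M" unfolding G_def by measurable
  have sp: "space (f x) = space N" for x using sets by (rule sets_eq_imp_space_eq)
  have sub: "subprob_space (f x)" if "x \<in> G" for x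
    using that N by (intro subprob_spaceI) (auto simp: G_def sp)
  show f'M: "f' \<in> M \<rightarrow>\<^sub>M ?S"
  proof (rule measurable_subprob_algebra)
    show "subprob_space (f' x)" for x
      using sub N by (auto simp: f'_def intro!: subprob_spaceI)
    show "sets (f' x) = sets N" for x using sets by (simp add: f'_def)
    fix A assume A: "A \<in> sets N"
    have "emeasure (f' x) A = (if x \<in> G then emeasure (f x) A else 0)" for x by (simp add: f'_def)
    then show "(\<lambda>x. emeasure (f' x) A) \<in> borel_measurable M" using meas[OF A] by simp
  qed
  have AEG: "AE x in M. x \<in> G" using le1 by (auto simp: G_def)
  then show "AE x in M. f' x = f x" by (auto simp: f'_def)
  have "distr M ?S f = distr M ?S f'"
    unfolding distr_def
  proof (rule measure_of_eq)
    fix A assume "A \<in> sigma_sets (space ?S) (sets ?S)"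
    then have A: "A \<in> sets ?S" by (simp add: sets.sigma_sets_eq)
    have inG: "f x \<in> A \<longleftrightarrow> f' x \<in> A \<and> x \<in> G" if x: "x \<in> space M" for x
    proof -
      have "x \<in> G" if "f x \<in> A"
      proof -
        have "f x \<in> space ?S" using sets.sets_into_space[OF A] that by blast
        then have "subprob_space (f x)" by (simp add: space_subprob_algebra)
        from subprob_space.emeasure_space_le_1[OF this] show ?thesis using x by (simp add: G_def sp)
      qed
      then show ?thesis by (auto simp: f'_def)
    qed
    have m: "f' -` A \<inter> space M \<in> sets M" by (rule measurable_sets[OF f'M A])
    have "f -` A \<inter> space M = (f' -` A \<inter> space M) \<inter> G" using inG by (auto simp: G_def)
    then show "emeasure M (f -` A \<inter> space M) = emeasure M (f' -` A \<inter> space M)"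
      using AEG m G by (auto intro!: emeasure_eq_AE)
  qed (rule sets.space_closed)
  moreover have "subprob_algebra (f x) = ?S" "subprob_algebra (f' x) = ?S" for x
    using sets by (auto intro!: subprob_algebra_cong simp: f'_def)
  ultimately show "M \<bind> f = M \<bind> f'" by (simp add: bind_nonempty[OF M])
qed

subsection \<open>Convergence\<close>

lemma ennreal_mult_add:
  "0 \<le> c \<Longrightarrow> 0 \<le> D \<Longrightarrow> 0 \<le> e \<Longrightarrow> ennreal (c * D + e) = ennreal c * ennreal D + ennreal e"
  by (simp add: ennreal_plus ennreal_mult)

lemma std_gauss_const: "has_bochner_integral std_gauss (\<lambda>z :: real^'d. c :: real) c"
  by (simp add: has_bochner_integral_iff)

context gauss_vi
begin

lemma update_joint_measurable [measurable]:
  assumes [measurable]: "f \<in> borel_measurable M" "g \<in> borel_measurable M"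
  shows "(\<lambda>x. fbgvi_update gradV hessV \<eta> (f x) (g x)) \<in> borel_measurable M"
  unfolding fbgvi_update_def Let_def
  by (intro borel_measurable_Pair) measurable

text \<open>For any factor \<open>B\<close>; it becomes a contraction of the true distance once
  \<open>B\<close> is the optimal factor, when \<open>D\<close> equals
  \<open>bw_sq mh K m S\<close>.\<close>

lemma step_expectation_bound:
  fixes m :: "real^'d" and B :: "real^'d^'d"
  assumes B: "det B \<noteq> 0" "B ** transpose B = S"
  defines "D \<equiv> (norm (m - mh))\<^sup>2 + (norm (B - K))\<^sup>2"
  shows "(\<integral>\<^sup>+z. ennreal (bw_sq mh K (fst (fbgvi_update gradV hessV \<eta> (m, S) (m + B *v z)))
      (snd (fbgvi_update gradV hessV \<eta> (m, S) (m + B *v z)))) \<partial>std_gauss)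
    \<le> ennreal ((1 - \<alpha> * \<eta> / 2) * D + 12 * \<beta> * \<eta>\<^sup>2 * real CARD('d))"
proof -
  let ?X = "\<lambda>z. m + B *v z"
  define g0 where "g0 = mean_grad m B"
  define Hb where "Hb = mean_hess m B"
  \<comment> \<open>Cocoercivity needs a reference point. With \<open>m\<close> the displacement is
    \<open>B *v z\<close>, so the mean of the bound is expressed by \<open>q\<close>, and
    \<open>a \<bullet> (B *v z)\<close> averages to zero.\<close>
  define a where "a = gradV m"
  define q where "q = (Hb ** B) \<bullet> B"
  define n where "n = (norm (Hb ** B))\<^sup>2"
  \<comment> \<open>A majorant whose expectation can be read off: linear in \<open>gradV\<close> and
    \<open>hessV\<close> at the sample. The zeros here and in \<open>W\<close> match the shape of
    the integration rules.\<close>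
  define w where "w z = D - 2 * \<eta> * (gradV (?X z) \<bullet> (m - mh) + hessV (?X z) \<bullet> ((B - K) ** transpose B)) + 2 * \<eta> * (EV m B - EV mh K)
    + 2 * \<eta>\<^sup>2 * (\<beta> * (gradV (?X z) \<bullet> (0 + B *v z)) - \<beta> * (a \<bullet> (B *v z)) - 2 * (gradV (?X z) \<bullet> (g0 - a)) + (2 * (a \<bullet> (g0 - a)) + (norm (g0 - a))\<^sup>2 + n)
      - 2 * (hessV (?X z) \<bullet> ((Hb ** B) ** transpose B)) + \<beta> * (hessV (?X z) \<bullet> (B ** transpose B)))" for z
  define W where "W = D - 2 * \<eta> * (g0 \<bullet> (m - mh) + Hb \<bullet> ((B - K) ** transpose B)) + 2 * \<eta> * (EV m B - EV mh K)
    + 2 * \<eta>\<^sup>2 * (\<beta> * (g0 \<bullet> 0 + (Hb ** B) \<bullet> B) - \<beta> * 0 - 2 * (g0 \<bullet> (g0 - a)) + (2 * (a \<bullet> (g0 - a)) + (norm (g0 - a))\<^sup>2 + n)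
      - 2 * (Hb \<bullet> ((Hb ** B) ** transpose B)) + \<beta> * (Hb \<bullet> (B ** transpose B)))"
  have wW: "has_bochner_integral std_gauss w W"
    unfolding w_def W_def g0_def Hb_def
    by (intro has_bochner_integral_add has_bochner_integral_diff has_bochner_integral_mult_right
        std_gauss_const grad_stein mean_grad_inner mean_hess_inner std_gauss_inner_linear_mean_zero)
  let ?u = "\<lambda>z. fbgvi_update gradV hessV \<eta> (m, S) (?X z)"
  have pt: "bw_sq mh K (fst (?u z)) (snd (?u z)) \<le> w z" for z
  proof -
    let ?b = "gradV (?X z)" and ?s = "hessV (?X z)"
    have v1: "(norm (g0 - ?b))\<^sup>2 \<le> \<beta> * (?b \<bullet> (0 + B *v z)) - \<beta> * (a \<bullet> (B *v z)) - 2 * (?b \<bullet> (g0 - a)) + (2 * (a \<bullet> (g0 - a)) + (norm (g0 - a))\<^sup>2)"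
    proof -
      have "(norm (?b - a))\<^sup>2 \<le> \<beta> * ((?b - a) \<bullet> (B *v z))" using grad_cocoercive[of "?X z" m] by (simp add: a_def)
      moreover have "(norm (g0 - ?b))\<^sup>2 = (norm (?b - a))\<^sup>2 - 2 * ((?b - a) \<bullet> (g0 - a)) + (norm (g0 - a))\<^sup>2"
        by (simp add: power2_norm_eq_inner inner_diff_left inner_diff_right inner_commute algebra_simps)
      ultimately show ?thesis by (simp add: inner_diff_left algebra_simps)
    qed
    \<comment> \<open>The covariance analogue of cocoercivity: \<open>hess_norm_sq\<close> on each
      column of \<open>B\<close> bounds the square by a term linear in the Hessian.\<close>
    have v2: "(norm ((Hb - ?s) ** B))\<^sup>2 \<le> n - 2 * (?s \<bullet> ((Hb ** B) ** transpose B)) + \<beta> * (?s \<bullet> (B ** transpose B))"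
    proof -
      have "(norm (?s ** B))\<^sup>2 = (\<Sum>j\<in>UNIV. (norm (?s *v (B *v axis j 1)))\<^sup>2)"
        by (simp add: power2_norm_eq_inner matrix_inner_eq_sum_axis[of "?s ** B"] matrix_vector_mul_assoc)
      also have "\<dots> \<le> (\<Sum>j\<in>UNIV. \<beta> * ((B *v axis j 1) \<bullet> (?s *v (B *v axis j 1))))"
        by (intro sum_mono hess_norm_sq)
      also have "\<dots> = \<beta> * ((?s ** B) \<bullet> B)"
        unfolding matrix_inner_eq_sum_axis[of "?s ** B"] sum_distrib_left
        by (intro sum.cong) (simp_all add: matrix_vector_mul_assoc inner_commute)
      finally have "(norm (?s ** B))\<^sup>2 \<le> \<beta> * ((?s ** B) \<bullet> B)" .
      moreover have "(norm ((Hb - ?s) ** B))\<^sup>2 = n - 2 * ((?s ** B) \<bullet> (Hb ** B)) + (norm (?s ** B))\<^sup>2"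
        by (simp add: n_def power2_norm_eq_inner matmul.diff_left inner_diff_left inner_diff_right inner_commute algebra_simps)
      ultimately show ?thesis by (simp add: matrix_inner_mult_right)
    qed
    have v: "2 * \<eta>\<^sup>2 * ((norm (g0 - ?b))\<^sup>2 + (norm ((Hb - ?s) ** B))\<^sup>2)
      \<le> 2 * \<eta>\<^sup>2 * (\<beta> * (?b \<bullet> (0 + B *v z)) - \<beta> * (a \<bullet> (B *v z)) - 2 * (?b \<bullet> (g0 - a)) + (2 * (a \<bullet> (g0 - a)) + (norm (g0 - a))\<^sup>2 + n)
      - 2 * (?s \<bullet> ((Hb ** B) ** transpose B)) + \<beta> * (?s \<bullet> (B ** transpose B)))"
      using v1 v2 by (intro mult_left_mono) (linarith, simp)
    have sB: "(?s ** B) \<bullet> (B - K) = ?s \<bullet> ((B - K) ** transpose B)" by (simp only: matrix_inner_mult_right)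
    show ?thesis unfolding w_def D_def sB[symmetric]
      by (rule order_trans[OF step_pointwise(2)[OF B, of m "?X z", folded g0_def Hb_def] add_left_mono[OF v]])
  qed
  have w0: "0 \<le> w z" for z using order_trans[OF bw_sq_nonneg pt] .
  have "(\<integral>\<^sup>+z. ennreal (bw_sq mh K (fst (?u z)) (snd (?u z))) \<partial>std_gauss) \<le> (\<integral>\<^sup>+z. ennreal (w z) \<partial>std_gauss)"
    by (intro nn_integral_mono ennreal_leI pt)
  also have "\<dots> = ennreal W"
    using wW w0 by (subst nn_integral_eq_integral) (auto simp: has_bochner_integral_iff)
  also have "W \<le> (1 - \<alpha> * \<eta> / 2) * D + 12 * \<beta> * \<eta>\<^sup>2 * real CARD('d)"
  proof -
    define G where "G = g0 \<bullet> (m - mh) + (Hb ** B) \<bullet> (B - K)"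
    \<comment> \<open>Strong convexity between the coupled points, integrated. \<open>G\<close> is
      the mean first order term of the step, so adding the difference of mean potentials cancels it
      and leaves \<open>- \<alpha> * \<eta> * D\<close>.\<close>
    have "\<alpha> / 2 * D - G + EV m B \<le> EV mh K"
    proof (rule has_bochner_integral_le[OF _ EV_integral])
      show "has_bochner_integral std_gauss (\<lambda>z. \<alpha> / 2 * (norm ((m - mh) + (B - K) *v z))\<^sup>2 - gradV (?X z) \<bullet> ((m - mh) + (B - K) *v z) + V (?X z))
        (\<alpha> / 2 * D - G + EV m B)"
        unfolding D_def G_def g0_def Hb_def
        by (intro has_bochner_integral_add has_bochner_integral_diff has_bochner_integral_mult_right
          EV_integral grad_stein std_gauss_norm_sq_affine)
      fix z
      have e: "mh + K *v z - ?X z = - ((m - mh) + (B - K) *v z)" by (simp add: matvec.diff_left algebra_simps)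
      from V_lower[of "?X z" "mh + K *v z", unfolded e norm_minus_cancel inner_minus_right]
      show "\<alpha> / 2 * (norm ((m - mh) + (B - K) *v z))\<^sup>2 - gradV (?X z) \<bullet> ((m - mh) + (B - K) *v z) + V (?X z) \<le> V (mh + K *v z)"
        by linarith
    qed
    then have cv: "2 * \<eta> * (EV m B - EV mh K) \<le> 2 * \<eta> * (G - \<alpha> / 2 * D)"
      using eta_pos by (intro mult_left_mono) auto
    have Hn: "Hb \<bullet> ((Hb ** B) ** transpose B) = n" "Hb \<bullet> (B ** transpose B) = q" "Hb \<bullet> ((B - K) ** transpose B) = (Hb ** B) \<bullet> (B - K)"
      by (simp_all add: matrix_inner_mult_right[symmetric] n_def q_def power2_norm_eq_inner)
    have var: "g0 \<bullet> (g0 - a) - a \<bullet> (g0 - a) = (norm (g0 - a))\<^sup>2" by (simp add: power2_norm_eq_inner inner_diff_left)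
    \<comment> \<open>Mean and covariance each contribute \<open>\<beta> * q\<close>; centring
      leaves the two squares with negative sign, and they are dropped.\<close>
    have quad: "\<beta> * (g0 \<bullet> 0 + q) - \<beta> * 0 - 2 * (g0 \<bullet> (g0 - a)) + (2 * (a \<bullet> (g0 - a)) + (norm (g0 - a))\<^sup>2 + n) - 2 * n + \<beta> * q
      = 2 * \<beta> * q - (norm (g0 - a))\<^sup>2 - n"
      using var by (simp only: inner_zero_right add_0_left mult_zero_right)
    have "W = D - 2 * \<eta> * G + 2 * \<eta> * (EV m B - EV mh K) + 2 * \<eta>\<^sup>2 * (2 * \<beta> * q - (norm (g0 - a))\<^sup>2 - n)"
      unfolding W_def Hn G_def q_def[symmetric] quad by simp
    also have "\<dots> \<le> D - 2 * \<eta> * G + 2 * \<eta> * (G - \<alpha> / 2 * D) + 2 * \<eta>\<^sup>2 * (2 * \<beta> * q)"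
      by (rule add_mono[OF add_left_mono[OF cv]], rule mult_left_mono) (auto simp: n_def)
    also have "\<dots> = D - \<alpha> * \<eta> * D + 4 * \<eta>\<^sup>2 * \<beta> * q" by (simp add: algebra_simps)
    also have "4 * \<eta>\<^sup>2 * \<beta> * q \<le> 4 * \<eta>\<^sup>2 * \<beta> * (5/2 * real CARD('d) + 7/4 * (\<beta>\<^sup>2 / \<alpha>) * D)"
      using mean_hess_factor_bound[of m B] beta_pos unfolding q_def Hb_def D_def
      by (intro mult_left_mono) auto
    \<comment> \<open>The distance part is at most 7/48 of \<open>\<alpha> * \<eta> * D\<close>,
      hence within half of the contraction; 4 * 5/2 = 10 is rounded up to 12.\<close>
    also have "\<dots> \<le> 12 * \<beta> * \<eta>\<^sup>2 * real CARD('d) + \<alpha> * \<eta> / 2 * D"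
    proof -
      have bp: "\<beta> > 0" by (rule beta_pos)
      have D0: "0 \<le> D" by (simp add: D_def)
      have "\<eta> * \<beta> ^ 3 \<le> \<alpha>\<^sup>2 / (48 * \<beta> ^ 3) * \<beta> ^ 3" using eta_le bp by (intro mult_right_mono) auto
      also have "\<dots> = \<alpha>\<^sup>2 / 48" using bp by simp
      finally have "\<eta> * (\<eta> * \<beta> ^ 3) / \<alpha> \<le> \<eta> * (\<alpha>\<^sup>2 / 48) / \<alpha>"
        using eta_pos alpha_pos by (intro divide_right_mono mult_left_mono) auto
      also have "\<dots> = \<eta> * \<alpha> / 48" using alpha_pos by (simp add: power2_eq_square)
      finally have k: "\<eta> * (\<eta> * \<beta> ^ 3) / \<alpha> * D \<le> \<eta> * \<alpha> / 48 * D" using D0 by (rule mult_right_mono)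
      have "4 * \<eta>\<^sup>2 * \<beta> * (5/2 * real CARD('d) + 7/4 * (\<beta>\<^sup>2 / \<alpha>) * D)
        = 10 * (\<beta> * \<eta>\<^sup>2 * real CARD('d)) + 7 * (\<eta> * (\<eta> * \<beta> ^ 3) / \<alpha> * D)"
        by (simp add: power2_eq_square power3_eq_cube algebra_simps)
      also have "\<dots> \<le> 12 * (\<beta> * \<eta>\<^sup>2 * real CARD('d)) + 7 * (\<eta> * \<alpha> / 48 * D)"
      proof (rule add_mono)
        show "10 * (\<beta> * \<eta>\<^sup>2 * real CARD('d)) \<le> 12 * (\<beta> * \<eta>\<^sup>2 * real CARD('d))"
          using bp by (intro mult_right_mono) auto
        show "7 * (\<eta> * (\<eta> * \<beta> ^ 3) / \<alpha> * D) \<le> 7 * (\<eta> * \<alpha> / 48 * D)"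
          by (rule mult_left_mono[OF k]) simp
      qed
      also have "7 * (\<eta> * \<alpha> / 48 * D) \<le> \<alpha> * \<eta> / 2 * D"
      proof -
        have "0 \<le> \<alpha> * \<eta> * D" using alpha_pos eta_pos D0 by simp
        then show ?thesis by (simp add: mult.commute)
      qed
      finally show ?thesis by (simp add: mult.assoc)
    qed
    finally show ?thesis by (simp add: algebra_simps)
  qed
  finally show ?thesis by (simp add: ennreal_leI)
qed

lemma contraction_factor_pos: "0 < 1 - \<alpha> * \<eta> / 2"
proof -
  have "\<alpha> * \<eta> \<le> \<beta> * \<eta>" using alpha_le_beta eta_pos by (intro mult_right_mono) auto
  then show ?thesis using eta_beta_le by (simp add: mult.commute[of \<eta>])
qed

section \<open>The recursion along the law of the iterates\<close>

definition lyap :: "(real^'d) \<times> (real^'d^'d) \<Rightarrow> ennreal" where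
  "lyap s = (if sym_pd (snd s) then ennreal (bw_sq mh K (fst s) (snd s)) else \<infinity>)"

lemma lyap_measurable [measurable]: "lyap \<in> borel_measurable borel"
proof -
  have [measurable]: "Measurable.pred borel (\<lambda>s :: (real^'d) \<times> (real^'d^'d). sym_pd (snd s))"
    using sym_pd_measurable by (simp add: pred_def)
  show ?thesis unfolding lyap_def by measurable
qed

lemma W2sq_le_lyap: "W2sq (gauss (fst s) (snd s)) (gauss mh Sh) \<le> lyap s"
  using W2sq_gauss[OF K(1), of "snd s" "fst s" mh] by (simp add: lyap_def K(2))

lemma sets_fbgvi_kernel: "sets (fbgvi_kernel gradV hessV \<eta> s) = sets borel"
  by (simp add: fbgvi_kernel_def)

lemma kernel_lyap:
  "(\<integral>\<^sup>+t. lyap t \<partial>fbgvi_kernel gradV hessV \<eta> s)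
    \<le> ennreal (1 - \<alpha> * \<eta> / 2) * lyap s + ennreal (12 * \<beta> * \<eta>\<^sup>2 * real CARD('d))"
proof -
  note c = contraction_factor_pos
  show ?thesis
  proof (cases "sym_pd (snd s)")
    \<comment> \<open>The right side is infinite, because the contraction factor is strictly
      positive.\<close>
    case False
    then show ?thesis using c by (simp add: lyap_def ennreal_mult_top)
  next
    case True
    obtain m S where s: "s = (m, S)" by fastforce
    have S: "sym_pd S" using True s by simp
    define B where "B = opt_factor K S"
    have B: "det B \<noteq> 0" "B ** transpose B = S"
      using opt_factor[OF K(1) S] unfolding B_def by metis+
    let ?u = "\<lambda>x. fbgvi_update gradV hessV \<eta> (m, S) x"
    have "(\<integral>\<^sup>+t. lyap t \<partial>fbgvi_kernel gradV hessV \<eta> s) = (\<integral>\<^sup>+x. lyap (?u x) \<partial>gauss m S)"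
      unfolding fbgvi_kernel_def s by (subst nn_integral_distr) simp_all
    also have "\<dots> = (\<integral>\<^sup>+z. lyap (?u (m + B *v z)) \<partial>std_gauss)"
      unfolding gauss_eq_distr[OF B] by (subst nn_integral_distr) simp_all
    also have "\<dots> = (\<integral>\<^sup>+z. ennreal (bw_sq mh K (fst (?u (m + B *v z))) (snd (?u (m + B *v z)))) \<partial>std_gauss)"
      using step_pointwise(1)[OF B] by (simp add: lyap_def)
    also have "\<dots> \<le> ennreal ((1 - \<alpha> * \<eta> / 2) * bw_sq mh K m S + 12 * \<beta> * \<eta>\<^sup>2 * real CARD('d))"
      using step_expectation_bound[OF B, of m] by (simp add: bw_sq_def B_def)
    also have "\<dots> = ennreal (1 - \<alpha> * \<eta> / 2) * lyap s + ennreal (12 * \<beta> * \<eta>\<^sup>2 * real CARD('d))"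
      using c beta_pos bw_sq_nonneg by (subst ennreal_mult_add) (simp_all add: s lyap_def S)
    finally show ?thesis .
  qed
qed

text \<open>The density formula is valid for every matrix, definite or not, so measurability holds
  on the whole state space by joint measurability of the integrand.\<close>

lemma kernel_emeasure_measurable:
  assumes [measurable]: "A \<in> sets borel"
  shows "(\<lambda>s. emeasure (fbgvi_kernel gradV hessV \<eta> s) A) \<in> borel_measurable borel"
proof -
  have "emeasure (fbgvi_kernel gradV hessV \<eta> s) A
    = (\<integral>\<^sup>+x. ennreal (gauss_dens (fst s) (snd s) x) * indicator A (fbgvi_update gradV hessV \<eta> s x) \<partial>lborel)" for s
  proof -
    have "fbgvi_update gradV hessV \<eta> s -` A \<in> sets borel"
      using measurable_sets[of "fbgvi_update gradV hessV \<eta> s" borel borel A] by simp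
    then show ?thesis
      unfolding fbgvi_kernel_def by (subst emeasure_distr) (auto simp: gauss_def emeasure_density indicator_vimage[unfolded o_def] intro!: nn_integral_cong split: split_indicator)
  qed
  moreover have "(\<lambda>s. \<integral>\<^sup>+x. ennreal (gauss_dens (fst s) (snd s) x) * indicator A (fbgvi_update gradV hessV \<eta> s x) \<partial>lborel) \<in> borel_measurable borel"
    by measurable
  ultimately show ?thesis by simp
qed

text \<open>The three facts are proved together: the integral bound makes the kernel a probability
  almost everywhere, which keeps the mass at most 1, and the mass bound controls the additive
  constant in the next integral.\<close>

lemma law_lyap:
  assumes S0: "sym_pd S0"
  shows "sets (fbgvi_law gradV hessV \<eta> m0 S0 k) = sets borel \<and> emeasure (fbgvi_law gradV hessV \<eta> m0 S0 k) UNIV \<le> 1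
    \<and> (\<integral>\<^sup>+s. lyap s \<partial>fbgvi_law gradV hessV \<eta> m0 S0 k)
      \<le> ennreal ((1 - \<alpha> * \<eta> / 2) ^ k * bw_sq mh K m0 S0 + 24 * \<beta> * \<eta> * real CARD('d) / \<alpha>)"
proof (induction k)
  case 0
  show ?case
  proof -
    have "(\<integral>\<^sup>+s. lyap s \<partial>return borel (m0, S0)) = lyap (m0, S0)" by (rule nn_integral_return) simp_all
    also have "\<dots> \<le> ennreal (bw_sq mh K m0 S0 + 24 * \<beta> * \<eta> * real CARD('d) / \<alpha>)"
      using S0 beta_pos eta_pos alpha_pos by (simp add: lyap_def ennreal_leI)
    finally show ?thesis by simp
  qed
next
  case (Suc k)
  let ?c = "1 - \<alpha> * \<eta> / 2" and ?e = "12 * \<beta> * \<eta>\<^sup>2 * real CARD('d)" and ?f = "fbgvi_kernel gradV hessV \<eta>"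
  let ?U = "?c ^ k * bw_sq mh K m0 S0 + 24 * \<beta> * \<eta> * real CARD('d) / \<alpha>"
  define M where "M = fbgvi_law gradV hessV \<eta> m0 S0 k"
  note c = contraction_factor_pos
  have sM [measurable_cong]: "sets M = sets borel" and M1: "emeasure M UNIV \<le> 1"
    and Mlyap: "(\<integral>\<^sup>+s. lyap s \<partial>M) \<le> ennreal ?U" using Suc.IH unfolding M_def by auto
  have spM: "space M = UNIV" using sets_eq_imp_space_eq[OF sM] by simp
  \<comment> \<open>Finiteness of the integral rules out the value infinity almost everywhere, hence
    all states at which the covariance is not positive definite.\<close>
  have "(\<integral>\<^sup>+s. lyap s \<partial>M) \<noteq> \<infinity>" using Mlyap by (auto simp: top_unique)
  then have "AE s in M. lyap s \<noteq> \<infinity>" by (intro nn_integral_PInf_AE) simp_all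
  then have AEpd: "AE s in M. sym_pd (snd s)" by (rule AE_mp) (auto simp: lyap_def)
  have prob: "emeasure (?f s) UNIV = 1" if "sym_pd (snd s)" for s
    using prob_space.emeasure_space_1[OF prob_space.prob_space_distr[OF prob_space_gauss[OF that, of "fst s"], of "fbgvi_update gradV hessV \<eta> s" borel]]
    by (simp add: fbgvi_kernel_def)
  have le1: "AE s in M. emeasure (?f s) (space borel) \<le> 1" using AEpd by (rule AE_mp) (auto simp: prob)
  obtain f' where f': "f' \<in> M \<rightarrow>\<^sub>M subprob_algebra borel" "AE s in M. f' s = ?f s" "M \<bind> ?f = M \<bind> f'"
  proof (rule bind_AE_subprob[of M ?f borel])
    show "(\<lambda>s. emeasure (?f s) A) \<in> borel_measurable M" if "A \<in> sets borel" for A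
      using kernel_emeasure_measurable[OF that] by measurable
  qed (use le1 in \<open>auto simp: spM sets_fbgvi_kernel\<close>)
  have law: "fbgvi_law gradV hessV \<eta> m0 S0 (Suc k) = M \<bind> f'" by (simp add: M_def[symmetric] f'(3))
  have sets: "sets (M \<bind> f') = sets borel"
    using f'(1) by (intro sets_bind) (auto simp: spM dest: sets_kernel subprob_measurableD)
  have "emeasure (M \<bind> f') UNIV = (\<integral>\<^sup>+s. emeasure (f' s) UNIV \<partial>M)"
    using f'(1) by (intro emeasure_bind) (auto simp: spM)
  also have "\<dots> \<le> (\<integral>\<^sup>+s. 1 \<partial>M)"
    using f'(2) le1 by (intro nn_integral_mono_AE) auto
  also have "\<dots> \<le> 1" using M1 by (simp add: spM)
  finally have m1: "emeasure (M \<bind> f') UNIV \<le> 1" .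
  have "(\<integral>\<^sup>+t. lyap t \<partial>(M \<bind> f')) = (\<integral>\<^sup>+s. \<integral>\<^sup>+t. lyap t \<partial>f' s \<partial>M)"
    by (rule nn_integral_bind[OF _ f'(1)]) simp
  also have "\<dots> \<le> (\<integral>\<^sup>+s. ennreal ?c * lyap s + ennreal ?e \<partial>M)"
  proof (rule nn_integral_mono_AE)
    show "AE s in M. (\<integral>\<^sup>+t. lyap t \<partial>f' s) \<le> ennreal ?c * lyap s + ennreal ?e"
      using f'(2) by (rule AE_mp) (intro AE_I2 impI, simp only: kernel_lyap)
  qed
  also have "\<dots> = ennreal ?c * (\<integral>\<^sup>+s. lyap s \<partial>M) + ennreal ?e * emeasure M UNIV"
    by (subst nn_integral_add) (simp_all add: nn_integral_cmult spM)
  also have "\<dots> \<le> ennreal ?c * ennreal ?U + ennreal ?e * 1"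
    using Mlyap M1 by (intro add_mono mult_left_mono) auto
  also have "\<dots> = ennreal (?c * ?U + ?e)"
  proof -
    have "0 \<le> ?c ^ k" using c by (intro zero_le_power) simp
    then have "0 \<le> ?U" using beta_pos eta_pos alpha_pos bw_sq_nonneg
      by (intro add_nonneg_nonneg mult_nonneg_nonneg) simp_all
    moreover have "0 \<le> ?e" using beta_pos by simp
    ultimately have "0 \<le> ?U" "0 \<le> ?e" .
    from ennreal_mult_add[OF less_imp_le[OF c] this] show ?thesis by (simp only: mult_1_right)
  qed
  \<comment> \<open>The additive constant is a fixed point: \<open>\<alpha> * \<eta> / 2\<close>
    times it equals \<open>?e\<close>.\<close>
  also have "?c * ?U + ?e = ?c ^ Suc k * bw_sq mh K m0 S0 + 24 * \<beta> * \<eta> * real CARD('d) / \<alpha>"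
    using alpha_pos by (simp add: field_simps power2_eq_square)
  finally show ?case unfolding law using sets m1 by simp
qed

end

theorem mainTheorem6:
  fixes V :: "real^'d \<Rightarrow> real"
    and gradV :: "real^'d \<Rightarrow> real^'d"
    and hessV :: "real^'d \<Rightarrow> real^'d^'d"
    and \<alpha> \<beta> \<eta> :: real
    and m0 mh :: "real^'d" and S0 Sh :: "real^'d^'d"
    and N :: nat
  assumes grad: "\<And>x. (V has_derivative (\<lambda>h. gradV x \<bullet> h)) (at x)"
    and hess: "\<And>x. (gradV has_derivative (\<lambda>h. hessV x *v h)) (at x)"
    and hess_cont: "continuous_on UNIV hessV"
    and alpha_pos: "0 < \<alpha>" and alpha_le_beta: "\<alpha> \<le> \<beta>"
    and strongly_convex: "\<And>x h. \<alpha> * (h \<bullet> h) \<le> h \<bullet> (hessV x *v h)"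
    and smooth: "\<And>x h. \<bar>h \<bullet> (hessV x *v h)\<bar> \<le> \<beta> * (h \<bullet> h)"
    and min_pd: "sym_pd Sh"
    and minimizer: "\<And>m S. sym_pd S \<Longrightarrow> free_energy V mh Sh \<le> free_energy V m S"
    and eta_pos: "0 < \<eta>" and eta_le: "\<eta> \<le> \<alpha>\<^sup>2 / (48 * \<beta> ^ 3)"
    and init_pd: "sym_pd S0"
  shows "(\<integral>\<^sup>+ s. W2sq (gauss (fst s) (snd s)) (gauss mh Sh) \<partial>(fbgvi_law gradV hessV \<eta> m0 S0 N))
         \<le> ennreal (exp (- (\<alpha> * real N * \<eta> / 2))) * W2sq (gauss m0 S0) (gauss mh Sh)
           + ennreal (24 * \<beta> * \<eta> * real CARD('d) / \<alpha>)"
proof -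
  interpret gauss_vi V gradV hessV \<alpha> \<beta> mh Sh \<eta>
    by unfold_locales (fact grad hess hess_cont alpha_pos alpha_le_beta strongly_convex smooth min_pd minimizer eta_pos eta_le)+
  let ?c = "1 - \<alpha> * \<eta> / 2" and ?D = "bw_sq mh K m0 S0" and ?r = "24 * \<beta> * \<eta> * real CARD('d) / \<alpha>"
  have c: "?c \<ge> 0" using contraction_factor_pos by simp
  have "?c \<le> exp (- (\<alpha> * \<eta> / 2))" using exp_ge_add_one_self[of "- (\<alpha> * \<eta> / 2)"] by simp
  then have "?c ^ N \<le> exp (- (\<alpha> * \<eta> / 2)) ^ N" using c by (rule power_mono)
  also have "\<dots> = exp (- (\<alpha> * real N * \<eta> / 2))" by (simp add: exp_of_nat_mult[symmetric] mult_ac)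
  finally have p: "?c ^ N \<le> exp (- (\<alpha> * real N * \<eta> / 2))" .
  have "(\<integral>\<^sup>+ s. W2sq (gauss (fst s) (snd s)) (gauss mh Sh) \<partial>(fbgvi_law gradV hessV \<eta> m0 S0 N))
      \<le> (\<integral>\<^sup>+ s. lyap s \<partial>(fbgvi_law gradV hessV \<eta> m0 S0 N))"
    by (intro nn_integral_mono W2sq_le_lyap)
  also have "\<dots> \<le> ennreal (?c ^ N * ?D + ?r)" using law_lyap[OF init_pd, of m0 N] by simp
  also have "\<dots> \<le> ennreal (exp (- (\<alpha> * real N * \<eta> / 2)) * ?D + ?r)"
    using p bw_sq_nonneg by (intro ennreal_leI add_right_mono mult_right_mono) auto
  also have "\<dots> = ennreal (exp (- (\<alpha> * real N * \<eta> / 2))) * ennreal ?D + ennreal ?r"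
    using beta_pos eta_pos alpha_pos bw_sq_nonneg by (intro ennreal_mult_add) simp_all
  also have "ennreal ?D = W2sq (gauss m0 S0) (gauss mh Sh)"
    using W2sq_gauss[OF K(1) init_pd, of m0 mh] by (simp add: K(2))
  finally show ?thesis .
qed

end
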